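(* Any genuine abelian deformation space $\mathcal{D}$ of $G$-trees is Hausdorff in the Gromov topology.
   Context: $G$ is a finitely generated group. A $G$-tree is a simplicial tree $T$ with an action of $G$ by simplicial automorphisms without inversions, always assumed minimal (no proper $G$-invariant subtree). A metric $G$-tree is a $G$-tree with a positive length assigned to each edge, constant on $G$-orbits, so that $G$ acts isometrically; metric $G$-trees are considered up to equivariant isometry. A subgroup of $G$ is elliptic in $T$ if it fixes a point of $T$. A deformation space $\mathcal{D}$ is the set of all metric $G$-trees having the same elliptic subgroups as a given one. It is genuine abelian if, for the trees $T$ it contains, $G$ fixes an end of $T$ and $T$ is not a line. Gromov topology on $\mathcal{D}$: a fundamental system of neighborhoods of $T$ is given by the sets $V_T(X,A,\varepsilon)$, with $X\subset T$ and $A\subset G$ finite and $\varepsilon>0$, where $T'\in V_T(X,A,\varepsilon)$ if and only if there is a map $x\mapsto\tilde x$ from $X$ to $T'$ with $|d(x,gy)-d(\tilde x,g\tilde y)|<\varepsilon$ for all $x,y\in X$, $g\in A$. *)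

theory Defs
  imports "HOL-Analysis.Analysis" "HOL-Algebra.Group_Action" "HOL-Algebra.Generated_Groups"
begin

definition finitely_generated_group :: "('g, 'm) monoid_scheme \<Rightarrow> bool" where
  "finitely_generated_group G \<longleftrightarrow>
     group G \<and> (\<exists>S. finite S \<and> S \<subseteq> carrier G \<and> generate G S = carrier G)"

section \<open>Metric G-trees\<close>

text \<open>
  A simplicial tree is a nonempty connected graph without circuits. Since a tree has neither loops
  nor multiple edges, an edge is the set of its two endpoints.
\<close>

definition is_tree :: "'v set \<Rightarrow> 'v set set \<Rightarrow> bool" where
  "is_tree V E \<longleftrightarrow>
     V \<noteq> {} \<and>
     (\<forall>e\<in>E. e \<subseteq> V \<and> card e = 2) \<and>
     (\<forall>u\<in>V. \<forall>v\<in>V. (\<lambda>x y. {x, y} \<in> E)\<^sup>*\<^sup>* u v) \<and>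
     \<not> (\<exists>xs. distinct xs \<and> 3 \<le> length xs \<and>
             successively (\<lambda>x y. {x, y} \<in> E) xs \<and> {last xs, hd xs} \<in> E)"

record ('g, 'v) gtree =
  verts :: "'v set"
  edges :: "'v set set"
  act :: "'g \<Rightarrow> 'v \<Rightarrow> 'v"
  len :: "'v set \<Rightarrow> real"

definition minimal :: "('g, 'm) monoid_scheme \<Rightarrow> ('g, 'v) gtree \<Rightarrow> bool" where
  "minimal G T \<longleftrightarrow>
     (\<forall>W F. W \<subseteq> verts T \<and> F \<subseteq> edges T \<and> is_tree W F \<and>
            (\<forall>g\<in>carrier G. (\<forall>v\<in>W. act T g v \<in> W) \<and> (\<forall>e\<in>F. act T g ` e \<in> F))
        \<longrightarrow> W = verts T \<and> F = edges T)"

text \<open>The fourth conjunct excludes inversions (no group element exchanges the endpoints of an edge).\<close>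

definition metric_G_tree :: "('g, 'm) monoid_scheme \<Rightarrow> ('g, 'v) gtree \<Rightarrow> bool" where
  "metric_G_tree G T \<longleftrightarrow>
     is_tree (verts T) (edges T) \<and>
     group_action G (verts T) (act T) \<and>
     (\<forall>g\<in>carrier G. \<forall>e\<in>edges T. act T g ` e \<in> edges T) \<and>
     (\<forall>g\<in>carrier G. \<forall>u v. {u, v} \<in> edges T \<longrightarrow> \<not> (act T g u = v \<and> act T g v = u)) \<and>
     minimal G T \<and>
     (\<forall>e\<in>edges T. 0 < len T e) \<and>
     (\<forall>g\<in>carrier G. \<forall>e\<in>edges T. len T (act T g ` e) = len T e)"

section \<open>Geometric realization\<close>

text \<open>
  A point of the tree is given by its barycentric coordinates: a function on the vertices with
  nonnegative values summing to 1, whose support is a vertex or an edge.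
\<close>

definition supp :: "('v \<Rightarrow> real) \<Rightarrow> 'v set" where
  "supp p = {v. p v \<noteq> 0}"

definition points :: "('g, 'v) gtree \<Rightarrow> ('v \<Rightarrow> real) set" where
  "points T = {p. (\<forall>v. 0 \<le> p v) \<and>
                  ((\<exists>v\<in>verts T. supp p = {v}) \<or> supp p \<in> edges T) \<and>
                  (\<Sum>v\<in>supp p. p v) = 1}"

text \<open>
  The affine extension of the action: the point \<open>g p\<close> has at \<open>g v\<close> the coordinate of \<open>p\<close> at \<open>v\<close>.
\<close>

definition act_pt ::
    "('g, 'm) monoid_scheme \<Rightarrow> ('g, 'v) gtree \<Rightarrow> 'g \<Rightarrow> ('v \<Rightarrow> real) \<Rightarrow> ('v \<Rightarrow> real)" where
  "act_pt G T g p = (\<lambda>w. if w \<in> verts T then p (act T (inv\<^bsub>G\<^esub> g) w) else 0)"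

text \<open>
  The path metric in which each edge \<open>e\<close> is isometric to an interval of length \<open>len T e\<close>: the
  infimum of the lengths of strings of points, consecutive points lying in a common closed edge.
  For \<open>p, q\<close> in the edge with endpoints \<open>u, v\<close>, one has \<open>p u + p v = q u + q v = 1\<close>, so that
  \<open>\<bar>p u - q u\<bar> = \<bar>p v - q v\<bar>\<close> is the fraction of the edge between \<open>p\<close> and \<open>q\<close>; below it
  appears as half the sum over both endpoints.
\<close>

inductive string_between ::
    "('g, 'v) gtree \<Rightarrow> ('v \<Rightarrow> real) \<Rightarrow> ('v \<Rightarrow> real) \<Rightarrow> real \<Rightarrow> bool" for T where
  string_refl: "p \<in> points T \<Longrightarrow> string_between T p p 0"
| string_step: "\<lbrakk>p \<in> points T; q \<in> points T; e \<in> edges T; supp p \<subseteq> e; supp q \<subseteq> e;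
          string_between T q r L\<rbrakk>
         \<Longrightarrow> string_between T p r (len T e * (\<Sum>v\<in>e. \<bar>p v - q v\<bar>) / 2 + L)"

definition tdist :: "('g, 'v) gtree \<Rightarrow> ('v \<Rightarrow> real) \<Rightarrow> ('v \<Rightarrow> real) \<Rightarrow> real" where
  "tdist T p q = Inf {L. string_between T p q L}"

definition equivariant_isometry ::
    "('g, 'm) monoid_scheme \<Rightarrow> ('g, 'v) gtree \<Rightarrow> ('g, 'v) gtree \<Rightarrow>
     (('v \<Rightarrow> real) \<Rightarrow> ('v \<Rightarrow> real)) \<Rightarrow> bool" where
  "equivariant_isometry G T T' f \<longleftrightarrow>
     bij_betw f (points T) (points T') \<and>
     (\<forall>p\<in>points T. \<forall>q\<in>points T. tdist T' (f p) (f q) = tdist T p q) \<and>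
     (\<forall>g\<in>carrier G. \<forall>p\<in>points T. f (act_pt G T g p) = act_pt G T' g (f p))"

definition isometry_rel :: "('g, 'm) monoid_scheme \<Rightarrow> (('g, 'v) gtree \<times> ('g, 'v) gtree) set" where
  "isometry_rel G = {(T, T'). metric_G_tree G T \<and> metric_G_tree G T' \<and>
                              (\<exists>f. equivariant_isometry G T T' f)}"

section \<open>Genuine abelian deformation spaces\<close>

definition elliptic :: "('g, 'm) monoid_scheme \<Rightarrow> ('g, 'v) gtree \<Rightarrow> 'g set \<Rightarrow> bool" where
  "elliptic G T H \<longleftrightarrow> (\<exists>p\<in>points T. \<forall>h\<in>H. act_pt G T h p = p)"

text \<open>
  The elements of a deformation space are classes of metric G-trees up to equivariant isometry.
\<close>

definition deformation_space :: "('g, 'm) monoid_scheme \<Rightarrow> ('g, 'v) gtree set set \<Rightarrow> bool" where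
  "deformation_space G D \<longleftrightarrow>
     (\<exists>T0 :: ('g, 'v) gtree. metric_G_tree G T0 \<and>
           D = {T. metric_G_tree G T \<and>
                   (\<forall>H. subgroup H G \<longrightarrow> (elliptic G T H \<longleftrightarrow> elliptic G T0 H))}
               // isometry_rel G)"

definition rays :: "('g, 'v) gtree \<Rightarrow> (nat \<Rightarrow> 'v) set" where
  "rays T = {r. inj r \<and> range r \<subseteq> verts T \<and> (\<forall>i. {r i, r (Suc i)} \<in> edges T)}"

definition cofinal_rel :: "('g, 'v) gtree \<Rightarrow> ((nat \<Rightarrow> 'v) \<times> (nat \<Rightarrow> 'v)) set" where
  "cofinal_rel T = {(r, s). r \<in> rays T \<and> s \<in> rays T \<and> (\<exists>m n. \<forall>i. r (m + i) = s (n + i))}"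

definition ends :: "('g, 'v) gtree \<Rightarrow> (nat \<Rightarrow> 'v) set set" where
  "ends T = rays T // cofinal_rel T"

definition fixes_an_end :: "('g, 'm) monoid_scheme \<Rightarrow> ('g, 'v) gtree \<Rightarrow> bool" where
  "fixes_an_end G T \<longleftrightarrow>
     (\<exists>\<omega>\<in>ends T. \<forall>g\<in>carrier G. (\<lambda>r. act T g \<circ> r) ` \<omega> = \<omega>)"

definition is_line :: "('g, 'v) gtree \<Rightarrow> bool" where
  "is_line T \<longleftrightarrow>
     (\<exists>f :: int \<Rightarrow> 'v. bij_betw f UNIV (verts T) \<and> edges T = range (\<lambda>i. {f i, f (i + 1)}))"

definition genuine_abelian :: "('g, 'm) monoid_scheme \<Rightarrow> ('g, 'v) gtree set set \<Rightarrow> bool" where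
  "genuine_abelian G D \<longleftrightarrow> (\<forall>C\<in>D. \<forall>T\<in>C. fixes_an_end G T \<and> \<not> is_line T)"

section \<open>Gromov topology\<close>

text \<open>The condition \<open>T' \<in> V\<^sub>T(X,A,\<epsilon>)\<close>.\<close>

definition gromov_close ::
    "('g, 'm) monoid_scheme \<Rightarrow> ('g, 'v) gtree \<Rightarrow> ('v \<Rightarrow> real) set \<Rightarrow> 'g set \<Rightarrow> real \<Rightarrow>
     ('g, 'v) gtree \<Rightarrow> bool" where
  "gromov_close G T X A \<epsilon> T' \<longleftrightarrow>
     (\<exists>f. f ` X \<subseteq> points T' \<and>
        (\<forall>x\<in>X. \<forall>y\<in>X. \<forall>g\<in>A.
           \<bar>tdist T x (act_pt G T g y) - tdist T' (f x) (act_pt G T' g (f y))\<bar> < \<epsilon>))"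

text \<open>
  The set \<open>V\<^sub>T(X,A,\<epsilon>)\<close> as a subset of \<open>D\<close>. The defining condition is invariant under equivariant
  isometry, so it does not matter which representative \<open>T'\<close> of the class \<open>C'\<close> is used.
\<close>

definition gromov_nbhd ::
    "('g, 'm) monoid_scheme \<Rightarrow> ('g, 'v) gtree set set \<Rightarrow> ('g, 'v) gtree \<Rightarrow>
     ('v \<Rightarrow> real) set \<Rightarrow> 'g set \<Rightarrow> real \<Rightarrow> ('g, 'v) gtree set set" where
  "gromov_nbhd G D T X A \<epsilon> = {C' \<in> D. \<exists>T'\<in>C'. gromov_close G T X A \<epsilon> T'}"

definition gromov_open ::
    "('g, 'm) monoid_scheme \<Rightarrow> ('g, 'v) gtree set set \<Rightarrow> ('g, 'v) gtree set set \<Rightarrow> bool" where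
  "gromov_open G D U \<longleftrightarrow> U \<subseteq> D \<and>
     (\<forall>C\<in>U. \<forall>T\<in>C. \<exists>X A \<epsilon>. finite X \<and> X \<subseteq> points T \<and> finite A \<and> A \<subseteq> carrier G \<and> 0 < \<epsilon> \<and>
        gromov_nbhd G D T X A \<epsilon> \<subseteq> U)"

definition gromov_topology ::
    "('g, 'm) monoid_scheme \<Rightarrow> ('g, 'v) gtree set set \<Rightarrow> ('g, 'v) gtree set topology" where
  "gromov_topology G D = topology (gromov_open G D)"

lemma gromov_closeI:
  assumes "f ` X \<subseteq> points T'"
    and "\<And>x y g. \<lbrakk>x \<in> X; y \<in> X; g \<in> A\<rbrakk> \<Longrightarrow>
      \<bar>tdist T x (act_pt G T g y) - tdist T' (f x) (act_pt G T' g (f y))\<bar> < \<epsilon>"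
  shows "gromov_close G T X A \<epsilon> T'"
  unfolding gromov_close_def by (rule exI[of _ f]) (simp add: assms)

lemma gromov_nbhd_mono:
  assumes "X \<subseteq> X'" "A \<subseteq> A'" "\<epsilon>' \<le> \<epsilon>"
  shows "gromov_nbhd G D T X' A' \<epsilon>' \<subseteq> gromov_nbhd G D T X A \<epsilon>"
proof -
  have "gromov_close G T X A \<epsilon> T'" if close: "gromov_close G T X' A' \<epsilon>' T'" for T'
  proof -
    obtain f where *: "f ` X' \<subseteq> points T' \<and> (\<forall>x\<in>X'. \<forall>y\<in>X'. \<forall>g\<in>A'.
        \<bar>tdist T x (act_pt G T g y) - tdist T' (f x) (act_pt G T' g (f y))\<bar> < \<epsilon>')"
      using close unfolding gromov_close_def by (rule exE)
    note f = conjunct1[OF *] and fd = conjunct2[OF *, rule_format]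
    show ?thesis
    proof (rule gromov_closeI)
      show "f ` X \<subseteq> points T'" using f assms(1) by blast
      fix x y g assume "x \<in> X" "y \<in> X" "g \<in> A"
      then have "x \<in> X'" "y \<in> X'" "g \<in> A'" using assms(1,2) by blast+
      from less_le_trans[OF fd[OF this] assms(3)]
      show "\<bar>tdist T x (act_pt G T g y) - tdist T' (f x) (act_pt G T' g (f y))\<bar> < \<epsilon>" .
    qed
  qed
  then show ?thesis unfolding gromov_nbhd_def by blast
qed

lemma gromov_openE:
  assumes "gromov_open G D U" "C \<in> U" "T \<in> C"
  obtains X A \<epsilon> where "finite X" "X \<subseteq> points T" "finite A" "A \<subseteq> carrier G" "0 < \<epsilon>"
    "gromov_nbhd G D T X A \<epsilon> \<subseteq> U"
  using assms(1)[unfolded gromov_open_def, THEN conjunct2, rule_format, OF assms(2,3)]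
  by (elim exE conjE) (rule that)

lemma gromov_openI:
  assumes "U \<subseteq> D"
    and "\<And>C T. \<lbrakk>C \<in> U; T \<in> C\<rbrakk> \<Longrightarrow> \<exists>X A \<epsilon>. finite X \<and> X \<subseteq> points T \<and> finite A \<and>
      A \<subseteq> carrier G \<and> 0 < \<epsilon> \<and> gromov_nbhd G D T X A \<epsilon> \<subseteq> U"
  shows "gromov_open G D U"
  unfolding gromov_open_def using assms by (intro conjI ballI)

lemma istopology_gromov_open: "istopology (gromov_open G D)"
  unfolding istopology_def
proof (intro conjI allI impI)
  fix S U assume S: "gromov_open G D S" and U: "gromov_open G D U"
  show "gromov_open G D (S \<inter> U)"
  proof (rule gromov_openI)
    show "S \<inter> U \<subseteq> D" using S by (auto simp: gromov_open_def)
    fix C T assume C: "C \<in> S \<inter> U" and T: "T \<in> C"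
    obtain X A \<epsilon> where 1: "finite X" "X \<subseteq> points T" "finite A" "A \<subseteq> carrier G" "0 < \<epsilon>"
      "gromov_nbhd G D T X A \<epsilon> \<subseteq> S"
      by (rule gromov_openE[OF S IntD1[OF C] T])
    obtain Y B \<delta> where 2: "finite Y" "Y \<subseteq> points T" "finite B" "B \<subseteq> carrier G" "0 < \<delta>"
      "gromov_nbhd G D T Y B \<delta> \<subseteq> U"
      by (rule gromov_openE[OF U IntD2[OF C] T])
    have "gromov_nbhd G D T (X \<union> Y) (A \<union> B) (min \<epsilon> \<delta>) \<subseteq> gromov_nbhd G D T X A \<epsilon>"
      "gromov_nbhd G D T (X \<union> Y) (A \<union> B) (min \<epsilon> \<delta>) \<subseteq> gromov_nbhd G D T Y B \<delta>"
      by (rule gromov_nbhd_mono; simp)+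
    then have "gromov_nbhd G D T (X \<union> Y) (A \<union> B) (min \<epsilon> \<delta>) \<subseteq> S \<inter> U"
      using 1(6) 2(6) by (meson Int_greatest subset_trans)
    then show "\<exists>X A \<epsilon>. finite X \<and> X \<subseteq> points T \<and> finite A \<and> A \<subseteq> carrier G \<and> 0 < \<epsilon> \<and>
        gromov_nbhd G D T X A \<epsilon> \<subseteq> S \<inter> U"
      using 1(1-5) 2(1-5)
      by (intro exI[of _ "X \<union> Y"] exI[of _ "A \<union> B"] exI[of _ "min \<epsilon> \<delta>"] conjI) simp_all
  qed
next
  fix K assume K: "\<forall>S\<in>K. gromov_open G D S"
  show "gromov_open G D (\<Union> K)"
  proof (rule gromov_openI)
    show "\<Union> K \<subseteq> D" using K by (auto simp: gromov_open_def)
    fix C T assume "C \<in> \<Union> K" and T: "T \<in> C"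
    then obtain S where S: "S \<in> K" "C \<in> S" by auto
    obtain X A \<epsilon> where 1: "finite X" "X \<subseteq> points T" "finite A" "A \<subseteq> carrier G" "0 < \<epsilon>"
      "gromov_nbhd G D T X A \<epsilon> \<subseteq> S"
      by (rule gromov_openE[OF K[rule_format, OF S(1)] S(2) T])
    moreover have "S \<subseteq> \<Union> K" using S(1) by auto
    ultimately show "\<exists>X A \<epsilon>. finite X \<and> X \<subseteq> points T \<and> finite A \<and> A \<subseteq> carrier G \<and> 0 < \<epsilon> \<and>
        gromov_nbhd G D T X A \<epsilon> \<subseteq> \<Union> K"
      by (intro exI[of _ X] exI[of _ A] exI[of _ \<epsilon>] conjI) (assumption | rule subset_trans)+
  qed
qed

lemma openin_gromov: "openin (gromov_topology G D) = gromov_open G D"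
  by (simp add: gromov_topology_def istopology_gromov_open topology_inverse')

section \<open>The sets \<open>V\<^sub>T(X,A,\<epsilon>)\<close> are open neighborhoods\<close>

lemma act_pt_in_points:
  assumes T: "metric_G_tree G T" and g: "g \<in> carrier G" and p: "p \<in> points T"
  shows "act_pt G T g p \<in> points T"
proof -
  interpret group_action G "verts T" "act T" using T by (simp add: metric_G_tree_def)
  interpret group_hom G "BijGroup (verts T)" "act T" by (rule group_hom)
  have sub: "supp p \<subseteq> verts T"
    using p T unfolding points_def metric_G_tree_def is_tree_def by auto
  have ig: "inv\<^bsub>G\<^esub> g \<in> carrier G" using g by simp
  have inv1: "act T (inv\<^bsub>G\<^esub> g) (act T g v) = v" if "v \<in> verts T" for v
    using orbit_sym_aux g that by blast
  have inv2: "act T g (act T (inv\<^bsub>G\<^esub> g) v) = v" if "v \<in> verts T" for v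
    using orbit_sym_aux[OF ig that refl] g by simp
  have mem: "act T h v \<in> verts T" if "h \<in> carrier G" "v \<in> verts T" for h v
    using element_image that by blast
  have s: "supp (act_pt G T g p) = act T g ` supp p"
  proof (intro equalityI subsetI)
    fix w assume "w \<in> supp (act_pt G T g p)"
    then have w: "w \<in> verts T" "act T (inv\<^bsub>G\<^esub> g) w \<in> supp p"
      by (auto simp: supp_def act_pt_def split: if_splits)
    then show "w \<in> act T g ` supp p" using inv2 by (metis imageI)
  next
    fix w assume "w \<in> act T g ` supp p"
    then show "w \<in> supp (act_pt G T g p)"
      using sub inv1 mem[OF g] by (auto simp: supp_def act_pt_def)
  qed
  have inj: "inj_on (act T g) (supp p)" using inj_prop[OF g] sub by (rule inj_on_subset)
  have "(\<Sum>v\<in>supp (act_pt G T g p). act_pt G T g p v) = (\<Sum>v\<in>supp p. act_pt G T g p (act T g v))"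
    unfolding s by (simp add: sum.reindex[OF inj])
  also have "\<dots> = (\<Sum>v\<in>supp p. p v)"
    using sub inv1 mem[OF g] by (intro sum.cong) (auto simp: act_pt_def)
  finally have sum: "(\<Sum>v\<in>supp (act_pt G T g p). act_pt G T g p v) = 1"
    using p by (simp add: points_def)
  have nonneg: "0 \<le> act_pt G T g p v" for v
    using p by (simp add: points_def act_pt_def)
  have "(\<exists>v\<in>verts T. supp (act_pt G T g p) = {v}) \<or> supp (act_pt G T g p) \<in> edges T"
  proof (cases "supp p \<in> edges T")
    case True
    then show ?thesis using T g unfolding s metric_G_tree_def by blast
  next
    case False
    then obtain v where "v \<in> verts T" "supp p = {v}" using p by (auto simp: points_def)
    then show ?thesis using mem[OF g] unfolding s by auto
  qed
  then show ?thesis using sum nonneg by (simp add: points_def)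
qed

lemma equiv_isometry_rel:
  fixes G :: "('g, 'm) monoid_scheme"
  shows "equiv {T :: ('g, 'v) gtree. metric_G_tree G T} (isometry_rel G)"
proof (rule equivI)
  show "isometry_rel G \<subseteq> {T :: ('g, 'v) gtree. metric_G_tree G T} \<times> {T. metric_G_tree G T}"
    by (auto simp: isometry_rel_def)
  show "refl_on {T :: ('g, 'v) gtree. metric_G_tree G T} (isometry_rel G)"
    by (auto simp: refl_on_def isometry_rel_def equivariant_isometry_def intro!: exI[of _ id])
  show "sym (isometry_rel G :: (('g, 'v) gtree \<times> ('g, 'v) gtree) set)"
  proof (rule symI)
    fix T T' :: "('g, 'v) gtree" assume "(T, T') \<in> isometry_rel G"
    then obtain f where T: "metric_G_tree G T" "metric_G_tree G T'"
      and f: "bij_betw f (points T) (points T')"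
        "\<forall>p\<in>points T. \<forall>q\<in>points T. tdist T' (f p) (f q) = tdist T p q"
        "\<forall>g\<in>carrier G. \<forall>p\<in>points T. f (act_pt G T g p) = act_pt G T' g (f p)"
      by (auto simp: isometry_rel_def equivariant_isometry_def)
    define h where "h = inv_into (points T) f"
    have h: "bij_betw h (points T') (points T)"
      using f(1) by (simp add: h_def bij_betw_inv_into)
    have hm: "h p \<in> points T" if "p \<in> points T'" for p using h that bij_betwE by blast
    have fh: "f (h p) = p" if "p \<in> points T'" for p
      using f(1) that by (simp add: h_def bij_betw_inv_into_right)
    have hf: "h (f p) = p" if "p \<in> points T" for p
      using f(1) that by (simp add: h_def bij_betw_inv_into_left)
    have "tdist T (h p) (h q) = tdist T' p q" if "p \<in> points T'" "q \<in> points T'" for p q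
      using f(2)[rule_format, OF hm[OF that(1)] hm[OF that(2)]] fh that by simp
    moreover have "h (act_pt G T' g p) = act_pt G T g (h p)"
      if "g \<in> carrier G" "p \<in> points T'" for g p
    proof -
      have "f (act_pt G T g (h p)) = act_pt G T' g p"
        using f(3) that(1) hm[OF that(2)] fh[OF that(2)] by simp
      then show ?thesis
        using hf[OF act_pt_in_points[OF T(1) that(1) hm[OF that(2)]]] by simp
    qed
    ultimately show "(T', T) \<in> isometry_rel G"
      using T h by (auto simp: isometry_rel_def equivariant_isometry_def)
  qed
  show "trans (isometry_rel G :: (('g, 'v) gtree \<times> ('g, 'v) gtree) set)"
  proof (rule transI)
    fix T T' T'' :: "('g, 'v) gtree"
    assume "(T, T') \<in> isometry_rel G" "(T', T'') \<in> isometry_rel G"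
    then obtain f h where T: "metric_G_tree G T" "metric_G_tree G T''"
      and f: "equivariant_isometry G T T' f" and h: "equivariant_isometry G T' T'' h"
      by (auto simp: isometry_rel_def)
    have fm: "f p \<in> points T'" if "p \<in> points T" for p
      using f that by (auto simp: equivariant_isometry_def dest: bij_betwE)
    have "equivariant_isometry G T T'' (h \<circ> f)"
      using f h fm unfolding equivariant_isometry_def by (auto intro: bij_betw_trans)
    then show "(T, T'') \<in> isometry_rel G" using T by (auto simp: isometry_rel_def)
  qed
qed

lemma openin_gromov_nbhd:
  fixes T :: "('g, 'v) gtree"
  assumes D: "deformation_space G D" and X: "finite X" and A: "finite A" "A \<subseteq> carrier G"
  shows "openin (gromov_topology G D) (gromov_nbhd G D T X A \<epsilon>)"
  unfolding openin_gromov
proof (rule gromov_openI)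
  show "gromov_nbhd G D T X A \<epsilon> \<subseteq> D" by (auto simp: gromov_nbhd_def)
  fix C S assume C: "C \<in> gromov_nbhd G D T X A \<epsilon>" and S: "S \<in> C"
  then obtain T' where CD: "C \<in> D" and T': "T' \<in> C" and close: "gromov_close G T X A \<epsilon> T'"
    unfolding gromov_nbhd_def by blast
  obtain f where *: "f ` X \<subseteq> points T' \<and> (\<forall>x\<in>X. \<forall>y\<in>X. \<forall>g\<in>A.
       \<bar>tdist T x (act_pt G T g y) - tdist T' (f x) (act_pt G T' g (f y))\<bar> < \<epsilon>)"
    using close unfolding gromov_close_def by (rule exE)
  note f = conjunct1[OF *] and fd = conjunct2[OF *, rule_format]
  obtain Q where Q: "Q \<subseteq> {T. metric_G_tree G T}" "D = Q // isometry_rel G"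
    using D unfolding deformation_space_def by (elim exE conjE) (rule that, auto)
  then have "C \<in> {T. metric_G_tree G T} // isometry_rel G"
    using CD by (auto simp: quotient_def)
  then have "(T', S) \<in> isometry_rel G"
    using quotient_eq_iff[OF equiv_isometry_rel _ _ T' S] by blast
  then obtain h where h: "equivariant_isometry G T' S h" and mT': "metric_G_tree G T'"
    by (auto simp: isometry_rel_def)
  note hb = h[unfolded equivariant_isometry_def, THEN conjunct1]
    and hd = h[unfolded equivariant_isometry_def, THEN conjunct2, THEN conjunct1]
    and hg = h[unfolded equivariant_isometry_def, THEN conjunct2, THEN conjunct2]
  define k where "k = h \<circ> f"
  have k: "k ` X \<subseteq> points S"
    using image_mono[OF f, of h] bij_betw_imp_surj_on[OF hb] by (simp add: k_def image_comp)
  define \<Delta> where "\<Delta> = (\<lambda>(x, y, g). \<epsilon> - \<bar>tdist T x (act_pt G T g y) - tdist S (k x) (act_pt G S g (k y))\<bar>)"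
  have pos: "0 < \<Delta> (x, y, g)" if "x \<in> X" "y \<in> X" "g \<in> A" for x y g
  proof -
    have "g \<in> carrier G" "f x \<in> points T'" "f y \<in> points T'" using that A f by auto
    note fx = this
    have "tdist S (h (f x)) (h (act_pt G T' g (f y))) = tdist T' (f x) (act_pt G T' g (f y))"
      using hd fx(2) act_pt_in_points[OF mT' fx(1,3)] by blast
    also have "h (act_pt G T' g (f y)) = act_pt G S g (h (f y))"
      using hg fx(1,3) by blast
    finally have "tdist S (k x) (act_pt G S g (k y)) = tdist T' (f x) (act_pt G T' g (f y))"
      by (simp add: k_def)
    then show ?thesis using fd[OF that] by (simp add: \<Delta>_def)
  qed
  define \<delta> where "\<delta> = Min (insert 1 (\<Delta> ` (X \<times> X \<times> A)))"
  have fin: "finite (insert 1 (\<Delta> ` (X \<times> X \<times> A)))" using X A by simp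
  have \<delta>0: "0 < \<delta>" unfolding \<delta>_def using fin pos by (subst Min_gr_iff) auto
  have \<delta>le: "\<delta> \<le> \<Delta> (x, y, g)" if "x \<in> X" "y \<in> X" "g \<in> A" for x y g
    unfolding \<delta>_def using fin that by (intro Min_le) auto
  have "gromov_close G T X A \<epsilon> T''" if close: "gromov_close G S (k ` X) A \<delta> T''" for T''
  proof -
    obtain m where *: "m ` k ` X \<subseteq> points T'' \<and> (\<forall>x\<in>k ` X. \<forall>y\<in>k ` X. \<forall>g\<in>A.
       \<bar>tdist S x (act_pt G S g y) - tdist T'' (m x) (act_pt G T'' g (m y))\<bar> < \<delta>)"
      using close unfolding gromov_close_def by (rule exE)
    note m = conjunct1[OF *] and md = conjunct2[OF *, rule_format]
    show ?thesis
    proof (rule gromov_closeI)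
      show "(m \<circ> k) ` X \<subseteq> points T''" using m by (simp add: image_comp)
      fix x y g assume "x \<in> X" "y \<in> X" "g \<in> A"
      then show "\<bar>tdist T x (act_pt G T g y) - tdist T'' ((m \<circ> k) x) (act_pt G T'' g ((m \<circ> k) y))\<bar> < \<epsilon>"
        using md[OF imageI imageI, of x y g] \<delta>le[of x y g] by (simp add: \<Delta>_def)
    qed
  qed
  then have sub: "gromov_nbhd G D S (k ` X) A \<delta> \<subseteq> gromov_nbhd G D T X A \<epsilon>"
    unfolding gromov_nbhd_def by blast
  show "\<exists>X' A' \<epsilon>'. finite X' \<and> X' \<subseteq> points S \<and> finite A' \<and> A' \<subseteq> carrier G \<and> 0 < \<epsilon>' \<and>
      gromov_nbhd G D S X' A' \<epsilon>' \<subseteq> gromov_nbhd G D T X A \<epsilon>"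
    by (rule exI[of _ "k ` X"], rule exI[of _ A], rule exI[of _ \<delta>])
      (simp add: X A k \<delta>0 sub)
qed

lemma topspace_gromov:
  assumes "deformation_space G D"
  shows "topspace (gromov_topology G D) = D"
proof
  show "topspace (gromov_topology G D) \<subseteq> D"
    using openin_topspace[of "gromov_topology G D"] unfolding openin_gromov gromov_open_def
    by (rule conjunct1)
  have "gromov_open G D D"
  proof (rule gromov_openI)
    show "\<exists>X A \<epsilon>. finite X \<and> X \<subseteq> points T \<and> finite A \<and> A \<subseteq> carrier G \<and> 0 < \<epsilon> \<and>
        gromov_nbhd G D T X A \<epsilon> \<subseteq> D" for T
      by (rule exI[of _ "{}"], rule exI[of _ "{}"], rule exI[of _ "1::real"])
        (simp add: gromov_nbhd_def)
  qed simp
  then show "D \<subseteq> topspace (gromov_topology G D)"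
    by (metis openin_gromov openin_subset)
qed

end

theory Submission
  imports Defs
begin

text \<open>
  Let \<open>T\<close>, \<open>T'\<close> be two trees of the space that cannot be separated. A fixed end orients a tree: every
  vertex \<open>v\<close> has a parent \<open>\<pi> v\<close>, the next vertex towards the end, and \<open>G\<close> commutes with \<open>\<pi>\<close>. So each point
  can be pushed upwards along the ray to the end, the distance of two points is determined by their
  heights and by the height at which their rays merge, and \<open>g\<close> shifts all heights by a constant \<open>\<tau> g\<close>,
  which vanishes exactly on the elliptic elements and so vanishes simultaneously in all trees of the
  space.

  Fix \<open>g\<close> with \<open>\<tau> g > 0\<close>. By minimality every point of \<open>T\<close> is a translate of a point of the axis of \<open>g\<close>,
  and as \<open>T\<close> is not a line, some elliptic \<open>e\<close> moves points of the axis; \<open>e\<close> can be chosen to work for \<open>T\<close>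
  and \<open>T'\<close>. Along the axis the displacement \<open>d(x, ex)\<close>, where positive, decreases with slope \<open>-2\<close>, so that
  a point of the axis is determined by its positive displacement, and approximately so for points
  near the axis. Hence pairing the points \<open>x\<close> and \<open>x'\<close> of the two axes with the same positive
  displacement gives, in a tree close to both \<open>T\<close> and \<open>T'\<close>, approximations of \<open>x\<close> and \<open>x'\<close> that are near
  each other. It follows that \<open>d(x, by) = d(x', by')\<close> for all \<open>b \<in> G\<close>, and \<open>bx \<mapsto> bx'\<close> is an equivariant
  isometry from \<open>T\<close> to \<open>T'\<close>.
\<close>

section \<open>Rays and the parent map of an end\<close>

text \<open>A repetition \<open>w = r k\<close> would force \<open>k \<ge> 2\<close>, and then
  \<open>r 0\<close>, ..., \<open>r k\<close> closed up by the edge from \<open>w\<close> to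
  \<open>r 0\<close> would be a circuit.\<close>

lemma ray_cons:
  assumes tree: "is_tree (verts T) (edges T)" and r: "r \<in> rays T"
    and w: "{w, r 0} \<in> edges T" "w \<noteq> r 1"
  shows "case_nat w r \<in> rays T"
proof -
  have E: "e \<subseteq> verts T" "card e = 2" if "e \<in> edges T" for e
    using tree that by (auto simp: is_tree_def)
  have nocycle: "\<not> (distinct xs \<and> 3 \<le> length xs \<and>
      successively (\<lambda>x y. {x, y} \<in> edges T) xs \<and> {last xs, hd xs} \<in> edges T)" for xs
    using tree unfolding is_tree_def by blast
  have inj: "inj r" and rE: "{r i, r (Suc i)} \<in> edges T" for i
    using r by (auto simp: rays_def)
  have w_new: "w \<noteq> r k" for k
  proof
    assume k: "w = r k"
    have "k \<noteq> 0" using E(2)[OF w(1)] k by (cases k) auto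
    moreover have "k \<noteq> 1" using w(2) k by auto
    ultimately have k2: "2 \<le> k" by auto
    have "successively (\<lambda>x y. {x, y} \<in> edges T) (map r [0..<Suc k])"
      by (simp add: successively_conv_nth rE del: upt_Suc)
    moreover have "distinct (map r [0..<Suc k])"
      using inj by (simp add: distinct_map inj_on_def inj_def del: upt_Suc)
    moreover have "last (map r [0..<Suc k]) = r k" by simp
    moreover have "hd (map r [0..<Suc k]) = r 0" by (simp add: hd_map del: upt_Suc)
    ultimately show False
      using nocycle[of "map r [0..<Suc k]"] k k2 w(1) by simp
  qed
  have "inj (case_nat w r)"
    using inj w_new by (auto simp: inj_def split: nat.splits)
  moreover have "w \<in> verts T" using E(1)[OF w(1)] by simp
  then have "range (case_nat w r) \<subseteq> verts T"
    using r unfolding rays_def by (force split: nat.splits)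
  moreover have "{case_nat w r i, case_nat w r (Suc i)} \<in> edges T" for i
    using w(1) rE by (cases i) auto
  ultimately show ?thesis by (simp add: rays_def)
qed

lemma ray_shift: "r \<in> rays T \<Longrightarrow> (\<lambda>i. r (Suc i)) \<in> rays T"
  by (auto simp: rays_def inj_def)

text \<open>If the rays separated at once, running backwards along \<open>s\<close> to the common
  origin and then along \<open>r\<close> would never repeat a vertex. The common tail provides a
  repetition.\<close>

lemma cofinal_ray_next_unique:
  assumes tree: "is_tree (verts T) (edges T)" and rs: "(r, s) \<in> cofinal_rel T" and 0: "r 0 = s 0"
  shows "r 1 = s 1"
proof (rule ccontr)
  assume ne: "r 1 \<noteq> s 1"
  have r: "r \<in> rays T" and s: "s \<in> rays T" using rs by (auto simp: cofinal_rel_def)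
  have injs: "inj s" and sE: "{s i, s (Suc i)} \<in> edges T" for i using s by (auto simp: rays_def)
  define q where "q n = (\<lambda>i. if i < n then s (n - i) else r (i - n))" for n :: nat
  have q: "q n \<in> rays T" for n
  proof (induction n)
    case 0
    show ?case using r by (simp add: q_def)
  next
    case (Suc n)
    have eq: "q (Suc n) = case_nat (s (Suc n)) (q n)"
      by (auto simp: q_def fun_eq_iff split: nat.splits)
    have "q n 0 = s n" by (auto simp: q_def 0)
    moreover have "s (Suc n) \<noteq> q n 1"
    proof (cases "n = 0")
      case True
      then show ?thesis using ne by (simp add: q_def)
    next
      case False
      then have "q n 1 = s (n - 1)" by (cases "n = 1") (auto simp: q_def 0)
      then show ?thesis using injs by (auto dest: injD)
    qed
    ultimately show ?case
      unfolding eq using sE[of n] by (intro ray_cons[OF tree Suc]) (auto simp: insert_commute)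
  qed
  obtain m n where mn: "\<And>i. r (m + i) = s (n + i)" using rs by (auto simp: cofinal_rel_def)
  have "q (Suc n) 0 = q (Suc n) (Suc (n + Suc m))"
    using mn[of 1] by (simp add: q_def)
  then show False using q[of "Suc n"] by (auto simp: rays_def dest: injD)
qed

lemma cofinal_rel_sym: "(r, s) \<in> cofinal_rel T \<Longrightarrow> (s, r) \<in> cofinal_rel T"
  unfolding cofinal_rel_def by clarsimp metis

lemma cofinal_rel_trans:
  assumes "(r, s) \<in> cofinal_rel T" "(s, t) \<in> cofinal_rel T"
  shows "(r, t) \<in> cofinal_rel T"
proof -
  obtain m n m' n' where "\<And>i. r (m + i) = s (n + i)" "\<And>i. s (m' + i) = t (n' + i)"
    using assms unfolding cofinal_rel_def by auto
  then have "r (m + m' + i) = t (n + n' + i)" for i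
    by (metis add.assoc add.left_commute)
  then show ?thesis using assms unfolding cofinal_rel_def by blast
qed

text \<open>The map \<open>\<pi>\<close> sends each vertex to its neighbour in the direction of the fixed end.\<close>

locale end_tree =
  fixes G :: "('g, 'm) monoid_scheme" and T :: "('g, 'v) gtree" and \<pi> :: "'v \<Rightarrow> 'v"
  assumes finitely_generated: "finitely_generated_group G"
    and metric_tree: "metric_G_tree G T"
    and not_line: "\<not> is_line T"
    and parent_in: "v \<in> verts T \<Longrightarrow> \<pi> v \<in> verts T"
    and edges_parent: "edges T = (\<lambda>v. {v, \<pi> v}) ` verts T"
    and parent_acyclic: "v \<in> verts T \<Longrightarrow> 0 < n \<Longrightarrow> (\<pi> ^^ n) v \<noteq> v"
    and parent_merge: "u \<in> verts T \<Longrightarrow> v \<in> verts T \<Longrightarrow> \<exists>m n. (\<pi> ^^ m) u = (\<pi> ^^ n) v"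
    and parent_act: "g \<in> carrier G \<Longrightarrow> v \<in> verts T \<Longrightarrow> \<pi> (act T g v) = act T g (\<pi> v)"

text \<open>Starting from one ray of the fixed end, each edge either follows the current ray or can
  be prefixed to it, so every vertex starts a ray of \<omega>. Its second vertex is well defined by
  \<open>cofinal_ray_next_unique\<close>; this is the parent.\<close>

lemma end_tree_exists:
  assumes fg: "finitely_generated_group G" and T: "metric_G_tree G T"
    and fix_end: "fixes_an_end G T" and not_line: "\<not> is_line T"
  shows "\<exists>\<pi>. end_tree G T \<pi>"
proof -
  have tree: "is_tree (verts T) (edges T)" using T by (simp add: metric_G_tree_def)
  have E: "e \<subseteq> verts T" "card e = 2" if "e \<in> edges T" for e
    using tree that by (auto simp: is_tree_def)
  obtain \<omega> where \<omega>: "\<omega> \<in> ends T" "\<And>g. g \<in> carrier G \<Longrightarrow> (\<lambda>r. act T g \<circ> r) ` \<omega> = \<omega>"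
    using fix_end by (auto simp: fixes_an_end_def)
  obtain r0 where r0: "r0 \<in> rays T" "\<omega> = cofinal_rel T `` {r0}"
    using \<omega>(1) by (auto simp: ends_def quotient_def)
  have cof: "(r, s) \<in> cofinal_rel T" if "r \<in> \<omega>" "s \<in> \<omega>" for r s
    using that unfolding r0(2) by (auto intro: cofinal_rel_trans dest: cofinal_rel_sym)
  have ray: "r \<in> rays T" if "r \<in> \<omega>" for r
    using that unfolding r0(2) by (auto simp: cofinal_rel_def)
  have in_\<omega>: "s \<in> \<omega>" if "r \<in> \<omega>" "s \<in> rays T" "\<And>i. r (m + i) = s (n + i)" for r s m n
  proof -
    have "(r, s) \<in> cofinal_rel T" using that ray unfolding cofinal_rel_def by auto
    then show ?thesis using that(1) unfolding r0(2) by (auto intro: cofinal_rel_trans)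
  qed
  have shift: "(\<lambda>i. r (Suc i)) \<in> \<omega>" if "r \<in> \<omega>" for r
    by (rule in_\<omega>[of r _ 1 0]) (use that ray_shift[OF ray] in auto)
  have cons: "case_nat w r \<in> \<omega>" if "r \<in> \<omega>" "{w, r 0} \<in> edges T" "w \<noteq> r 1" for w r
    by (rule in_\<omega>[of r _ 0 1]) (use that ray_cons[OF tree ray] in auto)
  have r0\<omega>: "r0 \<in> \<omega>" using r0 by (auto simp: cofinal_rel_def)
  have ex: "\<exists>r\<in>\<omega>. r 0 = v" if "v \<in> verts T" for v
  proof -
    have "r0 0 \<in> verts T" using r0(1) by (auto simp: rays_def)
    then have "(\<lambda>x y. {x, y} \<in> edges T)\<^sup>*\<^sup>* (r0 0) v"
      using tree that by (auto simp: is_tree_def)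
    then show ?thesis
    proof induction
      case base
      then show ?case using r0\<omega> by auto
    next
      case (step y z)
      then obtain r where r: "r \<in> \<omega>" "r 0 = y" by auto
      show ?case
      proof (cases "z = r 1")
        case True
        then show ?thesis using shift[OF r(1)] by force
      next
        case False
        have "case_nat z r \<in> \<omega>"
          by (rule cons[of r z]) (use False step r in \<open>auto simp: insert_commute\<close>)
        then show ?thesis by (intro bexI[of _ "case_nat z r"]) simp
      qed
    qed
  qed
  define R where "R v = (SOME r. r \<in> \<omega> \<and> r 0 = v)" for v
  have R: "R v \<in> \<omega>" "R v 0 = v" if "v \<in> verts T" for v
    using someI_ex[of "\<lambda>r. r \<in> \<omega> \<and> r 0 = v"] ex[OF that] unfolding R_def by auto
  define \<pi> where "\<pi> v = R v 1" for v
  have \<pi>_eq: "\<pi> (r 0) = r 1" if "r \<in> \<omega>" for r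
  proof -
    have "r 0 \<in> verts T" using ray[OF that] by (auto simp: rays_def)
    then show ?thesis
      unfolding \<pi>_def using cofinal_ray_next_unique[OF tree cof[OF R(1) that] R(2)] by auto
  qed
  have \<pi>_pow: "(\<pi> ^^ n) (r 0) = r n" if "r \<in> \<omega>" for n r
    using that
  proof (induction n arbitrary: r)
    case (Suc n)
    have "(\<pi> ^^ Suc n) (r 0) = (\<pi> ^^ n) (r 1)"
      by (simp only: funpow_Suc_right comp_apply \<pi>_eq[OF Suc.prems])
    then show ?case using Suc.IH[OF shift[OF Suc.prems]] by simp
  qed simp
  have "end_tree G T \<pi>"
  proof
    show "finitely_generated_group G" "metric_G_tree G T" "\<not> is_line T"
      by (fact fg T not_line)+
    show "\<pi> v \<in> verts T" if "v \<in> verts T" for v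
      using ray[OF R(1)[OF that]] by (auto simp: \<pi>_def rays_def)
    show "edges T = (\<lambda>v. {v, \<pi> v}) ` verts T"
    proof (intro equalityI subsetI)
      fix e assume e: "e \<in> edges T"
      then obtain u v where uv: "e = {u, v}" "u \<noteq> v"
        using E(2)[OF e] unfolding card_2_iff by blast
      then have V: "u \<in> verts T" "v \<in> verts T" using E(1)[OF e] by auto
      show "e \<in> (\<lambda>v. {v, \<pi> v}) ` verts T"
      proof (cases "v = \<pi> u")
        case True
        then show ?thesis using uv V by auto
      next
        case False
        \<comment> \<open>An edge not followed by the ray from \<open>u\<close> can be prefixed to
          it, which turns \<open>u\<close> into the parent of \<open>v\<close>.\<close>
        have "case_nat v (R u) \<in> \<omega>"
          by (rule cons) (use False e uv V R in \<open>auto simp: \<pi>_def insert_commute\<close>)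
        from \<pi>_eq[OF this] have "\<pi> v = u" using R(2)[OF V(1)] by simp
        then show ?thesis using uv V by (auto simp: insert_commute)
      qed
    next
      fix e assume "e \<in> (\<lambda>v. {v, \<pi> v}) ` verts T"
      then obtain v where v: "v \<in> verts T" "e = {v, \<pi> v}" by auto
      have "{R v 0, R v (Suc 0)} \<in> edges T" using ray[OF R(1)[OF v(1)]] unfolding rays_def by blast
      then show "e \<in> edges T" using R(2)[OF v(1)] v by (simp add: \<pi>_def)
    qed
    show "(\<pi> ^^ n) v \<noteq> v" if "v \<in> verts T" "0 < n" for v n
      using \<pi>_pow[OF R(1)[OF that(1)], of n] R(2)[OF that(1)] ray[OF R(1)[OF that(1)]] that(2)
      unfolding rays_def inj_def by (metis (mono_tags, lifting) mem_Collect_eq less_irrefl)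
    show "\<exists>m n. (\<pi> ^^ m) u = (\<pi> ^^ n) v" if "u \<in> verts T" "v \<in> verts T" for u v
    proof -
      note u = R[OF that(1)] and v = R[OF that(2)]
      obtain m n where "\<And>i. R u (m + i) = R v (n + i)"
        using cof[OF u(1) v(1)] by (auto simp: cofinal_rel_def)
      from this[of 0] show ?thesis
        using \<pi>_pow[OF u(1)] \<pi>_pow[OF v(1)] u(2) v(2) by auto
    qed
    show "\<pi> (act T g v) = act T g (\<pi> v)" if "g \<in> carrier G" "v \<in> verts T" for g v
    proof -
      have "act T g \<circ> R v \<in> \<omega>" using \<omega>(2)[OF that(1)] R(1)[OF that(2)] by blast
      from \<pi>_eq[OF this] show ?thesis using R(2)[OF that(2)] by (simp add: \<pi>_def)
    qed
  qed
  then show ?thesis by blast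
qed

section \<open>Flows towards an end\<close>

text \<open>
  \<open>up p h\<close> is the point at height \<open>h\<close> on the ray from \<open>p\<close> to the end (\<open>h\<close> at least the height
  \<open>\<beta> p\<close> of \<open>p\<close>); the rays from any two points merge at some height.
\<close>

locale horo_flow =
  fixes P :: "'p set" and \<beta> :: "'p \<Rightarrow> real" and up :: "'p \<Rightarrow> real \<Rightarrow> 'p"
  assumes up_in: "p \<in> P \<Longrightarrow> \<beta> p \<le> h \<Longrightarrow> up p h \<in> P"
    and ht_up: "p \<in> P \<Longrightarrow> \<beta> p \<le> h \<Longrightarrow> \<beta> (up p h) = h"
    and up_self: "p \<in> P \<Longrightarrow> up p (\<beta> p) = p"
    and up_up: "p \<in> P \<Longrightarrow> \<beta> p \<le> h \<Longrightarrow> h \<le> k \<Longrightarrow> up (up p h) k = up p k"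
    and merge: "p \<in> P \<Longrightarrow> q \<in> P \<Longrightarrow>
      \<exists>m. \<beta> p \<le> m \<and> \<beta> q \<le> m \<and> (\<forall>h. \<beta> p \<le> h \<longrightarrow> \<beta> q \<le> h \<longrightarrow> (up p h = up q h \<longleftrightarrow> m \<le> h))"
begin

definition merge_ht :: "'p \<Rightarrow> 'p \<Rightarrow> real" where
  "merge_ht p q = Inf {h. \<beta> p \<le> h \<and> \<beta> q \<le> h \<and> up p h = up q h}"

text \<open>The length of the path that climbs from \<open>p\<close> to the merging point and
  descends to \<open>q\<close>.\<close>

definition hdist :: "'p \<Rightarrow> 'p \<Rightarrow> real" where
  "hdist p q = 2 * merge_ht p q - \<beta> p - \<beta> q"

lemma merge_ht_eqI:
  assumes "p \<in> P" "q \<in> P" "\<beta> p \<le> m" "\<beta> q \<le> m"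
    and "\<And>h. \<beta> p \<le> h \<Longrightarrow> \<beta> q \<le> h \<Longrightarrow> up p h = up q h \<longleftrightarrow> m \<le> h"
  shows "merge_ht p q = m"
proof -
  have "{h. \<beta> p \<le> h \<and> \<beta> q \<le> h \<and> up p h = up q h} = {m..}"
    using assms by auto
  then show ?thesis by (simp add: merge_ht_def)
qed

lemma merge_ht_spec:
  assumes "p \<in> P" "q \<in> P"
  shows "\<beta> p \<le> merge_ht p q \<and> \<beta> q \<le> merge_ht p q \<and>
    (\<forall>h. \<beta> p \<le> h \<longrightarrow> \<beta> q \<le> h \<longrightarrow> (up p h = up q h \<longleftrightarrow> merge_ht p q \<le> h))"
proof -
  obtain m where m: "\<beta> p \<le> m" "\<beta> q \<le> m"
    "\<And>h. \<beta> p \<le> h \<Longrightarrow> \<beta> q \<le> h \<Longrightarrow> up p h = up q h \<longleftrightarrow> m \<le> h"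
    using merge[OF assms] by blast
  have "merge_ht p q = m" using assms m by (rule merge_ht_eqI)
  then show ?thesis using m by blast
qed

lemma merge_ht_ge:
  assumes "p \<in> P" "q \<in> P"
  shows "\<beta> p \<le> merge_ht p q" "\<beta> q \<le> merge_ht p q"
  using merge_ht_spec[OF assms] by auto

lemma up_eq_iff:
  assumes "p \<in> P" "q \<in> P" "\<beta> p \<le> h" "\<beta> q \<le> h"
  shows "up p h = up q h \<longleftrightarrow> merge_ht p q \<le> h"
  using merge_ht_spec[OF assms(1,2)] assms(3,4) by blast

lemma merge_ht_sym: "merge_ht p q = merge_ht q p"
  unfolding merge_ht_def by (rule arg_cong[where f = Inf]) auto

lemma hdist_sym: "hdist p q = hdist q p"
  by (simp add: hdist_def merge_ht_sym[of p q])

lemma hdist_ge: "p \<in> P \<Longrightarrow> q \<in> P \<Longrightarrow> \<bar>\<beta> p - \<beta> q\<bar> \<le> hdist p q"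
  using merge_ht_ge[of p q] by (auto simp: hdist_def)

lemma hdist_zero_iff:
  assumes "p \<in> P" "q \<in> P"
  shows "hdist p q = 0 \<longleftrightarrow> p = q"
proof
  assume 0: "hdist p q = 0"
  then have "\<beta> p = \<beta> q" using hdist_ge[OF assms] by simp
  moreover have "merge_ht p q = \<beta> p" using 0 calculation by (simp add: hdist_def)
  ultimately have "up p (\<beta> p) = up q (\<beta> q)" using up_eq_iff[OF assms, of "\<beta> p"] by simp
  then show "p = q" using assms by (simp add: up_self)
next
  assume "p = q"
  moreover have "merge_ht p p = \<beta> p" using assms by (intro merge_ht_eqI) auto
  ultimately show "hdist p q = 0" by (simp add: hdist_def)
qed

text \<open>At the larger \<open>h\<close> of the two merge heights all three rays agree, so
  \<open>p\<close> and \<open>r\<close> have merged. The smaller one is at least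
  \<open>\<beta> q\<close>, which absorbs the terms in \<open>\<beta> q\<close>.\<close>

lemma hdist_triangle:
  assumes "p \<in> P" "q \<in> P" "r \<in> P"
  shows "hdist p r \<le> hdist p q + hdist q r"
proof -
  define h where "h = max (merge_ht p q) (merge_ht q r)"
  have ge: "\<beta> p \<le> h" "\<beta> q \<le> h" "\<beta> r \<le> h"
    using merge_ht_ge assms by (auto simp: h_def intro: le_max_iff_disj[THEN iffD2])
  have "up p h = up q h" "up q h = up r h"
    using ge up_eq_iff[of p q h] up_eq_iff[of q r h] assms by (auto simp: h_def)
  then have "merge_ht p r \<le> h" using up_eq_iff[of p r h] ge assms by auto
  then show ?thesis
    using merge_ht_ge[of p q] merge_ht_ge[of q r] assms by (auto simp: hdist_def h_def)
qed

lemma hdist_up: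
  assumes "p \<in> P" "\<beta> p \<le> h"
  shows "hdist p (up p h) = h - \<beta> p"
proof -
  have "merge_ht p (up p h) = h"
    using assms by (intro merge_ht_eqI) (auto simp: up_in ht_up up_up)
  then show ?thesis using assms by (simp add: hdist_def ht_up)
qed

end

section \<open>Group actions fixing an end\<close>

text \<open>What the separation argument uses of a tree with a fixed end, expressed by points and
  heights instead of vertices, so that trees with unrelated simplicial structures can be compared.
  \<open>minimal_up\<close> is minimality tested on upward closed sets, and \<open>not_line\<close>
  says that no axis fills the tree.\<close>

locale horo_tree = horo_flow "points T" \<beta> up + group G
  for G :: "('g, 'm) monoid_scheme" (structure) and T :: "('g, 'v) gtree"
    and \<beta> :: "('v \<Rightarrow> real) \<Rightarrow> real" and up :: "('v \<Rightarrow> real) \<Rightarrow> real \<Rightarrow> 'v \<Rightarrow> real" +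
  fixes \<tau> :: "'g \<Rightarrow> real"
  assumes tdist_hdist: "p \<in> points T \<Longrightarrow> q \<in> points T \<Longrightarrow> tdist T p q = hdist p q"
    and act_in: "g \<in> carrier G \<Longrightarrow> p \<in> points T \<Longrightarrow> act_pt G T g p \<in> points T"
    and act_one: "p \<in> points T \<Longrightarrow> act_pt G T \<one> p = p"
    and act_mult: "g \<in> carrier G \<Longrightarrow> k \<in> carrier G \<Longrightarrow> p \<in> points T \<Longrightarrow>
      act_pt G T (g \<otimes> k) p = act_pt G T g (act_pt G T k p)"
    and ht_act: "g \<in> carrier G \<Longrightarrow> p \<in> points T \<Longrightarrow> \<beta> (act_pt G T g p) = \<beta> p + \<tau> g"
    and act_up: "g \<in> carrier G \<Longrightarrow> p \<in> points T \<Longrightarrow> \<beta> p \<le> h \<Longrightarrow>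
      act_pt G T g (up p h) = up (act_pt G T g p) (h + \<tau> g)"
    and minimal_up: "\<And>Q. Q \<subseteq> points T \<Longrightarrow> Q \<noteq> {} \<Longrightarrow>
      (\<And>p h. p \<in> Q \<Longrightarrow> \<beta> p \<le> h \<Longrightarrow> up p h \<in> Q) \<Longrightarrow>
      (\<And>g p. g \<in> carrier G \<Longrightarrow> p \<in> Q \<Longrightarrow> act_pt G T g p \<in> Q) \<Longrightarrow> Q = points T"
    and not_line: "g \<in> carrier G \<Longrightarrow> 0 < \<tau> g \<Longrightarrow>
      \<exists>p\<in>points T. act_pt G T g p \<noteq> up p (\<beta> p + \<tau> g)"
    and hyperbolic: "\<exists>g\<in>carrier G. 0 < \<tau> g"
begin

abbreviation a where "a \<equiv> act_pt G T"
abbreviation P where "P \<equiv> points T"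
abbreviation d where "d \<equiv> tdist T"

lemma d_sym: "p \<in> P \<Longrightarrow> q \<in> P \<Longrightarrow> d p q = d q p"
  by (simp add: tdist_hdist hdist_sym)

lemma d_nonneg: "p \<in> P \<Longrightarrow> q \<in> P \<Longrightarrow> 0 \<le> d p q"
  using hdist_ge[of p q] by (simp add: tdist_hdist)

lemma d_zero_iff: "p \<in> P \<Longrightarrow> q \<in> P \<Longrightarrow> d p q = 0 \<longleftrightarrow> p = q"
  by (simp add: tdist_hdist hdist_zero_iff)

lemma d_triangle: "p \<in> P \<Longrightarrow> q \<in> P \<Longrightarrow> r \<in> P \<Longrightarrow> d p r \<le> d p q + d q r"
  by (simp add: tdist_hdist hdist_triangle)

lemma d_up: "p \<in> P \<Longrightarrow> \<beta> p \<le> h \<Longrightarrow> d p (up p h) = h - \<beta> p"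
  by (simp add: tdist_hdist hdist_up up_in)

lemma nonempty: "P \<noteq> {}"
  using hyperbolic not_line by blast

lemma act_inv [simp]:
  assumes "g \<in> carrier G" "p \<in> P"
  shows "a (inv g) (a g p) = p" "a g (a (inv g) p) = p"
  using act_mult[of "inv g" g p] act_mult[of g "inv g" p] assms by (simp_all add: act_one)

lemma act_inj: "g \<in> carrier G \<Longrightarrow> p \<in> P \<Longrightarrow> q \<in> P \<Longrightarrow> a g p = a g q \<longleftrightarrow> p = q"
  by (metis act_inv(1))

lemma tau_mult:
  assumes "g \<in> carrier G" "h \<in> carrier G"
  shows "\<tau> (g \<otimes> h) = \<tau> g + \<tau> h"
proof -
  obtain p where p: "p \<in> P" using nonempty by blast
  have "\<beta> p + \<tau> (g \<otimes> h) = \<beta> (a g (a h p))" using assms p by (simp add: act_mult flip: ht_act)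
  then show ?thesis using assms p by (simp add: ht_act act_in)
qed

lemma tau_one: "\<tau> \<one> = 0"
  using tau_mult[of \<one> \<one>] by simp

lemma tau_inv: "g \<in> carrier G \<Longrightarrow> \<tau> (inv g) = - \<tau> g"
  using tau_mult[of g "inv g"] by (simp add: tau_one)

text \<open>The action commutes with the flow up to the shift \<open>\<tau> g\<close>, so heights
  and merge heights all change by \<open>\<tau> g\<close>, which cancels in
  \<open>hdist\<close>.\<close>

lemma d_act:
  assumes g: "g \<in> carrier G" and p: "p \<in> P" "q \<in> P"
  shows "d (a g p) (a g q) = d p q"
proof -
  have "merge_ht (a g p) (a g q) = merge_ht p q + \<tau> g"
  proof (rule merge_ht_eqI)
    fix h assume "\<beta> (a g p) \<le> h" "\<beta> (a g q) \<le> h"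
    then have h: "\<beta> p \<le> h - \<tau> g" "\<beta> q \<le> h - \<tau> g" using g p by (auto simp: ht_act)
    have "up (a g p) h = a g (up p (h - \<tau> g))" "up (a g q) h = a g (up q (h - \<tau> g))"
      using act_up[of g _ "h - \<tau> g"] g p h by auto
    then have "up (a g p) h = up (a g q) h \<longleftrightarrow> up p (h - \<tau> g) = up q (h - \<tau> g)"
      using g p h by (simp add: act_inj up_in)
    also have "\<dots> \<longleftrightarrow> merge_ht p q + \<tau> g \<le> h"
      using up_eq_iff[OF p h] by auto
    finally show "up (a g p) h = up (a g q) h \<longleftrightarrow> merge_ht p q + \<tau> g \<le> h" .
  qed (use g p merge_ht_ge[of p q] in \<open>auto simp: act_in ht_act\<close>)
  then show ?thesis using g p by (simp add: tdist_hdist hdist_def act_in ht_act)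
qed

lemma d_act_le:
  assumes "g \<in> carrier G" "p \<in> P" "q \<in> P" "p' \<in> P" "q' \<in> P"
  shows "d p' (a g q') \<le> d p' p + d p (a g q) + d q q'"
  using d_triangle[of p' p "a g q'"] d_triangle[of p "a g q" "a g q'"] d_act[of g q q'] assms
  by (simp add: act_in)

section \<open>The axis of a hyperbolic element\<close>

text \<open>For \<open>\<tau> g > 0\<close> this is the translation axis: the points that
  \<open>g\<close> moves along their own ray to the end.\<close>

definition elt_axis :: "'g \<Rightarrow> ('v \<Rightarrow> real) set" where
  "elt_axis g = {p \<in> P. a g p = up p (\<beta> p + \<tau> g)}"

lemma axisD: "p \<in> elt_axis g \<Longrightarrow> p \<in> P" "p \<in> elt_axis g \<Longrightarrow> a g p = up p (\<beta> p + \<tau> g)"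
  by (auto simp: elt_axis_def)

lemma axis_up:
  assumes g: "g \<in> carrier G" "0 < \<tau> g" and p: "p \<in> elt_axis g" "\<beta> p \<le> h"
  shows "up p h \<in> elt_axis g"
proof -
  note P = axisD(1)[OF p(1)]
  have "a g (up p h) = up (up p (\<beta> p + \<tau> g)) (h + \<tau> g)"
    using act_up[OF g(1) P p(2)] axisD(2)[OF p(1)] by simp
  also have "\<dots> = up (up p h) (h + \<tau> g)" using P p g by (simp add: up_up)
  finally show ?thesis using P p by (simp add: elt_axis_def up_in ht_up)
qed

text \<open>If the rays of \<open>p\<close> and \<open>g p\<close> merge at height \<open>m\<close>,
  then \<open>g\<close> carries the point at height \<open>m - \<tau> g\<close> above
  \<open>p\<close> to their merging point, which lies above it. Twice the climb to this point is the
  excess of the displacement over \<open>\<tau> g\<close>.\<close>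

lemma axis_near:
  assumes g: "g \<in> carrier G" "0 < \<tau> g" and p: "p \<in> P"
  obtains r where "0 \<le> r" "up p (\<beta> p + r) \<in> elt_axis g" "d p (a g p) = \<tau> g + 2 * r"
proof -
  define m where "m = merge_ht p (a g p)"
  define r where "r = m - \<beta> p - \<tau> g"
  have gp: "a g p \<in> P" using g p by (simp add: act_in)
  have m: "\<beta> p \<le> m" "\<beta> p + \<tau> g \<le> m"
    using merge_ht_ge[OF p gp] g p by (auto simp: m_def ht_act)
  then have r: "0 \<le> r" by (simp add: r_def)
  have "up p m = up (a g p) m"
    using up_eq_iff[OF p gp, of m] m g p by (simp add: m_def ht_act)
  also have "\<dots> = a g (up p (\<beta> p + r))"
    using act_up[OF g(1) p, of "\<beta> p + r"] r by (simp add: r_def)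
  finally have "a g (up p (\<beta> p + r)) = up (up p (\<beta> p + r)) (\<beta> p + r + \<tau> g)"
    using p r g by (simp add: up_up) (simp add: r_def)
  then have "up p (\<beta> p + r) \<in> elt_axis g" using p r by (simp add: elt_axis_def up_in ht_up)
  moreover have "d p (a g p) = \<tau> g + 2 * r"
    using g p gp by (simp add: tdist_hdist hdist_def ht_act r_def flip: m_def)
  ultimately show ?thesis using that r by blast
qed

lemma axis_nonempty: "g \<in> carrier G \<Longrightarrow> 0 < \<tau> g \<Longrightarrow> elt_axis g \<noteq> {}"
  using nonempty axis_near by (metis all_not_in_conv)

text \<open>By injectivity of \<open>g\<close>, agreement of the two rays at height
  \<open>h + \<tau> g\<close> passes down to height \<open>h\<close>, so the rays cannot merge
  strictly above \<open>\<beta> y\<close>.\<close>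

lemma axis_comparable:
  assumes g: "g \<in> carrier G" "0 < \<tau> g" and xy: "x \<in> elt_axis g" "y \<in> elt_axis g" "\<beta> x \<le> \<beta> y"
  shows "y = up x (\<beta> y)"
proof -
  note P = axisD(1)[OF xy(1)] axisD(1)[OF xy(2)]
  define m where "m = merge_ht x y"
  have m: "\<beta> y \<le> m" using merge_ht_ge[OF P] by (simp add: m_def)
  \<comment> \<open>One translation below the merge height, but not below \<open>\<beta> y\<close>,
    where the ray of \<open>y\<close> starts.\<close>
  define h where "h = max (\<beta> y) (m - \<tau> g)"
  have h: "\<beta> x \<le> h" "\<beta> y \<le> h" "m \<le> h + \<tau> g" using xy by (auto simp: h_def)
  have "up x (h + \<tau> g) = up y (h + \<tau> g)"
    using up_eq_iff[OF P, of "h + \<tau> g"] h g by (simp add: m_def)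
  then have "a g (up x h) = a g (up y h)"
    using axisD(2)[OF axis_up[OF g xy(1) h(1)]] axisD(2)[OF axis_up[OF g xy(2) h(2)]] P h g
    by (simp add: ht_up up_up)
  then have "up x h = up y h" using P h g by (simp add: act_inj up_in)
  then have "m \<le> h" using up_eq_iff[OF P h(1,2)] by (simp add: m_def)
  then have "m = \<beta> y" using m g by (simp add: h_def split: if_splits)
  then have "up x (\<beta> y) = up y (\<beta> y)" using up_eq_iff[OF P xy(3)] by (simp add: m_def)
  then show ?thesis using P by (simp add: up_self)
qed

lemma axis_inv_act:
  assumes g: "g \<in> carrier G" "0 < \<tau> g" and x: "x \<in> elt_axis g"
  shows "a (inv g) x \<in> elt_axis g"
proof -
  note P = axisD(1)[OF x]
  have "up (a (inv g) x) (\<beta> x) = a (inv g) (up x (\<beta> x + \<tau> g))"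
    using act_up[of "inv g" x "\<beta> x + \<tau> g"] g P by (simp add: tau_inv)
  also have "\<dots> = x" using axisD(2)[OF x] g P by (metis act_inv(1))
  finally show ?thesis using g P by (simp add: elt_axis_def act_in ht_act tau_inv)
qed

lemma axis_descend:
  assumes g: "g \<in> carrier G" "0 < \<tau> g" and x: "x \<in> elt_axis g"
  obtains c where "c \<in> carrier G" "a c x \<in> elt_axis g" "\<beta> (a c x) \<le> s"
proof -
  have *: "\<exists>c\<in>carrier G. a c x \<in> elt_axis g \<and> \<beta> (a c x) = \<beta> x - real n * \<tau> g" for n
  proof (induction n)
    case 0
    show ?case using x axisD(1)[OF x] by (intro bexI[of _ \<one>]) (auto simp: act_one)
  next
    case (Suc n)
    then obtain c where c: "c \<in> carrier G" "a c x \<in> elt_axis g"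
      "\<beta> (a c x) = \<beta> x - real n * \<tau> g" by blast
    moreover have "a (inv g \<otimes> c) x = a (inv g) (a c x)"
      using c g axisD(1)[OF x] by (simp add: act_mult)
    ultimately show ?case
      using axis_inv_act[OF g c(2)] axisD(1) g
      by (intro bexI[of _ "inv g \<otimes> c"]) (auto simp: ht_act tau_inv algebra_simps)
  qed
  obtain n :: nat where "\<beta> x - s \<le> real n * \<tau> g"
    using reals_Archimedean3[OF g(2)] less_imp_le by meson
  then show ?thesis using *[of n] that by force
qed

lemma axis_height:
  assumes g: "g \<in> carrier G" "0 < \<tau> g"
  obtains x where "x \<in> elt_axis g" "\<beta> x = s"
proof -
  obtain x0 where x0: "x0 \<in> elt_axis g" using axis_nonempty[OF g] by blast
  obtain c where "a c x0 \<in> elt_axis g" "\<beta> (a c x0) \<le> s"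
    by (rule axis_descend[OF g x0])
  then show ?thesis using that[OF axis_up[OF g]] axisD(1) by (simp add: ht_up)
qed

text \<open>The translates of the axis form a nonempty, invariant, upward closed set, which is
  everything by minimality.\<close>

lemma conj_axis_cover:
  assumes g: "g \<in> carrier G" "0 < \<tau> g" and p: "p \<in> P"
  obtains b x where "b \<in> carrier G" "x \<in> elt_axis g" "p = a b x"
proof -
  define Q where "Q = {a b x |b x. b \<in> carrier G \<and> x \<in> elt_axis g}"
  have "Q = P"
  proof (rule minimal_up)
    show "Q \<subseteq> P" using axisD(1) by (auto simp: Q_def act_in)
    show "Q \<noteq> {}" using axis_nonempty[OF g] by (auto simp: Q_def)
    show "up p h \<in> Q" if pQ: "p \<in> Q" "\<beta> p \<le> h" for p h
    proof -
      obtain b x where bx: "b \<in> carrier G" "x \<in> elt_axis g" "p = a b x" using pQ by (auto simp: Q_def)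
      then have "\<beta> x \<le> h - \<tau> b" using that axisD(1) by (simp add: ht_act)
      then have "up p h = a b (up x (h - \<tau> b))" "up x (h - \<tau> b) \<in> elt_axis g"
        using act_up[of b x "h - \<tau> b"] bx axisD(1) axis_up[OF g] by auto
      then show ?thesis using bx(1) by (auto simp: Q_def)
    qed
    show "a c p \<in> Q" if cQ: "c \<in> carrier G" "p \<in> Q" for c p
    proof -
      obtain b x where bx: "b \<in> carrier G" "x \<in> elt_axis g" "p = a b x" using cQ by (auto simp: Q_def)
      then have "a c p = a (c \<otimes> b) x" using that axisD(1) by (simp add: act_mult)
      then show ?thesis using bx that by (auto simp: Q_def)
    qed
  qed
  then obtain b x where "b \<in> carrier G" "x \<in> elt_axis g" "p = a b x"
    using p unfolding Q_def by blast
  then show ?thesis by (rule that)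
qed

section \<open>Displacement of elliptic elements\<close>

text \<open>If \<open>\<tau> e = 0\<close>, then \<open>p\<close> and \<open>e p\<close> have the
  same height, and \<open>e\<close> fixes the point where their rays merge.\<close>

lemma elliptic_iff:
  assumes "e \<in> carrier G"
  shows "\<tau> e = 0 \<longleftrightarrow> (\<exists>p\<in>P. a e p = p)"
proof
  assume 0: "\<tau> e = 0"
  obtain p where p: "p \<in> P" using nonempty by blast
  have ep: "a e p \<in> P" "\<beta> (a e p) = \<beta> p" using assms p 0 by (simp_all add: act_in ht_act)
  define m where "m = merge_ht p (a e p)"
  have m: "\<beta> p \<le> m" using merge_ht_ge[OF p ep(1)] by (simp add: m_def)
  have "a e (up p m) = up p m"
    using act_up[OF assms p m] up_eq_iff[OF p ep(1), of m] m ep 0 by (simp add: m_def)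
  then show "\<exists>p\<in>P. a e p = p" using up_in[OF p m] by blast
next
  assume "\<exists>p\<in>P. a e p = p"
  then show "\<tau> e = 0" using ht_act[OF assms] by force
qed

text \<open>Flowing \<open>x\<close> and \<open>e x\<close> up to height \<open>h\<close> replaces
  their merge height \<open>m\<close> by \<open>max h m\<close>, and the displacement is twice the
  gap between merge height and height.\<close>

lemma displacement_up:
  assumes e: "e \<in> carrier G" "\<tau> e = 0" and x: "x \<in> P" "\<beta> x \<le> h"
  shows "d (up x h) (a e (up x h)) = max 0 (d x (a e x) - 2 * (h - \<beta> x))"
proof -
  define m where "m = merge_ht x (a e x)"
  have ex: "a e x \<in> P" "\<beta> (a e x) = \<beta> x" using e x by (simp_all add: act_in ht_act)
  have eu: "a e (up x h) = up (a e x) h" using act_up[OF e(1) x] e by simp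
  have "merge_ht (up x h) (up (a e x) h) = max h m"
    using x ex up_eq_iff[OF x(1) ex(1)]
    by (intro merge_ht_eqI) (auto simp: up_in ht_up up_up m_def)
  then show ?thesis
    using x ex by (simp add: eu tdist_hdist hdist_def ht_up up_in flip: m_def)
qed

text \<open>Two points of the axis lie on one ray, along which the displacement falls with slope
  \<open>-2\<close> until it is cut off at 0. Positivity at both points excludes the cut-off,
  whichever of them is higher.\<close>

lemma axis_dist_displacement:
  assumes g: "g \<in> carrier G" "0 < \<tau> g" and e: "e \<in> carrier G" "\<tau> e = 0"
    and x: "x \<in> elt_axis g" "0 < d x (a e x)" and y: "y \<in> elt_axis g" "0 < d y (a e y)"
  shows "2 * d x y = \<bar>d x (a e x) - d y (a e y)\<bar>"
proof -
  have *: "2 * d x y = \<bar>d x (a e x) - d y (a e y)\<bar>"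
    if "x \<in> elt_axis g" "y \<in> elt_axis g" "0 < d y (a e y)" "\<beta> x \<le> \<beta> y" for x y
  proof -
    have y: "y = up x (\<beta> y)" using axis_comparable[OF g that(1,2,4)] .
    have "d x y = \<beta> y - \<beta> x" using d_up[OF axisD(1) that(4)] that(1) y by simp
    moreover have "d y (a e y) = max 0 (d x (a e x) - 2 * (\<beta> y - \<beta> x))"
      using displacement_up[OF e axisD(1) that(4)] that(1) y by simp
    ultimately show ?thesis using that(3,4) by auto
  qed
  show ?thesis
  proof (cases "\<beta> x \<le> \<beta> y")
    case True
    then show ?thesis using * x y by blast
  next
    case False
    then have "2 * d y x = \<bar>d y (a e y) - d x (a e x)\<bar>" using *[of y x] x y by simp
    then show ?thesis using d_sym x y axisD(1) by (simp add: abs_minus_commute)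
  qed
qed

lemma axis_displacement_exists:
  assumes g: "g \<in> carrier G" "0 < \<tau> g" and e: "e \<in> carrier G" "\<tau> e = 0"
    and x: "x \<in> elt_axis g" "0 < d x (a e x)" and \<delta>: "0 < \<delta>"
  obtains y where "y \<in> elt_axis g" "d y (a e y) = \<delta>"
proof -
  \<comment> \<open>The height at which the line of slope \<open>-2\<close> through the displacement
    of \<open>x\<close> takes the value \<delta>.\<close>
  obtain y where y: "y \<in> elt_axis g" "\<beta> y = \<beta> x + (d x (a e x) - \<delta>) / 2"
    using axis_height[OF g] by metis
  show ?thesis
  proof (cases "\<beta> x \<le> \<beta> y")
    case True
    then have "d y (a e y) = max 0 (d x (a e x) - 2 * (\<beta> y - \<beta> x))"
      using displacement_up[OF e axisD(1)[OF x(1)] True] axis_comparable[OF g x(1) y(1) True] by simp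
    then have "d y (a e y) = \<delta>" using y \<delta> by (simp add: field_simps)
    then show ?thesis using that y by blast
  next
    case False
    then have le: "\<beta> y \<le> \<beta> x" by simp
    then have "d x (a e x) = max 0 (d y (a e y) - 2 * (\<beta> x - \<beta> y))"
      using displacement_up[OF e axisD(1)[OF y(1)] le] axis_comparable[OF g y(1) x(1) le] by simp
    then have "d y (a e y) = \<delta>" using y x \<delta> by (simp add: field_simps max_def split: if_splits)
    then show ?thesis using that y by blast
  qed
qed

text \<open>If all elliptic elements fixed the axis pointwise, so would the commutators of
  \<open>g\<close>, and every \<open>b\<close> would preserve the axis. By minimality the axis would
  be the whole tree, contrary to \<open>not_line\<close>.\<close>

lemma elliptic_moves_axis:
  assumes g: "g \<in> carrier G" "0 < \<tau> g"
  obtains e x where "e \<in> carrier G" "\<tau> e = 0" "x \<in> elt_axis g" "a e x \<noteq> x"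
proof -
  have "\<exists>e x. e \<in> carrier G \<and> \<tau> e = 0 \<and> x \<in> elt_axis g \<and> a e x \<noteq> x"
  proof (rule ccontr)
    assume "\<not> ?thesis"
    then have fixes_axis: "a e x = x" if "e \<in> carrier G" "\<tau> e = 0" "x \<in> elt_axis g" for e x
      using that by blast
    have "a b x \<in> elt_axis g" if b: "b \<in> carrier G" and x: "x \<in> elt_axis g" for b x
    proof -
      note P = axisD(1)[OF x]
      \<comment> \<open>This commutator has shift 0 and satisfies \<open>g b c = b g\<close>; as it
        fixes \<open>x\<close>, it follows that \<open>g (b x) = b (g x)\<close>.\<close>
      define c where "c = inv b \<otimes> (inv g \<otimes> (b \<otimes> g))"
      have c: "c \<in> carrier G" "\<tau> c = 0"
        using b g by (simp_all add: c_def tau_mult tau_inv)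
      have "g \<otimes> (b \<otimes> c) = b \<otimes> g"
        using b g by (simp add: c_def m_assoc flip: m_assoc[of b "inv b"] m_assoc[of g "inv g"])
      then have "a (b \<otimes> g) x = a g (a b x)"
        using fixes_axis[OF c x] b g c P by (metis act_mult m_closed)
      then have "a g (a b x) = a b (up x (\<beta> x + \<tau> g))"
        using axisD(2)[OF x] b g P by (simp add: act_mult)
      also have "\<dots> = up (a b x) (\<beta> x + \<tau> g + \<tau> b)"
        using act_up[OF b P] g by simp
      finally show ?thesis using b P by (simp add: elt_axis_def act_in ht_act algebra_simps)
    qed
    then have "elt_axis g = P"
      using axisD(1) axis_nonempty[OF g] axis_up[OF g] by (intro minimal_up) auto
    then show False using not_line[OF g] axisD(2) by blast
  qed
  then show ?thesis using that by blast
qed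

end

section \<open>Quantitative estimates near an axis\<close>

context horo_tree
begin

text \<open>The displacement by \<open>e\<close> does not decrease downwards along the axis. So a
  power of \<open>g\<close> brings the axis point below the moved point \<open>y\<close>, where
  \<open>e\<close> moves it too, and the power is absorbed into \<open>b\<close>.\<close>

lemma conj_axis_cover_moved:
  assumes g: "g \<in> carrier G" "0 < \<tau> g" and e: "e \<in> carrier G" "\<tau> e = 0"
    and y: "y \<in> elt_axis g" "a e y \<noteq> y" and p: "p \<in> P"
  obtains b x where "b \<in> carrier G" "x \<in> elt_axis g" "0 < d x (a e x)" "p = a b x"
proof -
  obtain b x where bx: "b \<in> carrier G" "x \<in> elt_axis g" "p = a b x"
    by (rule conj_axis_cover[OF g p])
  obtain c where c: "c \<in> carrier G" "a c x \<in> elt_axis g" "\<beta> (a c x) \<le> \<beta> y"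
    by (rule axis_descend[OF g bx(2)])
  note P = axisD(1)[OF bx(2)] axisD(1)[OF c(2)] axisD(1)[OF y(1)]
  have "0 < d y (a e y)"
    using y(2) d_nonneg[of y "a e y"] d_zero_iff[of y "a e y"] P e by (force simp: act_in)
  then have "0 < d (a c x) (a e (a c x))"
    using displacement_up[OF e P(2) c(3)] axis_comparable[OF g c(2) y(1) c(3)] c(3) by simp
  moreover have "p = a (b \<otimes> inv c) (a c x)" using bx c P by (simp add: act_mult)
  ultimately show ?thesis using that[of "b \<otimes> inv c" "a c x"] bx c by simp
qed

lemma axis_dist_act:
  assumes g: "g \<in> carrier G" "0 < \<tau> g" and x: "x \<in> elt_axis g"
  shows "2 * d x (a g x) = d x (a (g \<otimes> g) x)"
proof -
  note P = axisD(1)[OF x]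
  have "a (g \<otimes> g) x = up x (\<beta> x + 2 * \<tau> g)"
    using axisD(2)[OF x] g P by (simp add: act_mult act_up up_up algebra_simps)
  then show ?thesis using axisD(2)[OF x] d_up[OF P] g by simp
qed

text \<open>
  The defect \<open>2 d(p, gp) - d(p, g\<^sup>2 p)\<close> is continuous in the Gromov topology and bounds the
  distance from \<open>p\<close> to the axis of \<open>g\<close>.
\<close>

lemma near_axis:
  assumes g: "g \<in> carrier G" "0 < \<tau> g" and p: "p \<in> P"
    and \<eta>: "2 * d p (a g p) - d p (a (g \<otimes> g) p) \<le> 2 * \<eta>"
  obtains r where "0 \<le> r" "r \<le> \<eta>" "up p (\<beta> p + r) \<in> elt_axis g"
proof -
  obtain r where r: "0 \<le> r" "up p (\<beta> p + r) \<in> elt_axis g" "d p (a g p) = \<tau> g + 2 * r"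
    by (rule axis_near[OF g p])
  define x where "x = up p (\<beta> p + r)"
  have x: "x \<in> elt_axis g" "d p x = r" using r p by (simp_all add: x_def d_up)
  note P = axisD(1)[OF x(1)]
  have "d x (a g x) = \<tau> g" using d_up[OF P] axisD(2)[OF x(1)] g by simp
  \<comment> \<open>Going via \<open>x\<close> bounds the displacement by
    \<open>g \<otimes> g\<close> by \<open>2 * \<tau> g + 2 * r\<close>, while twice that by
    \<open>g\<close> is \<open>2 * \<tau> g + 4 * r\<close>; the defect is therefore at least
    \<open>2 * r\<close>.\<close>
  then have "d p (a (g \<otimes> g) p) \<le> r + 2 * \<tau> g + r"
    using d_act_le[of "g \<otimes> g" x x p p] axis_dist_act[OF g x(1)] x P p g by (simp add: d_sym)
  then show ?thesis using that r \<eta> by simp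
qed

text \<open>Both points climb by at most \<eta> to the axis, which lowers their displacements by at
  most \<open>2 * \<eta>\<close> and keeps them positive, so that the exact formula on the axis
  applies. The two climbs and the altered displacements account for
  \<open>3 * \<eta>\<close>.\<close>

lemma near_axis_dist_displacement_pos:
  assumes g: "g \<in> carrier G" "0 < \<tau> g" and e: "e \<in> carrier G" "\<tau> e = 0"
    and p: "p \<in> P" "2 * d p (a g p) - d p (a (g \<otimes> g) p) \<le> 2 * \<eta>" "2 * \<eta> < d p (a e p)"
    and q: "q \<in> P" "2 * d q (a g q) - d q (a (g \<otimes> g) q) \<le> 2 * \<eta>" "2 * \<eta> < d q (a e q)"
  shows "d p q \<le> 3 * \<eta> + \<bar>d p (a e p) - d q (a e q)\<bar> / 2"
proof -
  obtain r where r: "0 \<le> r" "r \<le> \<eta>" "up p (\<beta> p + r) \<in> elt_axis g"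
    by (rule near_axis[OF g p(1,2)])
  obtain t where t: "0 \<le> t" "t \<le> \<eta>" "up q (\<beta> q + t) \<in> elt_axis g"
    by (rule near_axis[OF g q(1,2)])
  define x where "x = up p (\<beta> p + r)"
  define y where "y = up q (\<beta> q + t)"
  have x: "x \<in> elt_axis g" "d p x = r" "d x (a e x) = d p (a e p) - 2 * r"
    using r p displacement_up[OF e p(1), of "\<beta> p + r"] by (simp_all add: x_def d_up)
  have y: "y \<in> elt_axis g" "d q y = t" "d y (a e y) = d q (a e q) - 2 * t"
    using t q displacement_up[OF e q(1), of "\<beta> q + t"] by (simp_all add: y_def d_up)
  note P = axisD(1)[OF x(1)] axisD(1)[OF y(1)]
  have "2 * d x y = \<bar>d x (a e x) - d y (a e y)\<bar>"
    using axis_dist_displacement[OF g e x(1) _ y(1)] x y p q r t by simp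
  moreover have "d p q \<le> d p x + d x y + d q y"
    using d_triangle[of p x q] d_triangle[of x y q] P p q by (simp add: d_sym)
  moreover have "\<bar>d x (a e x) - d y (a e y)\<bar> \<le> \<bar>d p (a e p) - d q (a e q)\<bar> + 2 * \<eta>"
    unfolding x(3) y(3) using r(1,2) t(1,2) by linarith
  ultimately have "2 * d p q \<le> 6 * \<eta> + \<bar>d p (a e p) - d q (a e q)\<bar>"
    unfolding x(2) y(2) using r(2) t(2) by linarith
  then show ?thesis by simp
qed

lemma d_act_inv: "g \<in> carrier G \<Longrightarrow> p \<in> P \<Longrightarrow> d p (a (inv g) p) = d p (a g p)"
  using d_act[of g p "a (inv g) p"] d_sym[of p "a g p"] by (simp add: act_in)

lemma axis_defect_inv:
  assumes "g \<in> carrier G" "p \<in> P"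
  shows "2 * d p (a (inv g) p) - d p (a (inv g \<otimes> inv g) p) = 2 * d p (a g p) - d p (a (g \<otimes> g) p)"
  using d_act_inv[of g] d_act_inv[of "g \<otimes> g"] assms by (simp add: inv_mult_group)

text \<open>In a nearby tree the sign of \<open>\<tau> g\<close> is not known in advance. The defect
  is the same for \<open>g\<close> and \<open>inv g\<close>, and one of them has positive
  shift.\<close>

lemma near_axis_dist_displacement:
  assumes g: "g \<in> carrier G" "\<tau> g \<noteq> 0" and e: "e \<in> carrier G" "\<tau> e = 0"
    and p: "p \<in> P" "2 * d p (a g p) - d p (a (g \<otimes> g) p) \<le> 2 * \<eta>" "2 * \<eta> < d p (a e p)"
    and q: "q \<in> P" "2 * d q (a g q) - d q (a (g \<otimes> g) q) \<le> 2 * \<eta>" "2 * \<eta> < d q (a e q)"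
  shows "d p q \<le> 3 * \<eta> + \<bar>d p (a e p) - d q (a e q)\<bar> / 2"
proof (cases "0 < \<tau> g")
  case True
  show ?thesis by (rule near_axis_dist_displacement_pos[OF g(1) True e p q])
next
  case False
  then have "inv g \<in> carrier G" "0 < \<tau> (inv g)" using g by (simp_all add: tau_inv)
  then show ?thesis
    by (rule near_axis_dist_displacement_pos[OF _ _ e])
      (use g p q in \<open>simp_all only: axis_defect_inv\<close>)
qed

text \<open>When \<open>g\<close> moves its axis points down, \<open>g x\<close> lies below
  \<open>x\<close> and \<open>e\<close> moves it at least as far. After conjugation,
  \<open>inv g \<otimes> (e \<otimes> g)\<close> moves \<open>x\<close> at least as far as
  \<open>e\<close> does. Passing between \<open>p\<close> and the axis costs
  \<open>2 * \<eta>\<close> for each of the two displacements.\<close>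

lemma near_axis_displacement_inv:
  assumes g: "g \<in> carrier G" "\<tau> g < 0" and e: "e \<in> carrier G" "\<tau> e = 0"
    and p: "p \<in> P" "2 * d p (a g p) - d p (a (g \<otimes> g) p) \<le> 2 * \<eta>"
  shows "d p (a e p) \<le> 4 * \<eta> + d p (a (inv g \<otimes> (e \<otimes> g)) p)"
proof -
  have i: "inv g \<in> carrier G" "0 < \<tau> (inv g)" using g by (simp_all add: tau_inv)
  have "2 * d p (a (inv g) p) - d p (a (inv g \<otimes> inv g) p) \<le> 2 * \<eta>"
    using p g by (simp add: axis_defect_inv)
  then obtain r where r: "0 \<le> r" "r \<le> \<eta>" "up p (\<beta> p + r) \<in> elt_axis (inv g)"
    by (rule near_axis[OF i p(1)])
  define x where "x = up p (\<beta> p + r)"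
  have x: "x \<in> elt_axis (inv g)" "d p x = r" using r p by (simp_all add: x_def d_up)
  note P = axisD(1)[OF x(1)]
  have conj: "a (inv g \<otimes> (e \<otimes> g)) y = a (inv g) (a e (a g y))" if "y \<in> P" for y
    using that g e by (simp add: act_mult act_in)
  have dconj: "d y (a (inv g \<otimes> (e \<otimes> g)) z) = d (a g y) (a e (a g z))" if "y \<in> P" "z \<in> P" for y z
    using that g e d_act[of g y "a (inv g) (a e (a g z))"] by (simp add: conj act_in)
  have "up (a g x) (\<beta> x) = a g (up x (\<beta> x - \<tau> g))"
    using act_up[of g x "\<beta> x - \<tau> g"] g P by simp
  also have "up x (\<beta> x - \<tau> g) = a (inv g) x" using axisD(2)[OF x(1)] g by (simp add: tau_inv)
  finally have "up (a g x) (\<beta> x) = x" using g P by simp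
  then have "d x (a e x) \<le> d (a g x) (a e (a g x))"
    using displacement_up[OF e, of "a g x" "\<beta> x"] d_nonneg[of "a g x" "a e (a g x)"] g e P
    by (simp add: act_in ht_act)
  moreover have "d p (a e p) \<le> d p x + d x (a e x) + d x p"
    using d_act_le[of e x x p p] e P p by simp
  moreover have "d x (a (inv g \<otimes> (e \<otimes> g)) x) \<le> d x p + d p (a (inv g \<otimes> (e \<otimes> g)) p) + d p x"
    using d_act_le[of "inv g \<otimes> (e \<otimes> g)" p p x x] e g P p by simp
  ultimately show ?thesis using dconj[OF P P] x(2) d_sym[of x p] P p r by simp
qed

text \<open>Displacements by \<open>g\<close> do not reveal the sign of \<open>\<tau> g\<close>,
  being the same for \<open>inv g\<close>. Comparing \<open>e\<close> with its conjugate
  \<open>k\<close> does: at an axis point moved by \<open>e\<close> the conjugate moves strictly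
  less if \<open>\<tau> g > 0\<close>, while a negative shift gives the opposite inequality up to an
  error.\<close>

lemma translation_pos_nbhd:
  assumes g: "g \<in> carrier G" "0 < \<tau> g"
  obtains X A \<epsilon> where "finite X" "X \<subseteq> P" "finite A" "A \<subseteq> carrier G" "0 < \<epsilon>"
    "\<And>T'' \<beta>'' up'' \<tau>''. horo_tree G T'' \<beta>'' up'' \<tau>'' \<Longrightarrow>
      (\<And>e. e \<in> carrier G \<Longrightarrow> \<tau>'' e = 0 \<longleftrightarrow> \<tau> e = 0) \<Longrightarrow> gromov_close G T X A \<epsilon> T'' \<Longrightarrow> 0 < \<tau>'' g"
proof -
  obtain e x where e: "e \<in> carrier G" "\<tau> e = 0" and x: "x \<in> elt_axis g" "a e x \<noteq> x"
    by (rule elliptic_moves_axis[OF g])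
  note P = axisD(1)[OF x(1)]
  define k where "k = inv g \<otimes> (e \<otimes> g)"
  have k: "k \<in> carrier G" using g e by (simp add: k_def)
  have "d x (a k x) = d (a g x) (a e (a g x))"
    using d_act[of g x "a k x"] g e k P by (simp add: k_def act_mult act_in)
  also have "\<dots> = max 0 (d x (a e x) - 2 * \<tau> g)"
    using displacement_up[OF e P, of "\<beta> x + \<tau> g"] axisD(2)[OF x(1)] g by simp
  finally have dk: "d x (a k x) = max 0 (d x (a e x) - 2 * \<tau> g)" .
  \<comment> \<open>Of the eight tolerances, six come from \<open>near_axis_displacement_inv\<close>
    with \<open>\<eta> = 3 / 2 * \<epsilon>\<close> and one each from approximating the
    displacements by \<open>e\<close> and \<open>k\<close>.\<close>
  define \<epsilon> where "\<epsilon> = (d x (a e x) - d x (a k x)) / 8"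
  have "0 < d x (a e x)"
    using x(2) d_nonneg[of x "a e x"] d_zero_iff[of x "a e x"] P e by (force simp: act_in)
  then have \<epsilon>: "0 < \<epsilon>" using g by (simp add: \<epsilon>_def dk)
  have eps: "d x (a e x) - d x (a k x) = 8 * \<epsilon>" by (simp add: \<epsilon>_def)
  show ?thesis
  proof (rule that[of "{x}" "{g, g \<otimes> g, e, k}" \<epsilon>])
    fix T'' \<beta>'' up'' \<tau>''
    assume h: "horo_tree G T'' \<beta>'' up'' \<tau>''"
      and ell: "\<And>e. e \<in> carrier G \<Longrightarrow> \<tau>'' e = 0 \<longleftrightarrow> \<tau> e = 0"
      and "gromov_close G T {x} {g, g \<otimes> g, e, k} \<epsilon> T''"
    then obtain f where f: "f x \<in> points T''"
      "\<And>c. c \<in> {g, g \<otimes> g, e, k} \<Longrightarrow>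
        \<bar>d x (a c x) - tdist T'' (f x) (act_pt G T'' c (f x))\<bar> < \<epsilon>"
      unfolding gromov_close_def by auto
    interpret T'': horo_tree G T'' \<beta>'' up'' \<tau>'' by (fact h)
    show "0 < \<tau>'' g"
    proof (rule ccontr)
      assume "\<not> 0 < \<tau>'' g"
      then have neg: "\<tau>'' g < 0" using ell[OF g(1)] g by (simp add: not_less le_less)
      \<comment> \<open>The defect vanishes at \<open>x\<close>; its approximation uses the
        displacement by \<open>g\<close> twice and that by \<open>g \<otimes> g\<close> once, for an
        error below \<open>3 * \<epsilon>\<close>.\<close>
      have "2 * T''.d (f x) (T''.a g (f x)) - T''.d (f x) (T''.a (g \<otimes> g) (f x)) \<le> 2 * (3 / 2 * \<epsilon>)"
        using f(2)[of g] f(2)[of "g \<otimes> g"] axis_dist_act[OF g x(1)] by (simp add: abs_if split: if_splits)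
      then have "T''.d (f x) (T''.a e (f x)) \<le> 4 * (3 / 2 * \<epsilon>) + T''.d (f x) (T''.a k (f x))"
        unfolding k_def using ell[OF e(1)] e f(1) g(1) neg
        by (intro T''.near_axis_displacement_inv) auto
      then show False using f(2)[of e] f(2)[of k] \<epsilon> eps by simp
    qed
  qed (use g e k P \<epsilon> in auto)
qed

end

section \<open>Unseparated trees\<close>

text \<open>The negation of separation at the level of trees: any two basic neighbourhoods of
  \<open>T\<close> and \<open>T'\<close> share a tree \<open>T''\<close> with the same elliptic
  elements.\<close>

locale unseparated_trees =
  T: horo_tree G T \<beta> up \<tau> + T': horo_tree G T' \<beta>' up' \<tau>'
  for G :: "('g, 'm) monoid_scheme" (structure) and T T' :: "('g, 'v) gtree"
    and \<beta> up \<tau> \<beta>' up' \<tau>' +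
  assumes elliptic_eq: "e \<in> carrier G \<Longrightarrow> \<tau>' e = 0 \<longleftrightarrow> \<tau> e = 0"
    and unseparated: "\<lbrakk>finite X; X \<subseteq> points T; finite A; A \<subseteq> carrier G; 0 < \<epsilon>;
      finite X'; X' \<subseteq> points T'; finite A'; A' \<subseteq> carrier G; 0 < \<epsilon>'\<rbrakk> \<Longrightarrow>
      \<exists>T'' \<beta>'' up'' \<tau>''. horo_tree G T'' \<beta>'' up'' \<tau>'' \<and> (\<forall>e\<in>carrier G. \<tau>'' e = 0 \<longleftrightarrow> \<tau> e = 0) \<and>
        gromov_close G T X A \<epsilon> T'' \<and> gromov_close G T' X' A' \<epsilon>' T''"
begin

text \<open>Otherwise \<open>T\<close> has a neighbourhood where \<open>g\<close> has positive shift
  and \<open>T'\<close> one where \<open>inv g\<close> does, and a common tree is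
  contradictory.\<close>

lemma translation_pos:
  assumes g: "g \<in> carrier G" "0 < \<tau> g"
  shows "0 < \<tau>' g"
proof (rule ccontr)
  assume "\<not> 0 < \<tau>' g"
  then have "\<tau>' g < 0" using elliptic_eq[OF g(1)] g by (simp add: not_less le_less)
  then have i: "inv g \<in> carrier G" "0 < \<tau>' (inv g)" using g by (simp_all add: T'.tau_inv)
  obtain X A \<epsilon> where 1: "finite X" "X \<subseteq> points T" "finite A" "A \<subseteq> carrier G" "0 < \<epsilon>"
    "\<And>T'' \<beta>'' up'' \<tau>''. horo_tree G T'' \<beta>'' up'' \<tau>'' \<Longrightarrow>
      (\<And>e. e \<in> carrier G \<Longrightarrow> \<tau>'' e = 0 \<longleftrightarrow> \<tau> e = 0) \<Longrightarrow> gromov_close G T X A \<epsilon> T'' \<Longrightarrow> 0 < \<tau>'' g"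
    by (rule T.translation_pos_nbhd[OF g]) blast
  obtain X' A' \<epsilon>' where 2: "finite X'" "X' \<subseteq> points T'" "finite A'" "A' \<subseteq> carrier G" "0 < \<epsilon>'"
    "\<And>T'' \<beta>'' up'' \<tau>''. horo_tree G T'' \<beta>'' up'' \<tau>'' \<Longrightarrow>
      (\<And>e. e \<in> carrier G \<Longrightarrow> \<tau>'' e = 0 \<longleftrightarrow> \<tau>' e = 0) \<Longrightarrow> gromov_close G T' X' A' \<epsilon>' T'' \<Longrightarrow>
      0 < \<tau>'' (inv g)"
    by (rule T'.translation_pos_nbhd[OF i]) blast
  obtain T'' \<beta>'' up'' \<tau>'' where h: "horo_tree G T'' \<beta>'' up'' \<tau>''"
    and ell: "\<forall>e\<in>carrier G. \<tau>'' e = 0 \<longleftrightarrow> \<tau> e = 0"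
    and close: "gromov_close G T X A \<epsilon> T''" "gromov_close G T' X' A' \<epsilon>' T''"
    using unseparated[OF 1(1-5) 2(1-5)] by blast
  interpret T'': horo_tree G T'' \<beta>'' up'' \<tau>'' by (fact h)
  have "0 < \<tau>'' g" using 1(6)[OF h _ close(1)] ell by blast
  moreover have "0 < \<tau>'' (inv g)" using 2(6)[OF h _ close(2)] ell elliptic_eq by blast
  ultimately show False using g by (simp add: T''.tau_inv)
qed

text \<open>If \<open>e\<close> moves \<open>x\<close> but fixes \<open>x'\<close>, and
  \<open>e'\<close> moves \<open>x'\<close> but fixes \<open>x\<close>, then
  \<open>e \<otimes> e'\<close> moves both; it is elliptic because shifts add.\<close>

lemma common_elliptic_moves_axis:
  assumes g: "g \<in> carrier G" "0 < \<tau> g"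
  obtains e where "e \<in> carrier G" "\<tau> e = 0"
    "\<exists>x\<in>T.elt_axis g. T.a e x \<noteq> x" "\<exists>x\<in>T'.elt_axis g. T'.a e x \<noteq> x"
proof -
  obtain e x where e: "e \<in> carrier G" "\<tau> e = 0" and x: "x \<in> T.elt_axis g" "T.a e x \<noteq> x"
    by (rule T.elliptic_moves_axis[OF g])
  obtain e' x' where e': "e' \<in> carrier G" "\<tau>' e' = 0" and x': "x' \<in> T'.elt_axis g" "T'.a e' x' \<noteq> x'"
    by (rule T'.elliptic_moves_axis[OF g(1) translation_pos[OF g]])
  note P = T.axisD(1)[OF x(1)] and P' = T'.axisD(1)[OF x'(1)]
  consider "\<exists>x\<in>T'.elt_axis g. T'.a e x \<noteq> x" | "\<exists>x\<in>T.elt_axis g. T.a e' x \<noteq> x"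
    | "T'.a e x' = x'" "T.a e' x = x" using x x' by blast
  then show ?thesis
  proof cases
    case 3
    have "\<tau> (e \<otimes> e') = 0" using e e' elliptic_eq[OF e'(1)] by (simp add: T.tau_mult)
    moreover have "T.a (e \<otimes> e') x \<noteq> x" using 3 e e' x P by (simp add: T.act_mult)
    moreover have "T'.a e (T'.a e' x') \<noteq> x'"
      using 3(1) x'(2) e e' P' T'.act_inj[of e "T'.a e' x'" x'] by (simp add: T'.act_in)
    then have "T'.a (e \<otimes> e') x' \<noteq> x'" using e e' P' by (simp add: T'.act_mult)
    ultimately show ?thesis using that[of "e \<otimes> e'"] e e' x(1) x'(1) by blast
  qed (use that e e' x x' elliptic_eq in blast)+
qed

text \<open>
  In a tree close to both \<open>T\<close> and \<open>T'\<close>, the points corresponding to \<open>x\<close> and \<open>x'\<close> are near the axis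
  of \<open>g\<close> and moved by \<open>e\<close> by nearly the same positive amount, hence they are near each other.
\<close>

lemma paired_dist_eq:
  assumes g: "g \<in> carrier G" "0 < \<tau> g" and e: "e \<in> carrier G" "\<tau> e = 0" and b: "b \<in> carrier G"
    and x: "x \<in> T.elt_axis g" "0 < T.d x (T.a e x)"
    and x': "x' \<in> T'.elt_axis g" "T'.d x' (T'.a e x') = T.d x (T.a e x)"
    and y: "y \<in> T.elt_axis g" "0 < T.d y (T.a e y)"
    and y': "y' \<in> T'.elt_axis g" "T'.d y' (T'.a e y') = T.d y (T.a e y)"
  shows "T'.d x' (T'.a b y') = T.d x (T.a b y)"
proof -
  have g': "0 < \<tau>' g" using translation_pos[OF g] .
  have "\<bar>T'.d x' (T'.a b y') - T.d x (T.a b y)\<bar> \<le> 0"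
  proof (rule field_le_epsilon)
    fix \<delta> :: real assume \<delta>: "0 < \<delta>"
    \<comment> \<open>Each of the two pairs contributes \<open>11 / 2 * \<epsilon>\<close> and each
      of the two approximations contributes \<epsilon>, 13 in all. The bounds by a fifth keep the
      displacements in \<open>T''\<close> above \<open>4 * \<epsilon>\<close>, while
      \<open>3 * \<epsilon>\<close> is required near the axis.\<close>
    define \<epsilon> where "\<epsilon> = min (\<delta> / 13) (min (T.d x (T.a e x) / 5) (T.d y (T.a e y) / 5))"
    have \<epsilon>: "0 < \<epsilon>" "13 * \<epsilon> \<le> \<delta>" "5 * \<epsilon> \<le> T.d x (T.a e x)" "5 * \<epsilon> \<le> T.d y (T.a e y)"
      using \<delta> x y by (auto simp: \<epsilon>_def)
    \<comment> \<open>Displacements by \<open>g\<close> and \<open>g \<otimes> g\<close> control the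
      distance to the axis and those by \<open>e\<close> the position along it; \<open>b\<close>
      enters the distance to be compared.\<close>
    define A where "A = {g, g \<otimes> g, e, b}"
    have A: "finite A" "A \<subseteq> carrier G" using g e b by (auto simp: A_def)
    have X: "finite {x, y}" "{x, y} \<subseteq> points T" "finite {x', y'}" "{x', y'} \<subseteq> points T'"
      using x y x' y' T.axisD(1) T'.axisD(1) by auto
    obtain T'' \<beta>'' up'' \<tau>'' where h: "horo_tree G T'' \<beta>'' up'' \<tau>''"
      and ell: "\<forall>e\<in>carrier G. \<tau>'' e = 0 \<longleftrightarrow> \<tau> e = 0"
      and close: "gromov_close G T {x, y} A \<epsilon> T''" "gromov_close G T' {x', y'} A \<epsilon> T''"
      using unseparated[OF X(1,2) A \<epsilon>(1) X(3,4) A \<epsilon>(1)] by blast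
    interpret T'': horo_tree G T'' \<beta>'' up'' \<tau>'' by (fact h)
    obtain f where *: "f ` {x, y} \<subseteq> points T''"
      "\<forall>u\<in>{x, y}. \<forall>v\<in>{x, y}. \<forall>c\<in>A.
        \<bar>T.d u (T.a c v) - T''.d (f u) (T''.a c (f v))\<bar> < \<epsilon>"
      using close(1) unfolding gromov_close_def by blast
    have f: "f x \<in> points T''" "f y \<in> points T''"
      "\<And>u v c. u \<in> {x, y} \<Longrightarrow> v \<in> {x, y} \<Longrightarrow> c \<in> A \<Longrightarrow>
        \<bar>T.d u (T.a c v) - T''.d (f u) (T''.a c (f v))\<bar> < \<epsilon>"
      using *(1) *(2)[rule_format] by simp_all
    obtain f' where *: "f' ` {x', y'} \<subseteq> points T''"
      "\<forall>u\<in>{x', y'}. \<forall>v\<in>{x', y'}. \<forall>c\<in>A.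
        \<bar>T'.d u (T'.a c v) - T''.d (f' u) (T''.a c (f' v))\<bar> < \<epsilon>"
      using close(2) unfolding gromov_close_def by blast
    have f': "f' x' \<in> points T''" "f' y' \<in> points T''"
      "\<And>u v c. u \<in> {x', y'} \<Longrightarrow> v \<in> {x', y'} \<Longrightarrow> c \<in> A \<Longrightarrow>
        \<bar>T'.d u (T'.a c v) - T''.d (f' u) (T''.a c (f' v))\<bar> < \<epsilon>"
      using *(1) *(2)[rule_format] by simp_all
    have near: "T''.d (f u) (f' u') \<le> 11 / 2 * \<epsilon>"
      if u: "u \<in> {x, y}" "u' \<in> {x', y'}" "T'.d u' (T'.a e u') = T.d u (T.a e u)" for u u'
    proof -
      have u_axis: "u \<in> T.elt_axis g" "u' \<in> T'.elt_axis g" using u x y x' y' by auto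
      have c: "\<bar>T.d u (T.a c u) - T''.d (f u) (T''.a c (f u))\<bar> < \<epsilon>"
        "\<bar>T'.d u' (T'.a c u') - T''.d (f' u') (T''.a c (f' u'))\<bar> < \<epsilon>" if "c \<in> A" for c
        using f(3) f'(3) u that by blast+
      have big: "5 * \<epsilon> \<le> T.d u (T.a e u)" using u \<epsilon> by auto
      have A': "g \<in> A" "g \<otimes> g \<in> A" "e \<in> A" by (auto simp: A_def)
      have "T''.d (f u) (f' u') \<le> 3 * (3 / 2 * \<epsilon>) +
          \<bar>T''.d (f u) (T''.a e (f u)) - T''.d (f' u') (T''.a e (f' u'))\<bar> / 2"
      proof (rule T''.near_axis_dist_displacement[OF g(1) _ e(1)])
        show "\<tau>'' e = 0" using ell e by blast
        show "f u \<in> points T''" "f' u' \<in> points T''" using u f f' by auto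
        show "2 * T''.d (f u) (T''.a g (f u)) - T''.d (f u) (T''.a (g \<otimes> g) (f u)) \<le> 2 * (3 / 2 * \<epsilon>)"
          using c(1)[OF A'(1)] c(1)[OF A'(2)] T.axis_dist_act[OF g u_axis(1)]
          by (simp add: abs_if split: if_splits)
        show "2 * T''.d (f' u') (T''.a g (f' u')) - T''.d (f' u') (T''.a (g \<otimes> g) (f' u')) \<le> 2 * (3 / 2 * \<epsilon>)"
          using c(2)[OF A'(1)] c(2)[OF A'(2)] T'.axis_dist_act[OF g(1) g' u_axis(2)]
          by (simp add: abs_if split: if_splits)
        show "2 * (3 / 2 * \<epsilon>) < T''.d (f u) (T''.a e (f u))"
          "2 * (3 / 2 * \<epsilon>) < T''.d (f' u') (T''.a e (f' u'))"
          using c[OF A'(3)] u(3) big \<epsilon>(1) by (simp_all add: abs_if split: if_splits)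
        show "\<tau>'' g \<noteq> 0" using ell g by force
      qed
      moreover have "\<bar>T''.d (f u) (T''.a e (f u)) - T''.d (f' u') (T''.a e (f' u'))\<bar> \<le> 2 * \<epsilon>"
        using c[OF A'(3)] u(3) by linarith
      ultimately show ?thesis by simp
    qed
    have "T''.d (f x) (f' x') \<le> 11 / 2 * \<epsilon>" "T''.d (f y) (f' y') \<le> 11 / 2 * \<epsilon>"
      using near x' y' by auto
    moreover have "\<bar>T.d x (T.a b y) - T''.d (f x) (T''.a b (f y))\<bar> < \<epsilon>"
      "\<bar>T'.d x' (T'.a b y') - T''.d (f' x') (T''.a b (f' y'))\<bar> < \<epsilon>"
      using f(3) f'(3) by (auto simp: A_def)
    moreover have "T''.d (f x) (T''.a b (f y)) \<le>
        T''.d (f x) (f' x') + T''.d (f' x') (T''.a b (f' y')) + T''.d (f' y') (f y)"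
      "T''.d (f' x') (T''.a b (f' y')) \<le>
        T''.d (f' x') (f x) + T''.d (f x) (T''.a b (f y)) + T''.d (f y) (f' y')"
      by (rule T''.d_act_le[OF b]; use f f' in blast)+
    ultimately show "\<bar>T'.d x' (T'.a b y') - T.d x (T.a b y)\<bar> \<le> 0 + \<delta>"
      using \<epsilon>(2) T''.d_sym[OF f(1) f'(1)] T''.d_sym[OF f(2) f'(2)] by linarith
  qed
  then show ?thesis by simp
qed

text \<open>By \<open>paired_dist_eq\<close> the pairing of \<open>b x\<close> with
  \<open>b x'\<close> preserves distances, and every point of either tree occurs in it. Two partners
  of one point are at distance 0, so the pairing is the graph of an isometry.\<close>

lemma equivariant_isometry_exists: "\<exists>f. equivariant_isometry G T T' f"
proof -
  obtain g where g: "g \<in> carrier G" "0 < \<tau> g" using T.hyperbolic by blast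
  have g': "0 < \<tau>' g" using translation_pos[OF g] .
  obtain e where e: "e \<in> carrier G" "\<tau> e = 0"
    and moves: "\<exists>x\<in>T.elt_axis g. T.a e x \<noteq> x" "\<exists>x\<in>T'.elt_axis g. T'.a e x \<noteq> x"
    by (rule common_elliptic_moves_axis[OF g])
  have e': "\<tau>' e = 0" using e elliptic_eq by blast
  obtain x0 where x0: "x0 \<in> T.elt_axis g" "T.a e x0 \<noteq> x0" using moves(1) by blast
  obtain x0' where x0': "x0' \<in> T'.elt_axis g" "T'.a e x0' \<noteq> x0'" using moves(2) by blast
  have d0: "0 < T.d x0 (T.a e x0)"
    using T.d_nonneg[of x0 "T.a e x0"] T.d_zero_iff[of x0 "T.a e x0"] x0 e T.axisD(1)
    by (force simp: T.act_in)
  have d0': "0 < T'.d x0' (T'.a e x0')"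
    using T'.d_nonneg[of x0' "T'.a e x0'"] T'.d_zero_iff[of x0' "T'.a e x0'"] x0' e T'.axisD(1)
    by (force simp: T'.act_in)
  define R where "R p p' \<longleftrightarrow> (\<exists>b\<in>carrier G. \<exists>x\<in>T.elt_axis g. \<exists>x'\<in>T'.elt_axis g.
      0 < T.d x (T.a e x) \<and> T'.d x' (T'.a e x') = T.d x (T.a e x) \<and> p = T.a b x \<and> p' = T'.a b x')"
    for p p'
  have R_dist: "T'.d p' q' = T.d p q" if R: "R p p'" "R q q'" for p p' q q'
  proof -
    obtain b x x' where p: "b \<in> carrier G" "x \<in> T.elt_axis g" "x' \<in> T'.elt_axis g"
      "0 < T.d x (T.a e x)" "T'.d x' (T'.a e x') = T.d x (T.a e x)" "p = T.a b x" "p' = T'.a b x'"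
      using R(1) unfolding R_def by blast
    obtain c y y' where q: "c \<in> carrier G" "y \<in> T.elt_axis g" "y' \<in> T'.elt_axis g"
      "0 < T.d y (T.a e y)" "T'.d y' (T'.a e y') = T.d y (T.a e y)" "q = T.a c y" "q' = T'.a c y'"
      using R(2) unfolding R_def by blast
    \<comment> \<open>Translating by \<open>inv b\<close> leaves the distance from an axis point to
      the translate of an axis point by a single element.\<close>
    define k where "k = inv b \<otimes> c"
    have k: "k \<in> carrier G" using p q by (simp add: k_def)
    note P = T.axisD(1)[OF p(2)] T.axisD(1)[OF q(2)] T'.axisD(1)[OF p(3)] T'.axisD(1)[OF q(3)]
    have "T.d p q = T.d x (T.a k y)"
      using T.d_act[OF p(1), of x "T.a k y"] p q k P by (simp add: k_def T.act_mult T.act_in)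
    moreover have "T'.d p' q' = T'.d x' (T'.a k y')"
      using T'.d_act[OF p(1), of x' "T'.a k y'"] p q k P by (simp add: k_def T'.act_mult T'.act_in)
    ultimately show ?thesis using paired_dist_eq[OF g e k p(2,4,3,5) q(2,4,3,5)] by simp
  qed
  have R_in: "p \<in> points T" "p' \<in> points T'" if "R p p'" for p p'
    using that T.axisD(1) T'.axisD(1) unfolding R_def by (auto simp: T.act_in T'.act_in)
  have R_left: "\<exists>p'. R p p'" if p: "p \<in> points T" for p
  proof -
    obtain b x where bx: "b \<in> carrier G" "x \<in> T.elt_axis g" "0 < T.d x (T.a e x)" "p = T.a b x"
      by (rule T.conj_axis_cover_moved[OF g e x0 p])
    obtain x' where "x' \<in> T'.elt_axis g" "T'.d x' (T'.a e x') = T.d x (T.a e x)"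
      by (rule T'.axis_displacement_exists[OF g(1) g' e(1) e' x0'(1) d0' bx(3)])
    then show ?thesis using bx unfolding R_def by blast
  qed
  have R_right: "\<exists>p. R p p'" if p: "p' \<in> points T'" for p'
  proof -
    obtain b x' where bx: "b \<in> carrier G" "x' \<in> T'.elt_axis g" "0 < T'.d x' (T'.a e x')" "p' = T'.a b x'"
      by (rule T'.conj_axis_cover_moved[OF g(1) g' e(1) e' x0' p])
    obtain x where "x \<in> T.elt_axis g" "T.d x (T.a e x) = T'.d x' (T'.a e x')"
      by (rule T.axis_displacement_exists[OF g e x0(1) d0 bx(3)])
    then show ?thesis using bx unfolding R_def by metis
  qed
  have R_act: "R (T.a c p) (T'.a c p')" if c: "c \<in> carrier G" and R: "R p p'" for c p p'
  proof -
    obtain b x x' where p: "b \<in> carrier G" "x \<in> T.elt_axis g" "x' \<in> T'.elt_axis g"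
      "0 < T.d x (T.a e x)" "T'.d x' (T'.a e x') = T.d x (T.a e x)" "p = T.a b x" "p' = T'.a b x'"
      using R unfolding R_def by blast
    then have "T.a c p = T.a (c \<otimes> b) x" "T'.a c p' = T'.a (c \<otimes> b) x'"
      using c T.axisD(1) T'.axisD(1) by (simp_all add: T.act_mult T'.act_mult)
    then show ?thesis using p c unfolding R_def by blast
  qed
  define f where "f p = (SOME p'. R p p')" for p
  have f: "R p (f p)" if "p \<in> points T" for p
    using R_left[OF that] unfolding f_def by (rule someI_ex)
  have f_eq: "f p = p'" if R: "R p p'" for p p'
  proof -
    have "T'.d (f p) p' = T.d p p" using R_dist[OF f[OF R_in(1)[OF R]] R] .
    also have "\<dots> = 0" using T.d_zero_iff R_in(1)[OF R] by blast
    finally show ?thesis using T'.d_zero_iff R_in(2) f R_in(1)[OF R] R by blast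
  qed
  have "bij_betw f (points T) (points T')"
  proof (rule bij_betw_imageI)
    show "inj_on f (points T)"
    proof (rule inj_onI)
      fix p q assume pq: "p \<in> points T" "q \<in> points T" "f p = f q"
      have "T.d p q = T'.d (f p) (f q)" using R_dist[OF f[OF pq(1)] f[OF pq(2)]] by simp
      also have "\<dots> = 0" using pq T'.d_zero_iff R_in(2) f by metis
      finally show "p = q" using pq T.d_zero_iff by blast
    qed
    show "f ` points T = points T'" using R_right f_eq R_in f by force
  qed
  then have "equivariant_isometry G T T' f"
    unfolding equivariant_isometry_def using R_dist f f_eq R_act by blast
  then show ?thesis by blast
qed

end

section \<open>Iterates of the parent map and the action on vertices\<close>

context end_tree
begin

abbreviation V where "V \<equiv> verts T"
abbreviation gv where "gv \<equiv> act T"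

lemma tree: "is_tree V (edges T)"
  using metric_tree by (simp add: metric_G_tree_def)

lemma group_act: "group_action G V gv"
  using metric_tree by (simp add: metric_G_tree_def)

lemma group: "group G"
  using finitely_generated by (simp add: finitely_generated_group_def)

lemma vert_nonempty: "V \<noteq> {}"
  using tree by (simp add: is_tree_def)

lemma gv_in [simp]: "g \<in> carrier G \<Longrightarrow> v \<in> V \<Longrightarrow> gv g v \<in> V"
  using group_action.element_image[OF group_act] by blast

lemma gv_mult:
  "g \<in> carrier G \<Longrightarrow> k \<in> carrier G \<Longrightarrow> v \<in> V \<Longrightarrow> gv (g \<otimes>\<^bsub>G\<^esub> k) v = gv g (gv k v)"
  using group_action.composition_rule[OF group_act] by blast

lemma gv_one: "v \<in> V \<Longrightarrow> gv \<one>\<^bsub>G\<^esub> v = v"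
  using group_action.id_eq_one[OF group_act] by (metis restrict_apply')

lemma gv_inv [simp]:
  assumes "g \<in> carrier G" "v \<in> V"
  shows "gv (inv\<^bsub>G\<^esub> g) (gv g v) = v" "gv g (gv (inv\<^bsub>G\<^esub> g) v) = v"
proof -
  interpret group G by (fact group)
  show "gv (inv\<^bsub>G\<^esub> g) (gv g v) = v" "gv g (gv (inv\<^bsub>G\<^esub> g) v) = v"
    using assms by (simp_all add: gv_one flip: gv_mult)
qed

lemma pow_in [simp]: "v \<in> V \<Longrightarrow> (\<pi> ^^ n) v \<in> V"
  by (induction n) (auto simp: parent_in)

lemma pow_act:
  assumes "g \<in> carrier G" "v \<in> V"
  shows "(\<pi> ^^ n) (gv g v) = gv g ((\<pi> ^^ n) v)"
  using assms by (induction n) (auto simp: parent_act)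

lemma pow_add: "(\<pi> ^^ m) ((\<pi> ^^ n) v) = (\<pi> ^^ (m + n)) v"
  by (simp add: funpow_add)

lemma pow_inj:
  assumes v: "v \<in> V" and eq: "(\<pi> ^^ m) v = (\<pi> ^^ n) v"
  shows "m = n"
proof -
  have "\<not> m < n" if "(\<pi> ^^ m) v = (\<pi> ^^ n) v" for m n
  proof
    assume "m < n"
    then have "n - m + m = n" by simp
    then have "(\<pi> ^^ (n - m)) ((\<pi> ^^ m) v) = (\<pi> ^^ n) v" by (simp only: pow_add)
    then have "(\<pi> ^^ (n - m)) ((\<pi> ^^ m) v) = (\<pi> ^^ m) v" by (rule trans[OF _ that[symmetric]])
    then show False using parent_acyclic[of "(\<pi> ^^ m) v" "n - m"] v \<open>m < n\<close> by simp
  qed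
  from this[OF eq] this[OF eq[symmetric]] show ?thesis by simp
qed

lemma parent_neq: "v \<in> V \<Longrightarrow> \<pi> v \<noteq> v"
  using parent_acyclic[of v 1] by simp

lemma parent_edge: "v \<in> V \<Longrightarrow> {v, \<pi> v} \<in> edges T"
  by (auto simp: edges_parent)

section \<open>Heights of vertices\<close>

definition ascent :: "'v \<Rightarrow> nat \<Rightarrow> real" where
  "ascent v n = (\<Sum>i<n. len T {(\<pi> ^^ i) v, \<pi> ((\<pi> ^^ i) v)})"

lemma ascent_add: "ascent v (m + n) = ascent v m + ascent ((\<pi> ^^ m) v) n"
  by (induction n) (simp_all add: ascent_def pow_add add.commute)

text \<open>By acyclicity, two meetings of the rays are the same number of steps apart on both rays,
  along the same edges, so both ascents change equally. This makes relative heights well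
  defined.\<close>

lemma ascent_diff_unique:
  assumes "u \<in> V" "v \<in> V" "(\<pi> ^^ m) u = (\<pi> ^^ n) v" "(\<pi> ^^ m') u = (\<pi> ^^ n') v"
  shows "ascent v n - ascent u m = ascent v n' - ascent u m'"
proof -
  have *: "ascent v n - ascent u m = ascent v n' - ascent u m'"
    if eq: "(\<pi> ^^ m) u = (\<pi> ^^ n) v" "(\<pi> ^^ m') u = (\<pi> ^^ n') v" "m \<le> m'" for m n m' n'
  proof -
    obtain k where k: "m' = m + k" using eq(3) le_Suc_ex by blast
    have "(\<pi> ^^ n') v = (\<pi> ^^ k) ((\<pi> ^^ m) u)" using eq(2) by (simp add: k pow_add add.commute)
    also have "\<dots> = (\<pi> ^^ (n + k)) v" by (simp add: eq(1) pow_add add.commute)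
    finally have "n' = n + k" using assms(2) pow_inj by blast
    then show ?thesis by (simp add: k ascent_add eq(1))
  qed
  show ?thesis using *[OF assms(3,4)] *[OF assms(4,3)] by linarith
qed

text \<open>A Busemann function: the height of \<open>v\<close> relative to \<open>v0\<close> comes
  from climbing from \<open>v0\<close> to a common ancestor and descending to
  \<open>v\<close>.\<close>

lemma height_exists: "\<exists>H. \<forall>v\<in>V. H (\<pi> v) = H v + len T {v, \<pi> v}"
proof -
  obtain v0 where v0: "v0 \<in> V" using vert_nonempty by blast
  have "\<forall>v\<in>V. \<exists>x. \<exists>m n. (\<pi> ^^ m) v = (\<pi> ^^ n) v0 \<and> x = ascent v0 n - ascent v m"
    using parent_merge[OF _ v0] by blast
  from bchoice[OF this] obtain H where H: "\<And>v. v \<in> V \<Longrightarrow>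
      \<exists>m n. (\<pi> ^^ m) v = (\<pi> ^^ n) v0 \<and> H v = ascent v0 n - ascent v m"
    by blast
  have "H (\<pi> v) = H v + len T {v, \<pi> v}" if v: "v \<in> V" for v
  proof -
    obtain m n where 1: "(\<pi> ^^ m) v = (\<pi> ^^ n) v0" "H v = ascent v0 n - ascent v m"
      using H[OF v] by blast
    obtain m' n' where 2: "(\<pi> ^^ m') (\<pi> v) = (\<pi> ^^ n') v0" "H (\<pi> v) = ascent v0 n' - ascent (\<pi> v) m'"
      using H[OF parent_in[OF v]] by blast
    have "(\<pi> ^^ (1 + m')) v = (\<pi> ^^ n') v0" using 2(1) by (simp add: funpow_Suc_right del: funpow.simps)
    from ascent_diff_unique[OF v v0 1(1) this]
    have "H v = ascent v0 n' - ascent v (1 + m')" by (simp only: 1(2))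
    moreover have "ascent v (1 + m') = len T {v, \<pi> v} + ascent (\<pi> v) m'"
      by (subst ascent_add) (simp add: ascent_def)
    ultimately show ?thesis by (simp only: 2(2))
  qed
  then show ?thesis by blast
qed

text \<open>The equation determines the height on \<open>V\<close> up to an additive constant, since
  any two vertices have a common ancestor; \<open>SOME\<close> fixes the constant.\<close>

definition ht :: "'v \<Rightarrow> real" where
  "ht = (SOME H. \<forall>v\<in>V. H (\<pi> v) = H v + len T {v, \<pi> v})"

lemma ht_parent: "v \<in> V \<Longrightarrow> ht (\<pi> v) = ht v + len T {v, \<pi> v}"
  using someI_ex[OF height_exists] unfolding ht_def by blast

lemma ht_parent_gt: "v \<in> V \<Longrightarrow> ht v < ht (\<pi> v)"
  using metric_tree parent_edge by (simp add: ht_parent metric_G_tree_def)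

lemma ht_pow_strict_mono:
  assumes "v \<in> V"
  shows "strict_mono (\<lambda>n. ht ((\<pi> ^^ n) v))"
  using ht_parent_gt assms by (simp add: strict_mono_Suc_iff)

lemma ht_pow_less_iff: "v \<in> V \<Longrightarrow> ht ((\<pi> ^^ m) v) < ht ((\<pi> ^^ n) v) \<longleftrightarrow> m < n"
  using strict_mono_less[OF ht_pow_strict_mono] by blast

lemma ht_pow_le_iff: "v \<in> V \<Longrightarrow> ht ((\<pi> ^^ m) v) \<le> ht ((\<pi> ^^ n) v) \<longleftrightarrow> m \<le> n"
  using strict_mono_less_eq[OF ht_pow_strict_mono] by blast

definition shift :: "'g \<Rightarrow> real" where
  "shift g = (THE t. \<forall>v\<in>V. ht (gv g v) = ht v + t)"

text \<open>Edge lengths are invariant, so \<open>g\<close> changes the heights of a vertex and of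
  its parent equally, hence those of any two vertices, which have a common ancestor.\<close>

lemma ht_gv:
  assumes g: "g \<in> carrier G" and v: "v \<in> V"
  shows "ht (gv g v) = ht v + shift g"
proof -
  have parent: "ht (gv g (\<pi> v)) - ht (\<pi> v) = ht (gv g v) - ht v" if v: "v \<in> V" for v
  proof -
    have "gv g ` {v, \<pi> v} = {gv g v, \<pi> (gv g v)}" using g v by (simp add: parent_act)
    then have "len T {gv g v, \<pi> (gv g v)} = len T {v, \<pi> v}"
      using metric_tree parent_edge[OF v] g unfolding metric_G_tree_def by metis
    then show ?thesis using ht_parent[of "gv g v"] ht_parent[OF v] g v by (simp add: parent_act)
  qed
  have pow: "ht (gv g ((\<pi> ^^ n) v)) - ht ((\<pi> ^^ n) v) = ht (gv g v) - ht v" if "v \<in> V" for v n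
    using that by (induction n) (simp_all add: parent)
  have const: "ht (gv g u) - ht u = ht (gv g v) - ht v" if "u \<in> V" for u
    using parent_merge[OF that v] pow[OF that] pow[OF v] by metis
  have "shift g = ht (gv g v) - ht v"
    unfolding shift_def
  proof (rule the_equality)
    show "\<forall>u\<in>V. ht (gv g u) = ht u + (ht (gv g v) - ht v)" using const by force
  qed (use v in force)
  then show ?thesis by simp
qed

section \<open>Minimality and hyperbolic elements\<close>

text \<open>A connected subgraph of a tree inherits the absence of circuits, so minimality applies.
  The edge set is a parameter to allow for a single vertex without edges.\<close>

lemma invariant_verts_eq:
  assumes W: "W \<subseteq> V" "W \<noteq> {}" and F: "F \<subseteq> edges T" "\<And>e. e \<in> F \<Longrightarrow> e \<subseteq> W"
    and conn: "\<And>u v. u \<in> W \<Longrightarrow> v \<in> W \<Longrightarrow> (\<lambda>x y. {x, y} \<in> F)\<^sup>*\<^sup>* u v"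
    and inv: "\<And>g v. g \<in> carrier G \<Longrightarrow> v \<in> W \<Longrightarrow> gv g v \<in> W"
      "\<And>g e. g \<in> carrier G \<Longrightarrow> e \<in> F \<Longrightarrow> gv g ` e \<in> F"
  shows "W = V"
proof -
  have succ: "successively (\<lambda>x y. {x, y} \<in> edges T) xs"
    if "successively (\<lambda>x y. {x, y} \<in> F) xs" for xs
    by (rule successively_mono[OF that]) (use F(1) in blast)
  have "is_tree W F"
    unfolding is_tree_def
  proof (intro conjI)
    show "\<forall>e\<in>F. e \<subseteq> W \<and> card e = 2" using F tree unfolding is_tree_def by blast
    show "\<not> (\<exists>xs. distinct xs \<and> 3 \<le> length xs \<and>
        successively (\<lambda>x y. {x, y} \<in> F) xs \<and> {last xs, hd xs} \<in> F)"
      using tree F(1) succ unfolding is_tree_def by blast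
  qed (use W conn in auto)
  moreover have "minimal G T" using metric_tree by (simp add: metric_G_tree_def)
  ultimately have "W = V \<and> F = edges T"
    using W(1) F(1) inv unfolding minimal_def by blast
  then show ?thesis ..
qed

lemma invariant_parent_closed_eq:
  assumes W: "W \<subseteq> V" "W \<noteq> {}" and parent: "\<And>v. v \<in> W \<Longrightarrow> \<pi> v \<in> W"
    and inv: "\<And>g v. g \<in> carrier G \<Longrightarrow> v \<in> W \<Longrightarrow> gv g v \<in> W"
  shows "W = V"
proof (rule invariant_verts_eq[where F = "(\<lambda>v. {v, \<pi> v}) ` W"])
  let ?F = "(\<lambda>v. {v, \<pi> v}) ` W"
  show "?F \<subseteq> edges T" using W parent_edge by auto
  show "e \<subseteq> W" if "e \<in> ?F" for e using that parent by auto
  define R where "R = (\<lambda>x y. {x, y} \<in> ?F)"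
  have R: "R v (\<pi> v)" "R (\<pi> v) v" if "v \<in> W" for v
    using that unfolding R_def by (auto simp: insert_commute)
  have up: "R\<^sup>*\<^sup>* v ((\<pi> ^^ n) v) \<and> R\<^sup>*\<^sup>* ((\<pi> ^^ n) v) v \<and> (\<pi> ^^ n) v \<in> W" if "v \<in> W" for v n
  proof (induction n)
    case 0
    then show ?case using that by simp
  next
    case (Suc n)
    then have "R ((\<pi> ^^ n) v) ((\<pi> ^^ Suc n) v)" "R ((\<pi> ^^ Suc n) v) ((\<pi> ^^ n) v)"
      using R by simp_all
    note step = this
    have "R\<^sup>*\<^sup>* v ((\<pi> ^^ Suc n) v)"
      using conjunct1[OF Suc] step(1) by (rule rtranclp.rtrancl_into_rtrancl)
    moreover have "R\<^sup>*\<^sup>* ((\<pi> ^^ Suc n) v) v"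
      using step(2) conjunct1[OF conjunct2[OF Suc]] by (rule converse_rtranclp_into_rtranclp)
    ultimately show ?case using Suc parent by simp
  qed
  show "(\<lambda>x y. {x, y} \<in> ?F)\<^sup>*\<^sup>* u v" if uv: "u \<in> W" "v \<in> W" for u v
  proof -
    obtain m n where mn: "(\<pi> ^^ m) u = (\<pi> ^^ n) v" using parent_merge[OF subsetD[OF W(1) uv(1)] subsetD[OF W(1) uv(2)]] by blast
    have "R\<^sup>*\<^sup>* u ((\<pi> ^^ m) u)" "R\<^sup>*\<^sup>* ((\<pi> ^^ n) v) v"
      using up[OF uv(1), of m] up[OF uv(2), of n] by simp_all
    then have "R\<^sup>*\<^sup>* u v" unfolding mn by (rule rtranclp_trans)
    then show ?thesis unfolding R_def .
  qed
  show "gv g ` e \<in> ?F" if g: "g \<in> carrier G" "e \<in> ?F" for g e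
  proof -
    obtain v where v: "v \<in> W" "e = {v, \<pi> v}" using g by blast
    then have "gv g ` e = {gv g v, \<pi> (gv g v)}" using g W parent_act[of g v] by auto
    then show ?thesis using inv[OF g(1) v(1)] by blast
  qed
qed (fact W inv)+

text \<open>Otherwise every element fixes an ancestor of \<open>v0\<close>, so finitely many
  generators fix a common one. This vertex alone would be an invariant subtree, hence the whole
  tree, but its parent is another vertex.\<close>

lemma hyperbolic_vertex:
  obtains g v k where "g \<in> carrier G" "v \<in> V" "0 < k" "gv g v = (\<pi> ^^ k) v"
proof -
  interpret group G by (fact group)
  have "\<exists>g v k. g \<in> carrier G \<and> v \<in> V \<and> 0 < k \<and> gv g v = (\<pi> ^^ k) v"
  proof (rule ccontr)
    assume "\<not> ?thesis"
    then have none: "\<not> (g \<in> carrier G \<and> v \<in> V \<and> 0 < k \<and> gv g v = (\<pi> ^^ k) v)" for g v k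
      by blast
    obtain v0 where v0: "v0 \<in> V" using vert_nonempty by blast
    obtain S where S: "finite S" "S \<subseteq> carrier G" "generate G S = carrier G"
      using finitely_generated by (auto simp: finitely_generated_group_def)
    have "\<exists>n. gv s ((\<pi> ^^ n) v0) = (\<pi> ^^ n) v0" if s: "s \<in> carrier G" for s
    proof -
      obtain m n where mn: "(\<pi> ^^ m) (gv s v0) = (\<pi> ^^ n) v0"
        using parent_merge[of "gv s v0" v0] s v0 by auto
      then have eq: "gv s ((\<pi> ^^ m) v0) = (\<pi> ^^ n) v0" using s v0 by (simp add: pow_act)
      \<comment> \<open>For \<open>m < n\<close> the element \<open>s\<close> moves a vertex up its
        ray, for \<open>n < m\<close> its inverse does; both are excluded.\<close>
      consider "m < n" | "n < m" | "m = n" by linarith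
      then show ?thesis
      proof cases
        case 1
        then have "gv s ((\<pi> ^^ m) v0) = (\<pi> ^^ (n - m)) ((\<pi> ^^ m) v0)" using eq by (simp add: pow_add)
        then show ?thesis using none[of s "(\<pi> ^^ m) v0" "n - m"] 1 s v0 by simp
      next
        case 2
        then have "(\<pi> ^^ m) v0 = (\<pi> ^^ (m - n)) ((\<pi> ^^ n) v0)" by (simp add: pow_add)
        moreover have "gv (inv\<^bsub>G\<^esub> s) ((\<pi> ^^ n) v0) = (\<pi> ^^ m) v0"
          using s v0 by (metis eq gv_inv(1) pow_in)
        ultimately show ?thesis using none[of "inv\<^bsub>G\<^esub> s" "(\<pi> ^^ n) v0" "m - n"] 2 s v0 by simp
      qed (use eq in blast)
    qed
    then obtain N where N: "\<And>s. s \<in> carrier G \<Longrightarrow> gv s ((\<pi> ^^ N s) v0) = (\<pi> ^^ N s) v0"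
      by metis
    \<comment> \<open>High enough for all generators at once: an element fixing a vertex fixes all
      its ancestors.\<close>
    define M where "M = Max (insert 0 (N ` S))"
    define w where "w = (\<pi> ^^ M) v0"
    have w: "w \<in> V" using v0 by (simp add: w_def)
    have gen: "gv s w = w" if "s \<in> S" for s
    proof -
      have "N s \<le> M" using S(1) that by (simp add: M_def)
      then have "w = (\<pi> ^^ (M - N s)) ((\<pi> ^^ N s) v0)" by (simp add: w_def pow_add)
      then show ?thesis
        using N[of s] pow_act[of s "(\<pi> ^^ N s) v0" "M - N s"] that S(2) v0 by auto
    qed
    have "gv g w = w" if "g \<in> generate G S" for g
      using that
    proof induction
      case one
      then show ?case using w by (simp add: gv_one)
    next
      case (inv s)
      then show ?case using gen[of s] gv_inv(1)[of s w] w S(2) by auto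
    next
      case (eng g h)
      then have "g \<in> carrier G" "h \<in> carrier G" using S(3) by auto
      then show ?case using eng w by (simp add: gv_mult)
    qed (use gen in blast)
    then have "{w} = V"
      using w S(3) by (intro invariant_verts_eq[where F = "{}"]) auto
    then show False using parent_in[OF w] parent_neq[OF w] by auto
  qed
  then show ?thesis using that by blast
qed

lemma hyperbolic_shift: "\<exists>g\<in>carrier G. 0 < shift g"
proof -
  obtain g v k where g: "g \<in> carrier G" "v \<in> V" "0 < k" "gv g v = (\<pi> ^^ k) v"
    by (rule hyperbolic_vertex)
  have "ht v < ht (gv g v)" using ht_pow_less_iff[OF g(2), of 0 k] g by simp
  then show ?thesis using ht_gv[OF g(1,2)] g(1) by auto
qed

text \<open>Positive edge lengths along a ray could have a finite sum. But along the ray of a vertex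
  translated by \<open>g\<close> the height grows by \<open>shift g\<close> every \<open>k\<close>
  steps, and every ray merges with this one.\<close>

lemma ht_unbounded:
  assumes v: "v \<in> V"
  shows "\<exists>n. h < ht ((\<pi> ^^ n) v)"
proof -
  obtain g u k where g: "g \<in> carrier G" "u \<in> V" "0 < k" "gv g u = (\<pi> ^^ k) u"
    by (rule hyperbolic_vertex)
  have pos: "0 < shift g"
    using ht_pow_less_iff[OF g(2), of 0 k] ht_gv[OF g(1,2)] g by simp
  have step: "ht ((\<pi> ^^ (k * j)) u) = ht u + real j * shift g" for j
  proof (induction j)
    case (Suc j)
    have "(\<pi> ^^ (k * Suc j)) u = gv g ((\<pi> ^^ (k * j)) u)"
      using g pow_act[OF g(1,2), of "k * j"] by (simp add: pow_add add.commute)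
    then show ?case using Suc ht_gv[OF g(1), of "(\<pi> ^^ (k * j)) u"] g by (simp add: algebra_simps)
  qed simp
  obtain m n where mn: "(\<pi> ^^ m) v = (\<pi> ^^ n) u" using parent_merge[OF v g(2)] by blast
  obtain j :: nat where j: "h - ht u < real j * shift g"
    using reals_Archimedean3[OF pos] by blast
  have "h < ht ((\<pi> ^^ (k * j)) u)" using j by (simp add: step)
  also have "\<dots> \<le> ht ((\<pi> ^^ (k * j + n)) u)" using ht_pow_le_iff[OF g(2)] by simp
  also have "(\<pi> ^^ (k * j + n)) u = (\<pi> ^^ (k * j + m)) v" using mn by (simp flip: pow_add)
  finally show ?thesis by blast
qed

text \<open>The vertices form the two-sided orbit of one vertex under \<pi>: acyclicity makes the
  indexing injective, common ancestors and injectivity of \<pi> make it surjective.\<close>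

lemma line_if_parent_bij:
  assumes bij: "bij_betw \<pi> V V"
  shows "is_line T"
proof -
  obtain v0 where v0: "v0 \<in> V" using vert_nonempty by blast
  define \<sigma> where "\<sigma> = inv_into V \<pi>"
  have \<sigma>: "\<sigma> v \<in> V" "\<pi> (\<sigma> v) = v" if "v \<in> V" for v
    using bij_betwE[OF bij_betw_inv_into[OF bij]] bij_betw_inv_into_right[OF bij] that
    by (auto simp: \<sigma>_def)
  have \<sigma>_pow: "(\<sigma> ^^ n) v \<in> V" if "v \<in> V" for v n
    using that by (induction n) (auto simp: \<sigma>)
  define f :: "int \<Rightarrow> 'v" where
    "f i = (if 0 \<le> i then (\<pi> ^^ nat i) v0 else (\<sigma> ^^ nat (- i)) v0)" for i
  have f_in: "f i \<in> V" for i using v0 \<sigma>_pow by (simp add: f_def)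
  have f_Suc: "f (i + 1) = \<pi> (f i)" for i
  proof (cases "0 \<le> i")
    case True
    then show ?thesis by (simp add: f_def nat_add_distrib)
  next
    case False
    then have "nat (- i) = Suc (nat (- i - 1))" by linarith
    then have "f i = \<sigma> ((\<sigma> ^^ nat (- i - 1)) v0)" using False by (simp add: f_def)
    moreover have "f (i + 1) = (\<sigma> ^^ nat (- i - 1)) v0"
      using False by (cases "i = -1") (auto simp: f_def)
    ultimately show ?thesis using \<sigma>(2) \<sigma>_pow v0 by simp
  qed
  have f_add: "f (i + int n) = (\<pi> ^^ n) (f i)" for i n
  proof (induction n)
    case (Suc n)
    then show ?case using f_Suc[of "i + int n"] by (simp add: algebra_simps)
  qed simp
  have inj_pow: "u = v" if "u \<in> V" "v \<in> V" "(\<pi> ^^ n) u = (\<pi> ^^ n) v" for u v n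
    using that
  proof (induction n)
    case (Suc n)
    then show ?case using bij by (auto simp: bij_betw_def dest: inj_onD)
  qed simp
  have less: "f i \<noteq> f j" if "i < j" for i j
    using parent_acyclic[OF f_in[of i], of "nat (j - i)"] f_add[of i "nat (j - i)"] that by auto
  have "inj f"
  proof (rule injI)
    fix i j assume "f i = f j"
    then show "i = j" using less[of i j] less[of j i] by (cases i j rule: linorder_cases) auto
  qed
  moreover have surj: "v \<in> range f" if "v \<in> V" for v
  proof -
    obtain m n where mn: "(\<pi> ^^ m) v = (\<pi> ^^ n) v0" using parent_merge[OF \<open>v \<in> V\<close> v0] by blast
    also have "\<dots> = f (int n)" by (simp add: f_def)
    also have "\<dots> = (\<pi> ^^ m) (f (int n - int m))" using f_add[of "int n - int m" m] by simp
    finally have "v = f (int n - int m)" using inj_pow that f_in by blast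
    then show ?thesis by blast
  qed
  ultimately have "bij_betw f UNIV V" using f_in by (auto simp: bij_betw_def)
  moreover have "edges T = range (\<lambda>i. {f i, f (i + 1)})"
    using surj f_in by (auto simp: edges_parent f_Suc)
  ultimately show ?thesis unfolding is_line_def by blast
qed

end

context end_tree
begin

section \<open>Points of the geometric realization\<close>

text \<open>The point at height \<open>h\<close> on the edge from \<open>v\<close> to its parent.\<close>

definition pt :: "'v \<Rightarrow> real \<Rightarrow> 'v \<Rightarrow> real" where
  "pt v h = (\<lambda>w. if w = v then (ht (\<pi> v) - h) / (ht (\<pi> v) - ht v)
                 else if w = \<pi> v then (h - ht v) / (ht (\<pi> v) - ht v) else 0)"

definition pt_ht :: "('v \<Rightarrow> real) \<Rightarrow> real" where
  "pt_ht p = (\<Sum>w\<in>supp p. p w * ht w)"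

text \<open>With edges taken without their upper endpoint, each point lies on exactly one; the foot
  is its lower endpoint, and a vertex is its own foot.\<close>

definition foot :: "('v \<Rightarrow> real) \<Rightarrow> 'v" where
  "foot p = (THE v. v \<in> V \<and> v \<in> supp p \<and> supp p \<subseteq> {v, \<pi> v})"

lemma pt_low: "v \<in> V \<Longrightarrow> pt v (ht v) = (\<lambda>w. if w = v then 1 else 0)"
  using ht_parent_gt[of v] by (auto simp: pt_def fun_eq_iff)

lemma pt_high: "v \<in> V \<Longrightarrow> pt v (ht (\<pi> v)) = pt (\<pi> v) (ht (\<pi> v))"
  using ht_parent_gt[of v] parent_neq[of v] parent_in[of v] by (auto simp: pt_low) (auto simp: pt_def fun_eq_iff)

lemma supp_pt: "supp (pt v h) \<subseteq> {v, \<pi> v}"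
  by (auto simp: supp_def pt_def)

lemma foot_in_supp_pt: "v \<in> V \<Longrightarrow> h < ht (\<pi> v) \<Longrightarrow> v \<in> supp (pt v h)"
  using ht_parent_gt[of v] by (simp add: supp_def pt_def)

lemma sum_pt:
  assumes "v \<in> V"
  shows "(\<Sum>w\<in>supp (pt v h). pt v h w * F w) =
    ((ht (\<pi> v) - h) * F v + (h - ht v) * F (\<pi> v)) / (ht (\<pi> v) - ht v)"
proof -
  have "(\<Sum>w\<in>supp (pt v h). pt v h w * F w) = (\<Sum>w\<in>{v, \<pi> v}. pt v h w * F w)"
    using supp_pt[of v h] by (intro sum.mono_neutral_left) (auto simp: supp_def)
  then show ?thesis using parent_neq[OF assms] by (simp add: pt_def add_divide_distrib)
qed

lemma pt_ht_pt: "v \<in> V \<Longrightarrow> pt_ht (pt v h) = h"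
  using ht_parent_gt[of v] by (simp add: pt_ht_def sum_pt) (simp add: field_simps)

lemma pt_in:
  assumes v: "v \<in> V" and h: "ht v \<le> h" "h \<le> ht (\<pi> v)"
  shows "pt v h \<in> points T"
proof -
  have lt: "ht v < ht (\<pi> v)" using ht_parent_gt[OF v] .
  have "(\<Sum>w\<in>supp (pt v h). pt v h w) = 1"
    using sum_pt[OF v, of h "\<lambda>_. 1"] lt by simp
  moreover have "0 \<le> pt v h w" for w using h lt by (simp add: pt_def)
  moreover have "(\<exists>u\<in>V. supp (pt v h) = {u}) \<or> supp (pt v h) \<in> edges T"
  proof -
    consider "h = ht v" | "h = ht (\<pi> v)" | "ht v < h" "h < ht (\<pi> v)" using h by linarith
    then show ?thesis
    proof cases
      case 3
      then have "supp (pt v h) = {v, \<pi> v}" using lt by (auto simp: supp_def pt_def)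
      then show ?thesis using parent_edge[OF v] by simp
    qed (use v parent_in[OF v] in \<open>auto simp: pt_low pt_high supp_def\<close>)
  qed
  ultimately show ?thesis by (simp add: points_def)
qed

lemma pt_on_edge:
  assumes p: "p \<in> points T" and v: "v \<in> V" and supp: "supp p \<subseteq> {v, \<pi> v}"
  obtains h where "ht v \<le> h" "h \<le> ht (\<pi> v)" "p = pt v h"
proof -
  have lt: "ht v < ht (\<pi> v)" using ht_parent_gt[OF v] .
  have "(\<Sum>w\<in>supp p. p w) = (\<Sum>w\<in>{v, \<pi> v}. p w)"
    using supp by (intro sum.mono_neutral_left) (auto simp: supp_def)
  then have sum: "p v + p (\<pi> v) = 1" using p parent_neq[OF v] by (simp add: points_def)
  have nonneg: "0 \<le> p w" for w using p by (simp add: points_def)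
  define h where "h = ht v + p (\<pi> v) * (ht (\<pi> v) - ht v)"
  have "p (\<pi> v) * (ht (\<pi> v) - ht v) \<le> 1 * (ht (\<pi> v) - ht v)"
    using sum nonneg[of v] lt by (intro mult_right_mono) auto
  then have "h \<le> ht (\<pi> v)" by (simp add: h_def)
  moreover have "ht v \<le> h" using nonneg lt by (simp add: h_def)
  moreover have "p = pt v h"
  proof
    fix w
    have pv: "p v = 1 - p (\<pi> v)" using sum by simp
    have "ht (\<pi> v) - h = p v * (ht (\<pi> v) - ht v)" by (simp add: h_def pv algebra_simps)
    moreover have "w \<noteq> v \<Longrightarrow> w \<noteq> \<pi> v \<Longrightarrow> p w = 0" using supp by (auto simp: supp_def)
    ultimately show "p w = pt v h w" using lt by (simp add: pt_def) (simp add: h_def)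
  qed
  ultimately show ?thesis using that by blast
qed

lemma pt_cases:
  assumes p: "p \<in> points T"
  obtains v h where "v \<in> V" "ht v \<le> h" "h < ht (\<pi> v)" "p = pt v h"
proof -
  have "(\<exists>v\<in>V. supp p = {v}) \<or> supp p \<in> edges T" using p by (simp add: points_def)
  then obtain v where v: "v \<in> V" "v \<in> supp p" "supp p \<subseteq> {v, \<pi> v}"
    by (auto simp: edges_parent)
  obtain h where h: "ht v \<le> h" "h \<le> ht (\<pi> v)" "p = pt v h"
    by (rule pt_on_edge[OF p v(1,3)])
  have "h \<noteq> ht (\<pi> v)" using v(2) by (auto simp: h supp_def pt_def)
  then show ?thesis using that v h by simp
qed

lemma foot_pt:
  assumes v: "v \<in> V" and h: "h < ht (\<pi> v)"
  shows "foot (pt v h) = v"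
  unfolding foot_def
proof (rule the_equality)
  show "v \<in> V \<and> v \<in> supp (pt v h) \<and> supp (pt v h) \<subseteq> {v, \<pi> v}"
    using v foot_in_supp_pt[OF v h] supp_pt by blast
  fix u assume u: "u \<in> V \<and> u \<in> supp (pt v h) \<and> supp (pt v h) \<subseteq> {u, \<pi> u}"
  have "u = v \<or> u = \<pi> v" "v = u \<or> v = \<pi> u" using u supp_pt foot_in_supp_pt[OF v h] by blast+
  then show "u = v" using ht_parent_gt[OF v] ht_parent_gt[of u] u by fastforce
qed

section \<open>The flow towards the end\<close>

text \<open>The least index selects the edge of the ray from \<open>v\<close> whose height interval,
  open at the top, contains \<open>h\<close>.\<close>

definition above :: "'v \<Rightarrow> real \<Rightarrow> 'v \<Rightarrow> real" where
  "above v h = pt ((\<pi> ^^ (LEAST n. h < ht ((\<pi> ^^ Suc n) v))) v) h"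

definition flow :: "('v \<Rightarrow> real) \<Rightarrow> real \<Rightarrow> 'v \<Rightarrow> real" where
  "flow p h = above (foot p) h"

lemma level_exists:
  assumes v: "v \<in> V" and h: "ht v \<le> h"
  obtains n where "ht ((\<pi> ^^ n) v) \<le> h" "h < ht ((\<pi> ^^ Suc n) v)"
proof -
  define n where "n = (LEAST n. h < ht ((\<pi> ^^ n) v))"
  have n: "h < ht ((\<pi> ^^ n) v)"
    using LeastI_ex[OF ht_unbounded[OF v, of h]] by (simp add: n_def)
  then obtain k where k: "n = Suc k" using h by (cases n) auto
  then have "\<not> h < ht ((\<pi> ^^ k) v)" using not_less_Least[of k "\<lambda>n. h < ht ((\<pi> ^^ n) v)"] by (simp add: n_def)
  then show ?thesis using that[of k] n k by simp
qed

lemma above_eq: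
  assumes v: "v \<in> V" and n: "ht ((\<pi> ^^ n) v) \<le> h" "h < ht ((\<pi> ^^ Suc n) v)"
  shows "above v h = pt ((\<pi> ^^ n) v) h"
proof -
  have "(LEAST n. h < ht ((\<pi> ^^ Suc n) v)) = n"
  proof (rule Least_equality)
    fix k assume "h < ht ((\<pi> ^^ Suc k) v)"
    then have "ht ((\<pi> ^^ n) v) < ht ((\<pi> ^^ Suc k) v)" using n by linarith
    then show "n \<le> k" using ht_pow_less_iff[OF v, of n "Suc k"] by simp
  qed (fact n(2))
  then show ?thesis by (simp add: above_def)
qed

lemma above_cases:
  assumes v: "v \<in> V" and h: "ht v \<le> h"
  obtains n where "ht ((\<pi> ^^ n) v) \<le> h" "h < ht (\<pi> ((\<pi> ^^ n) v))" "above v h = pt ((\<pi> ^^ n) v) h"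
proof -
  obtain n where n: "ht ((\<pi> ^^ n) v) \<le> h" "h < ht ((\<pi> ^^ Suc n) v)"
    by (rule level_exists[OF assms])
  then show ?thesis using that[of n] above_eq[OF v n] by simp
qed

lemma ht_pow_ge: "v \<in> V \<Longrightarrow> ht v \<le> ht ((\<pi> ^^ n) v)"
  using ht_pow_le_iff[of v 0 n] by simp

lemma above_pow:
  assumes v: "v \<in> V" and h: "ht ((\<pi> ^^ n) v) \<le> h"
  shows "above ((\<pi> ^^ n) v) h = above v h"
proof -
  obtain k where k: "ht ((\<pi> ^^ k) ((\<pi> ^^ n) v)) \<le> h" "h < ht ((\<pi> ^^ Suc k) ((\<pi> ^^ n) v))"
    using level_exists[OF pow_in[OF v] h] by blast
  then have "ht ((\<pi> ^^ (k + n)) v) \<le> h" "h < ht ((\<pi> ^^ Suc (k + n)) v)"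
    by (simp_all only: pow_add add_Suc)
  then show ?thesis using above_eq[OF pow_in[OF v] k] above_eq[OF v] by (simp add: pow_add)
qed

lemma above_edge:
  assumes v: "v \<in> V" and h: "ht v \<le> h" "h \<le> ht (\<pi> v)"
  shows "above v h = pt v h"
proof (cases "h = ht (\<pi> v)")
  case True
  \<comment> \<open>The upper endpoint belongs to the next edge for \<open>above\<close>; the two
    descriptions agree by \<open>pt_high\<close>.\<close>
  have "above v h = above (\<pi> v) h" using above_pow[OF v, of 1 h] True by simp
  also have "\<dots> = pt (\<pi> v) h"
    using above_eq[OF parent_in[OF v], of 0 h] ht_parent_gt[OF parent_in[OF v]] True by simp
  finally show ?thesis using pt_high[OF v] True by simp
next
  case False
  then show ?thesis using above_eq[OF v, of 0 h] h by simp
qed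

lemma
  assumes "v \<in> V" "ht v \<le> h"
  shows above_in: "above v h \<in> points T" and pt_ht_above: "pt_ht (above v h) = h"
proof -
  obtain n where n: "ht ((\<pi> ^^ n) v) \<le> h" "h < ht (\<pi> ((\<pi> ^^ n) v))"
    "above v h = pt ((\<pi> ^^ n) v) h" by (rule above_cases[OF assms])
  then show "above v h \<in> points T" using pt_in[of "(\<pi> ^^ n) v" h] assms(1) by simp
  show "pt_ht (above v h) = h" using n(3) pt_ht_pt assms(1) by simp
qed

lemma above_repr:
  assumes "p \<in> points T"
  obtains v h where "v \<in> V" "ht v \<le> h" "h < ht (\<pi> v)" "p = above v h" "p = pt v h"
    "foot p = v" "pt_ht p = h"
proof -
  obtain v h where vh: "v \<in> V" "ht v \<le> h" "h < ht (\<pi> v)" "p = pt v h"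
    by (rule pt_cases[OF assms])
  then have "p = above v h" "foot p = v" "pt_ht p = h"
    using above_edge[of v h] foot_pt[of v h] pt_ht_pt[of v h] by simp_all
  then show ?thesis using that vh by blast
qed

lemma flow_above:
  assumes v: "v \<in> V" and h: "ht v \<le> h" "h \<le> k"
  shows "flow (above v h) k = above v k"
proof -
  obtain n where n: "ht ((\<pi> ^^ n) v) \<le> h" "h < ht (\<pi> ((\<pi> ^^ n) v))" "above v h = pt ((\<pi> ^^ n) v) h"
    by (rule above_cases[OF v h(1)])
  have "flow (above v h) k = above ((\<pi> ^^ n) v) k"
    unfolding flow_def n(3) foot_pt[OF pow_in[OF v] n(2)] ..
  then show ?thesis using above_pow[OF v, of n k] n h by simp
qed

text \<open>The foot recovers the edge of the ray on which a point lies, so equal points give a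
  common ancestor at height at most \<open>h\<close>. Above a common ancestor the rays
  coincide.\<close>

lemma above_eq_above_iff:
  assumes u: "u \<in> V" "ht u \<le> h" and v: "v \<in> V" "ht v \<le> h"
  shows "above u h = above v h \<longleftrightarrow> (\<exists>m n. (\<pi> ^^ m) u = (\<pi> ^^ n) v \<and> ht ((\<pi> ^^ m) u) \<le> h)"
proof
  obtain m where m: "ht ((\<pi> ^^ m) u) \<le> h" "h < ht (\<pi> ((\<pi> ^^ m) u))" "above u h = pt ((\<pi> ^^ m) u) h"
    by (rule above_cases[OF u])
  obtain n where n: "ht ((\<pi> ^^ n) v) \<le> h" "h < ht (\<pi> ((\<pi> ^^ n) v))" "above v h = pt ((\<pi> ^^ n) v) h"
    by (rule above_cases[OF v])
  have foot: "foot (above u h) = (\<pi> ^^ m) u" "foot (above v h) = (\<pi> ^^ n) v"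
    unfolding m(3) n(3) using foot_pt pow_in u(1) v(1) m(2) n(2) by blast+
  assume "above u h = above v h"
  then have "foot (above u h) = foot (above v h)" by (rule arg_cong)
  then have "(\<pi> ^^ m) u = (\<pi> ^^ n) v" unfolding foot .
  then show "\<exists>m n. (\<pi> ^^ m) u = (\<pi> ^^ n) v \<and> ht ((\<pi> ^^ m) u) \<le> h" using m(1) by blast
next
  assume "\<exists>m n. (\<pi> ^^ m) u = (\<pi> ^^ n) v \<and> ht ((\<pi> ^^ m) u) \<le> h"
  then obtain m n where mn: "(\<pi> ^^ m) u = (\<pi> ^^ n) v" "ht ((\<pi> ^^ m) u) \<le> h" by blast
  have "above u h = above ((\<pi> ^^ m) u) h" using above_pow[OF u(1) mn(2)] by simp
  also have "\<dots> = above v h" using above_pow[OF v(1), of n h] mn by simp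
  finally show "above u h = above v h" .
qed

text \<open>\<open>M\<close> is the height of the first vertex on the ray of \<open>u\<close> that
  is also on the ray of \<open>v\<close>.\<close>

lemma above_merge:
  assumes u: "u \<in> V" and v: "v \<in> V"
  obtains M where "\<And>h. ht u \<le> h \<Longrightarrow> ht v \<le> h \<Longrightarrow> above u h = above v h \<longleftrightarrow> M \<le> h"
proof -
  define m where "m = (LEAST m. \<exists>n. (\<pi> ^^ m) u = (\<pi> ^^ n) v)"
  obtain n where n: "(\<pi> ^^ m) u = (\<pi> ^^ n) v"
    using LeastI_ex[OF parent_merge[OF u v]] unfolding m_def by blast
  have "above u h = above v h \<longleftrightarrow> ht ((\<pi> ^^ m) u) \<le> h" if h: "ht u \<le> h" "ht v \<le> h" for h
  proof
    assume "above u h = above v h"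
    then obtain k l where kl: "(\<pi> ^^ k) u = (\<pi> ^^ l) v" "ht ((\<pi> ^^ k) u) \<le> h"
      using above_eq_above_iff[OF u h(1) v h(2)] by blast
    have "m \<le> k" unfolding m_def by (rule Least_le) (use kl(1) in blast)
    then have "ht ((\<pi> ^^ m) u) \<le> ht ((\<pi> ^^ k) u)" using ht_pow_le_iff[OF u] by simp
    then show "ht ((\<pi> ^^ m) u) \<le> h" using kl(2) by simp
  next
    assume "ht ((\<pi> ^^ m) u) \<le> h"
    then show "above u h = above v h" using above_eq_above_iff[OF u h(1) v h(2)] n by blast
  qed
  then show ?thesis by (rule that)
qed

sublocale horo_flow "points T" pt_ht flow
proof
  have flow: "flow p h \<in> points T \<and> pt_ht (flow p h) = h \<and>
      (\<forall>k\<ge>h. flow (flow p h) k = flow p k)" if p: "p \<in> points T" "pt_ht p \<le> h" for p h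
  proof -
    obtain v h0 where v: "v \<in> V" "ht v \<le> h0" "p = above v h0" "pt_ht p = h0"
      by (rule above_repr[OF p(1)])
    then have "flow p k = above v k" if "h0 \<le> k" for k using flow_above[of v h0] that by simp
    then show ?thesis
      using v p above_in[of v h] pt_ht_above[of v h] flow_above[of v h] by simp
  qed
  fix p assume p: "p \<in> points T"
  obtain v h where v: "v \<in> V" "ht v \<le> h" "p = above v h" "pt_ht p = h"
    by (rule above_repr[OF p])
  then show "flow p (pt_ht p) = p" using flow_above[of v h h] by simp
  show "flow p h \<in> points T" "pt_ht (flow p h) = h" if "pt_ht p \<le> h" for h
    using flow[OF p that] by blast+
  show "flow (flow p h) k = flow p k" if "pt_ht p \<le> h" "h \<le> k" for h k
    using flow[OF p that(1)] that(2) by blast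
next
  fix p q assume p: "p \<in> points T" and q: "q \<in> points T"
  obtain u h where u: "u \<in> V" "ht u \<le> h" "p = above u h" "pt_ht p = h"
    by (rule above_repr[OF p])
  obtain v k where v: "v \<in> V" "ht v \<le> k" "q = above v k" "pt_ht q = k"
    by (rule above_repr[OF q])
  obtain M where M: "\<And>l. ht u \<le> l \<Longrightarrow> ht v \<le> l \<Longrightarrow> above u l = above v l \<longleftrightarrow> M \<le> l"
    using above_merge[OF u(1) v(1)] by blast
  \<comment> \<open>The rays of \<open>u\<close> and \<open>v\<close> merge at \<open>M\<close>, but
    \<open>p\<close> and \<open>q\<close> may themselves lie higher.\<close>
  have "flow p l = flow q l \<longleftrightarrow> max M (max h k) \<le> l" if "pt_ht p \<le> l" "pt_ht q \<le> l" for l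
    using M[of l] flow_above[OF u(1,2), of l] flow_above[OF v(1,2), of l] u v that by simp
  then show "\<exists>m. pt_ht p \<le> m \<and> pt_ht q \<le> m \<and>
      (\<forall>l. pt_ht p \<le> l \<longrightarrow> pt_ht q \<le> l \<longrightarrow> (flow p l = flow q l \<longleftrightarrow> m \<le> l))"
    using u v by (intro exI[of _ "max M (max h k)"]) auto
qed

section \<open>The path metric\<close>

text \<open>Both coordinates change by the same fraction of the edge, whose length is the height
  difference of its endpoints.\<close>

lemma edge_segment_length:
  assumes v: "v \<in> V"
  shows "len T {v, \<pi> v} * (\<Sum>w\<in>{v, \<pi> v}. \<bar>pt v h w - pt v k w\<bar>) / 2 = \<bar>h - k\<bar>"
proof -
  have lt: "ht v < ht (\<pi> v)" using ht_parent_gt[OF v] .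
  have "pt v h v - pt v k v = (k - h) / (ht (\<pi> v) - ht v)"
    "pt v h (\<pi> v) - pt v k (\<pi> v) = (h - k) / (ht (\<pi> v) - ht v)"
    using parent_neq[OF v] by (simp_all add: pt_def flip: diff_divide_distrib)
  then have "(\<Sum>w\<in>{v, \<pi> v}. \<bar>pt v h w - pt v k w\<bar>) = 2 * \<bar>h - k\<bar> / (ht (\<pi> v) - ht v)"
    using parent_neq[OF v] lt by (simp add: abs_minus_commute add_divide_distrib)
  then show ?thesis using ht_parent[OF v] lt by simp
qed

lemma string_edge:
  assumes v: "v \<in> V" and h: "ht v \<le> h" "h \<le> ht (\<pi> v)" and k: "ht v \<le> k" "k \<le> ht (\<pi> v)"
    and s: "string_between T (pt v k) r L"
  shows "string_between T (pt v h) r (\<bar>h - k\<bar> + L)"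
  using string_step[OF pt_in[OF v h] pt_in[OF v k] parent_edge[OF v] supp_pt supp_pt s]
  by (simp only: edge_segment_length[OF v])

lemma string_up_pow:
  assumes "v \<in> V" "ht v \<le> h" "h \<le> ht (\<pi> v)" "ht ((\<pi> ^^ n) v) \<le> k" "k \<le> ht (\<pi> ((\<pi> ^^ n) v))" "h \<le> k"
  shows "string_between T (pt v h) (pt ((\<pi> ^^ n) v) k) (k - h)"
  using assms
proof (induction n arbitrary: v h)
  case 0
  have "string_between T (pt v h) (pt v k) (\<bar>h - k\<bar> + 0)"
    using 0 by (intro string_edge string_refl pt_in) auto
  then show ?case using 0 by simp
next
  case (Suc n)
  have v: "\<pi> v \<in> V" "(\<pi> ^^ n) (\<pi> v) = (\<pi> ^^ Suc n) v"
    using Suc.prems parent_in by (simp_all add: funpow_Suc_right del: funpow.simps)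
  have ge: "ht (\<pi> v) \<le> k"
    using ht_pow_ge[OF v(1), of n] Suc.prems v(2) by simp
  have "string_between T (pt (\<pi> v) (ht (\<pi> v))) (pt ((\<pi> ^^ n) (\<pi> v)) k) (k - ht (\<pi> v))"
    using Suc.prems v ge ht_parent_gt[OF v(1)] by (intro Suc.IH) (simp_all only: order.refl less_imp_le)
  then have "string_between T (pt v (ht (\<pi> v))) (pt ((\<pi> ^^ Suc n) v) k) (k - ht (\<pi> v))"
    using pt_high[of v] Suc.prems v by simp
  then have "string_between T (pt v h) (pt ((\<pi> ^^ Suc n) v) k) (\<bar>h - ht (\<pi> v)\<bar> + (k - ht (\<pi> v)))"
    using Suc.prems ht_parent_gt[of v] by (intro string_edge) auto
  then show ?case using Suc.prems by simp
qed

lemma string_up: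
  assumes p: "p \<in> points T" "pt_ht p \<le> h"
  shows "string_between T p (flow p h) (h - pt_ht p)"
proof -
  obtain v k where v: "v \<in> V" "ht v \<le> k" "k < ht (\<pi> v)" "p = above v k" "p = pt v k" "pt_ht p = k"
    by (rule above_repr[OF p(1)])
  then have h: "ht v \<le> h" "k \<le> h" using p by simp_all
  obtain n where n: "ht ((\<pi> ^^ n) v) \<le> h" "h < ht (\<pi> ((\<pi> ^^ n) v))" "above v h = pt ((\<pi> ^^ n) v) h"
    by (rule above_cases[OF v(1) h(1)])
  have "flow p h = pt ((\<pi> ^^ n) v) h" using flow_above[OF v(1,2) h(2)] v n by simp
  then show ?thesis using string_up_pow[of v k n h] v n h by simp
qed

lemma string_trans:
  "string_between T p q L \<Longrightarrow> string_between T q r M \<Longrightarrow> string_between T p r (L + M)"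
proof (induction rule: string_between.induct)
  case (string_step p q e r' L)
  then show ?case using string_between.string_step[of p T q e r "L + M"] by (simp add: add.assoc)
qed simp

lemma string_sym: "string_between T p q L \<Longrightarrow> string_between T q p L"
proof (induction rule: string_between.induct)
  case (string_step p q e r L)
  have "string_between T q p (len T e * (\<Sum>v\<in>e. \<bar>q v - p v\<bar>) / 2 + 0)"
    using string_step by (intro string_between.intros)
  from string_trans[OF string_step.IH this] show ?case
    by (simp add: abs_minus_commute add.commute)
qed (rule string_refl)

lemma string_points: "string_between T p q L \<Longrightarrow> p \<in> points T \<and> q \<in> points T"
  by (induction rule: string_between.induct) auto

lemma hdist_pt:
  assumes v: "v \<in> V" and h: "ht v \<le> h" "h \<le> ht (\<pi> v)" and k: "ht v \<le> k" "k \<le> ht (\<pi> v)"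
  shows "hdist (pt v h) (pt v k) = \<bar>h - k\<bar>"
proof -
  have *: "hdist (pt v h) (pt v k) = k - h" if "ht v \<le> h" "h \<le> k" "k \<le> ht (\<pi> v)" for h k
  proof -
    have "flow (pt v h) k = pt v k"
      using flow_above[OF v that(1,2)] above_edge[OF v, of h] above_edge[OF v, of k] that by simp
    then show ?thesis
      using hdist_up[OF pt_in[OF v], of h k] pt_ht_pt[OF v] that by simp
  qed
  show ?thesis
    using *[of h k] *[of k h] h k hdist_sym[of "pt v h" "pt v k"] by (cases "h \<le> k") auto
qed

text \<open>Each step stays on one edge and is as long as the \<open>hdist\<close> of its ends; the
  triangle inequality adds up the steps.\<close>

lemma hdist_le_string: "string_between T p q L \<Longrightarrow> hdist p q \<le> L"
proof (induction rule: string_between.induct)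
  case (string_refl p)
  then show ?case using hdist_zero_iff by force
next
  case (string_step p q e r L)
  obtain v where v: "v \<in> V" "e = {v, \<pi> v}" using string_step(3) by (auto simp: edges_parent)
  obtain h where h: "ht v \<le> h" "h \<le> ht (\<pi> v)" "p = pt v h"
    using pt_on_edge[OF string_step(1) v(1)] string_step(4) v(2) by blast
  obtain k where k: "ht v \<le> k" "k \<le> ht (\<pi> v)" "q = pt v k"
    using pt_on_edge[OF string_step(2) v(1)] string_step(5) v(2) by blast
  have "hdist p q = len T e * (\<Sum>v\<in>e. \<bar>p v - q v\<bar>) / 2"
    unfolding v(2) h(3) k(3) edge_segment_length[OF v(1)] by (rule hdist_pt[OF v(1) h(1,2) k(1,2)])
  moreover have "r \<in> points T" using string_points[OF string_step(6)] by blast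
  ultimately show ?case
    using hdist_triangle[OF string_step(1,2), of r] string_step.IH by linarith
qed

text \<open>The string climbing from \<open>p\<close> to the merging point and descending to
  \<open>q\<close> has length \<open>hdist p q\<close>, and no string is shorter, so the infimum is
  attained.\<close>

lemma tdist_eq_hdist:
  assumes p: "p \<in> points T" and q: "q \<in> points T"
  shows "tdist T p q = hdist p q"
proof -
  define m where "m = merge_ht p q"
  have m: "pt_ht p \<le> m" "pt_ht q \<le> m" using merge_ht_ge[OF p q] by (simp_all add: m_def)
  have "flow p m = flow q m" using up_eq_iff[OF p q m] by (simp add: m_def)
  then have "string_between T p q (hdist p q)"
    using string_trans[OF string_up[OF p m(1)], of q "m - pt_ht q"] string_sym[OF string_up[OF q m(2)]]
    by (simp add: hdist_def m_def algebra_simps)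
  then show ?thesis unfolding tdist_def
    by (intro cInf_eq_minimum) (auto dest: hdist_le_string)
qed

section \<open>The action on points\<close>

lemma act_pt_pt:
  assumes g: "g \<in> carrier G" and v: "v \<in> V"
  shows "act_pt G T g (pt v h) = pt (gv g v) (h + shift g)"
proof
  fix w
  interpret group G by (fact group)
  show "act_pt G T g (pt v h) w = pt (gv g v) (h + shift g) w"
  proof (cases "w \<in> V")
    case True
    have iff: "gv (inv\<^bsub>G\<^esub> g) w = u \<longleftrightarrow> w = gv g u" if "u \<in> V" for u
      using gv_inv[OF g True] gv_inv[OF g that] by auto
    show ?thesis
      using True iff[OF v] iff[OF parent_in[OF v]] ht_gv[OF g v] ht_gv[OF g parent_in[OF v]]
      by (simp add: act_pt_def pt_def parent_act[OF g v] algebra_simps)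
  next
    case False
    then have "w \<noteq> gv g v" "w \<noteq> \<pi> (gv g v)" using g v parent_in by auto
    then show ?thesis using False by (simp add: act_pt_def pt_def)
  qed
qed

lemma act_pt_above:
  assumes g: "g \<in> carrier G" and v: "v \<in> V" "ht v \<le> h"
  shows "act_pt G T g (above v h) = above (gv g v) (h + shift g)"
proof -
  obtain n where n: "ht ((\<pi> ^^ n) v) \<le> h" "h < ht (\<pi> ((\<pi> ^^ n) v))" "above v h = pt ((\<pi> ^^ n) v) h"
    by (rule above_cases[OF v])
  have pow: "(\<pi> ^^ n) (gv g v) = gv g ((\<pi> ^^ n) v)" "(\<pi> ^^ Suc n) (gv g v) = gv g (\<pi> ((\<pi> ^^ n) v))"
    using pow_act[OF g v(1), of n] pow_act[OF g v(1), of "Suc n"] by simp_all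
  have "above (gv g v) (h + shift g) = pt ((\<pi> ^^ n) (gv g v)) (h + shift g)"
    using n g v by (intro above_eq) (simp_all only: pow ht_gv gv_in pow_in parent_in add_le_cancel_right add_less_cancel_right)
  then show ?thesis using act_pt_pt[OF g pow_in[OF v(1)], of n h] n pow by simp
qed

text \<open>Here \<open>g\<close> maps every vertex to a proper ancestor. So \<pi> is onto, as
  \<open>v\<close> is a proper ancestor of its image under \<open>inv g\<close>. If \<open>u\<close>
  and \<open>v\<close> have the same parent, then \<open>g u\<close> and \<open>g v\<close> are the
  same ancestor, whence \<open>u = v\<close>.\<close>

lemma axis_all_imp_line:
  assumes g: "g \<in> carrier G" "0 < shift g"
    and all: "\<And>p. p \<in> points T \<Longrightarrow> act_pt G T g p = flow p (pt_ht p + shift g)"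
  shows "is_line T"
proof (rule line_if_parent_bij)
  have pow: "\<exists>n>0. gv g v = (\<pi> ^^ n) v" if v: "v \<in> V" for v
  proof -
    have above_v: "above v (ht v) = pt v (ht v)" using above_edge[OF v, of "ht v"] ht_parent_gt[OF v] by simp
    have in_pts: "above v (ht v) \<in> points T" "pt_ht (above v (ht v)) = ht v" using v above_in pt_ht_above by auto
    have "above (gv g v) (ht v + shift g) = above v (ht v + shift g)"
      using all[OF in_pts(1)] act_pt_above[OF g(1) v, of "ht v"] flow_above[OF v, of "ht v"] in_pts(2) g by simp
    then obtain m n where mn: "(\<pi> ^^ m) (gv g v) = (\<pi> ^^ n) v" "ht ((\<pi> ^^ m) (gv g v)) \<le> ht (gv g v)"
      using above_eq_above_iff[of "gv g v" "ht v + shift g" v] v g ht_gv[OF g(1) v] by auto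
    \<comment> \<open>An ancestor of \<open>gv g v\<close> that is no higher than
      \<open>gv g v\<close> is this vertex itself.\<close>
    then have "m = 0" using ht_pow_le_iff[of "gv g v" m 0] v g by simp
    then have eq: "gv g v = (\<pi> ^^ n) v" using mn by simp
    moreover have "n \<noteq> 0"
    proof
      assume "n = 0"
      then show False using eq ht_gv[OF g(1) v] g by simp
    qed
    ultimately show ?thesis by blast
  qed
  show "bij_betw \<pi> V V"
  proof (rule bij_betw_imageI)
    show "inj_on \<pi> V"
    proof (rule inj_onI)
      fix u v assume uv: "u \<in> V" "v \<in> V" "\<pi> u = \<pi> v"
      obtain m n where m: "0 < m" "gv g u = (\<pi> ^^ m) u" and n: "0 < n" "gv g v = (\<pi> ^^ n) v"
        using pow[OF uv(1)] pow[OF uv(2)] by blast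
      have eq: "(\<pi> ^^ Suc k) u = (\<pi> ^^ Suc k) v" for k
        using uv(3) by (simp only: funpow_Suc_right comp_apply)
      have "\<pi> (gv g u) = (\<pi> ^^ Suc m) u" "\<pi> (gv g v) = (\<pi> ^^ Suc n) v" using m n by simp_all
      moreover have "\<pi> (gv g u) = \<pi> (gv g v)" using uv g by (simp add: parent_act)
      ultimately have "(\<pi> ^^ Suc m) v = (\<pi> ^^ Suc n) v" using eq[of m] by simp
      then have "Suc m = Suc n" by (rule pow_inj[OF uv(2)])
      then have mn: "n = m" by simp
      obtain k where k: "m = Suc k" using m(1) by (cases m) auto
      have "gv g u = gv g v" unfolding m(2) n(2) mn k by (rule eq)
      then have "gv (inv\<^bsub>G\<^esub> g) (gv g u) = gv (inv\<^bsub>G\<^esub> g) (gv g v)" by (rule arg_cong)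
      then show "u = v" unfolding gv_inv(1)[OF g(1) uv(1)] gv_inv(1)[OF g(1) uv(2)] .
    qed
    show "\<pi> ` V = V"
    proof (intro equalityI subsetI)
      fix v assume v: "v \<in> V"
      interpret group G by (fact group)
      have w: "gv (inv\<^bsub>G\<^esub> g) v \<in> V" using g v by simp
      then obtain n where n: "0 < n" "v = (\<pi> ^^ n) (gv (inv\<^bsub>G\<^esub> g) v)"
        using pow[OF w] g v by auto
      then obtain k where "n = Suc k" by (cases n) auto
      then have "v = \<pi> ((\<pi> ^^ k) (gv (inv\<^bsub>G\<^esub> g) v))" using n(2) by simp
      then show "v \<in> \<pi> ` V" by (rule image_eqI) (rule pow_in[OF w])
    qed (use parent_in in auto)
  qed
qed

text \<open>The vertices in \<open>Q\<close> are closed under parents and the action, so they are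
  all vertices; every other point is reached by flowing up from its foot.\<close>

lemma invariant_up_closed_eq:
  assumes Q: "Q \<subseteq> points T" "Q \<noteq> {}"
    and up: "\<And>p h. p \<in> Q \<Longrightarrow> pt_ht p \<le> h \<Longrightarrow> flow p h \<in> Q"
    and inv: "\<And>g p. g \<in> carrier G \<Longrightarrow> p \<in> Q \<Longrightarrow> act_pt G T g p \<in> Q"
  shows "Q = points T"
proof -
  define W where "W = {v \<in> V. pt v (ht v) \<in> Q}"
  have pt_above: "pt v (ht v) = above v (ht v)" if "v \<in> V" for v
    using above_edge[OF that, of "ht v"] ht_parent_gt[OF that] by simp
  have flow_pt: "flow (pt v h) k = above v k" if "v \<in> V" "ht v \<le> h" "h \<le> ht (\<pi> v)" "h \<le> k" for v h k
    using flow_above[OF that(1,2,4)] above_edge[OF that(1-3)] by simp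
  have parent_up: "pt (\<pi> v) (ht (\<pi> v)) \<in> Q" if "v \<in> V" "ht v \<le> h" "h \<le> ht (\<pi> v)" "pt v h \<in> Q" for v h
  proof -
    have "flow (pt v h) (ht (\<pi> v)) = pt (\<pi> v) (ht (\<pi> v))"
      using flow_pt[OF that(1-3,3)] above_edge[OF that(1), of "ht (\<pi> v)"] pt_high[OF that(1)] ht_parent_gt[OF that(1)] by simp
    then show ?thesis using up[OF that(4), of "ht (\<pi> v)"] pt_ht_pt[OF that(1)] that(3) by simp
  qed
  have "W = V"
  proof (rule invariant_parent_closed_eq)
    show "W \<subseteq> V" by (auto simp: W_def)
    obtain p where p: "p \<in> Q" using Q by blast
    obtain v h where "v \<in> V" "ht v \<le> h" "h < ht (\<pi> v)" "p = pt v h"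
      by (rule pt_cases[OF subsetD[OF Q(1) p]])
    then have "\<pi> v \<in> W" using parent_up[of v h] p parent_in by (simp add: W_def)
    then show "W \<noteq> {}" by blast
    show "\<pi> v \<in> W" if "v \<in> W" for v
      using parent_up[of v "ht v"] that parent_in ht_parent_gt[of v] by (simp add: W_def)
    show "gv g v \<in> W" if "g \<in> carrier G" "v \<in> W" for g v
      using inv[OF that(1), of "pt v (ht v)"] act_pt_pt[OF that(1), of v "ht v"] ht_gv[OF that(1), of v] that
      by (simp add: W_def)
  qed
  have "p \<in> Q" if "p \<in> points T" for p
  proof -
    obtain v h where v: "v \<in> V" "ht v \<le> h" "h < ht (\<pi> v)" "p = pt v h"
      by (rule pt_cases[OF \<open>p \<in> points T\<close>])
    then have "flow (pt v (ht v)) h = p"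
      using flow_pt[of v "ht v" h] above_edge[of v h] ht_parent_gt[of v] by simp
    moreover have "pt v (ht v) \<in> Q" using v(1) \<open>W = V\<close> by (auto simp: W_def)
    ultimately show ?thesis using up[of "pt v (ht v)" h] pt_ht_pt[OF v(1)] v(2) by simp
  qed
  then show ?thesis using Q by blast
qed

lemma horo_tree: "horo_tree G T pt_ht flow shift"
proof -
  interpret group G by (fact group)
  show ?thesis
  proof
    show "tdist T p q = hdist p q" if "p \<in> points T" "q \<in> points T" for p q
      using that by (rule tdist_eq_hdist)
    show "act_pt G T g p \<in> points T" if "g \<in> carrier G" "p \<in> points T" for g p
      using act_pt_in_points[OF metric_tree that] .
    have shift_mult: "shift (g \<otimes>\<^bsub>G\<^esub> k) = shift g + shift k" if "g \<in> carrier G" "k \<in> carrier G" for g k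
    proof -
      obtain v where v: "v \<in> V" using vert_nonempty by blast
      show ?thesis
        using ht_gv[of "g \<otimes>\<^bsub>G\<^esub> k" v] ht_gv[OF that(1), of "gv k v"] ht_gv[OF that(2) v] that v
        by (simp add: gv_mult)
    qed
    have shift_one: "shift \<one>\<^bsub>G\<^esub> = 0" using shift_mult[of "\<one>\<^bsub>G\<^esub>" "\<one>\<^bsub>G\<^esub>"] by simp
    show "act_pt G T \<one>\<^bsub>G\<^esub> p = p" if "p \<in> points T" for p
      using that by (rule pt_cases) (simp add: act_pt_pt gv_one shift_one)
    show "act_pt G T (g \<otimes>\<^bsub>G\<^esub> k) p = act_pt G T g (act_pt G T k p)"
      if "g \<in> carrier G" "k \<in> carrier G" "p \<in> points T" for g k p
      using that(3) by (rule pt_cases) (simp add: that act_pt_pt gv_mult shift_mult algebra_simps)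
    show "pt_ht (act_pt G T g p) = pt_ht p + shift g" if "g \<in> carrier G" "p \<in> points T" for g p
      using that(2) by (rule pt_cases) (simp add: that act_pt_pt pt_ht_pt)
    show "act_pt G T g (flow p h) = flow (act_pt G T g p) (h + shift g)"
      if g: "g \<in> carrier G" and p: "p \<in> points T" "pt_ht p \<le> h" for g p h
    proof -
      obtain v k where v: "v \<in> V" "ht v \<le> k" "p = above v k" "pt_ht p = k"
        by (rule above_repr[OF p(1)])
      then show ?thesis
        using flow_above[of v k h] flow_above[of "gv g v" "k + shift g" "h + shift g"] act_pt_above[OF g, of v] p g
        by (simp add: ht_gv)
    qed
    show "Q = points T" if "Q \<subseteq> points T" "Q \<noteq> {}"
      "\<And>p h. p \<in> Q \<Longrightarrow> pt_ht p \<le> h \<Longrightarrow> flow p h \<in> Q"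
      "\<And>g p. g \<in> carrier G \<Longrightarrow> p \<in> Q \<Longrightarrow> act_pt G T g p \<in> Q" for Q
      using that by (rule invariant_up_closed_eq)
    show "\<exists>p\<in>points T. act_pt G T g p \<noteq> flow p (pt_ht p + shift g)"
      if "g \<in> carrier G" "0 < shift g" for g
      using axis_all_imp_line[OF that] not_line by blast
    show "\<exists>g\<in>carrier G. 0 < shift g" by (rule hyperbolic_shift)
  qed
qed

end

lemma horo_tree_exists:
  assumes "finitely_generated_group G" "metric_G_tree G T" "fixes_an_end G T" "\<not> is_line T"
  obtains \<beta> up \<tau> where "horo_tree G T \<beta> up \<tau>"
proof -
  obtain \<pi> where "end_tree G T \<pi>" using end_tree_exists[OF assms] by blast
  then show ?thesis by (rule that[OF end_tree.horo_tree])
qed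

section \<open>Invariance under equivariant isometry\<close>

text \<open>Deformation spaces compare elliptic subgroups; cyclic subgroups turn this into a
  comparison of the zeros of the shifts.\<close>

lemma (in horo_tree) elliptic_generate_iff:
  assumes e: "e \<in> carrier G"
  shows "elliptic G T (generate G {e}) \<longleftrightarrow> \<tau> e = 0"
proof
  assume "elliptic G T (generate G {e})"
  then show "\<tau> e = 0" using elliptic_iff[OF e] generate.incl[of e "{e}" G] by (auto simp: elliptic_def)
next
  assume "\<tau> e = 0"
  then obtain p where p: "p \<in> P" "a e p = p" using elliptic_iff[OF e] by blast
  have "a h p = p \<and> h \<in> carrier G" if "h \<in> generate G {e}" for h
    using that
  proof induction
    case one
    then show ?case using p by (simp add: act_one)
  next
    case (inv h)
    then show ?case using act_inv(1)[OF e p(1)] p e by auto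
  next
    case (eng h k)
    then show ?case using p by (simp add: act_mult)
  qed (use p e in auto)
  then show "elliptic G T (generate G {e})" using p(1) by (auto simp: elliptic_def)
qed

lemma elliptic_isometry_imp:
  assumes iso: "(T, T') \<in> isometry_rel G" and H: "H \<subseteq> carrier G" and ell: "elliptic G T H"
  shows "elliptic G T' H"
proof -
  obtain f where f: "bij_betw f (points T) (points T')"
    "\<And>g p. g \<in> carrier G \<Longrightarrow> p \<in> points T \<Longrightarrow> f (act_pt G T g p) = act_pt G T' g (f p)"
    using iso unfolding isometry_rel_def equivariant_isometry_def by blast
  obtain p where p: "p \<in> points T" "\<And>h. h \<in> H \<Longrightarrow> act_pt G T h p = p"
    using ell by (auto simp: elliptic_def)
  have "act_pt G T' h (f p) = f p" if "h \<in> H" for h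
    using f(2)[of h p] p that H by auto
  then show ?thesis using bij_betwE[OF f(1)] p(1) by (auto simp: elliptic_def)
qed

text \<open>A class in two basic neighbourhoods may satisfy the two conditions through different
  representatives; composing with the isometry moves both conditions to one representative.\<close>

lemma gromov_close_isometry:
  assumes iso: "(T1, T2) \<in> isometry_rel G" and A: "A \<subseteq> carrier G"
    and close: "gromov_close G T X A \<epsilon> T1"
  shows "gromov_close G T X A \<epsilon> T2"
proof -
  obtain h where h: "bij_betw h (points T1) (points T2)"
    "\<And>p q. p \<in> points T1 \<Longrightarrow> q \<in> points T1 \<Longrightarrow> tdist T2 (h p) (h q) = tdist T1 p q"
    "\<And>g p. g \<in> carrier G \<Longrightarrow> p \<in> points T1 \<Longrightarrow> h (act_pt G T1 g p) = act_pt G T2 g (h p)"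
    and T1: "metric_G_tree G T1"
    using iso unfolding isometry_rel_def equivariant_isometry_def by blast
  obtain f where f: "f ` X \<subseteq> points T1" "\<forall>x\<in>X. \<forall>y\<in>X. \<forall>g\<in>A.
      \<bar>tdist T x (act_pt G T g y) - tdist T1 (f x) (act_pt G T1 g (f y))\<bar> < \<epsilon>"
    using close unfolding gromov_close_def by blast
  show ?thesis
  proof (rule gromov_closeI)
    show "(h \<circ> f) ` X \<subseteq> points T2" using f(1) bij_betwE[OF h(1)] by auto
    fix x y g assume xyg: "x \<in> X" "y \<in> X" "g \<in> A"
    then have fx: "f x \<in> points T1" "f y \<in> points T1" "g \<in> carrier G" using f(1) A by auto
    have "tdist T2 ((h \<circ> f) x) (act_pt G T2 g ((h \<circ> f) y)) = tdist T1 (f x) (act_pt G T1 g (f y))"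
      using h(2)[OF fx(1) act_pt_in_points[OF T1 fx(3,2)]] h(3)[OF fx(3,2)] by simp
    then show "\<bar>tdist T x (act_pt G T g y) - tdist T2 ((h \<circ> f) x) (act_pt G T2 g ((h \<circ> f) y))\<bar> < \<epsilon>"
      using f(2) xyg by simp
  qed
qed

section \<open>Classes in a deformation space and the Hausdorff property\<close>

lemma deformation_space_classD:
  fixes D :: "('g, 'v) gtree set set"
  assumes "deformation_space G D"
  shows "\<And>C T T'. C \<in> D \<Longrightarrow> T \<in> C \<Longrightarrow> T' \<in> C \<longleftrightarrow> (T, T') \<in> isometry_rel G"
    and "\<And>C. C \<in> D \<Longrightarrow> \<exists>T. T \<in> C"
    and "\<And>C T. C \<in> D \<Longrightarrow> T \<in> C \<Longrightarrow> metric_G_tree G T"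
    and "\<And>C T C' T' H. C \<in> D \<Longrightarrow> T \<in> C \<Longrightarrow> C' \<in> D \<Longrightarrow> T' \<in> C' \<Longrightarrow> subgroup H G \<Longrightarrow>
      elliptic G T H \<longleftrightarrow> elliptic G T' H"
proof -
  obtain T0 :: "('g, 'v) gtree" where D: "D = {T. metric_G_tree G T \<and>
      (\<forall>H. subgroup H G \<longrightarrow> (elliptic G T H \<longleftrightarrow> elliptic G T0 H))} // isometry_rel G"
    using assms unfolding deformation_space_def by blast
  have eqv: "equiv {T :: ('g, 'v) gtree. metric_G_tree G T} (isometry_rel G)"
    by (rule equiv_isometry_rel)
  have sym: "(T', T) \<in> isometry_rel G" if "(T, T') \<in> isometry_rel G" for T T' :: "('g, 'v) gtree"
    using eqv that by (auto elim: equivE dest: symD)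
  have trans: "(T, T'') \<in> isometry_rel G" if "(T, T') \<in> isometry_rel G" "(T', T'') \<in> isometry_rel G"
    for T T' T'' :: "('g, 'v) gtree"
    using eqv that by (meson equivE transD)
  have repr: "\<exists>S. metric_G_tree G S \<and> (\<forall>H. subgroup H G \<longrightarrow> (elliptic G S H \<longleftrightarrow> elliptic G T0 H)) \<and>
      C = isometry_rel G `` {S}" if "C \<in> D" for C
    using that unfolding D by (auto elim!: quotientE)
  show iff: "T' \<in> C \<longleftrightarrow> (T, T') \<in> isometry_rel G" if C: "C \<in> D" "T \<in> C" for C T T'
  proof -
    obtain S where S: "C = isometry_rel G `` {S}" using repr[OF C(1)] by blast
    then have "(S, T) \<in> isometry_rel G" using C(2) by blast
    then show ?thesis using S trans[of S T T'] trans[of T S T'] sym[of S T] by blast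
  qed
  show "\<exists>T. T \<in> C" if C: "C \<in> D" for C
  proof -
    obtain S where S: "metric_G_tree G S" "C = isometry_rel G `` {S}" using repr[OF C] by blast
    then have "(S, S) \<in> isometry_rel G" using eqv by (auto elim!: equivE dest: refl_onD)
    then show ?thesis using S by blast
  qed
  show "metric_G_tree G T" if "C \<in> D" "T \<in> C" for C T
    using repr[OF that(1)] that(2) by (auto simp: isometry_rel_def)
  have base: "elliptic G T H \<longleftrightarrow> elliptic G T0 H" if C: "C \<in> D" "T \<in> C" and H: "subgroup H G" for C T H
  proof -
    obtain S where S: "elliptic G S H \<longleftrightarrow> elliptic G T0 H" "(S, T) \<in> isometry_rel G"
      using repr[OF C(1)] C(2) H by blast
    then show ?thesis
      using elliptic_isometry_imp[OF S(2)] elliptic_isometry_imp[OF sym[OF S(2)]] subgroup.subset[OF H]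
      by blast
  qed
  show "elliptic G T H \<longleftrightarrow> elliptic G T' H"
    if "C \<in> D" "T \<in> C" "C' \<in> D" "T' \<in> C'" "subgroup H G" for C T C' T' H
    using base[OF that(1,2,5)] base[OF that(3,4,5)] by simp
qed

theorem proposition5p7:
  fixes G :: "('g, 'm) monoid_scheme" and D :: "('g, 'v) gtree set set"
  assumes "finitely_generated_group G"
    and "deformation_space G D"
    and "genuine_abelian G D"
  shows "Hausdorff_space (gromov_topology G D)"
  unfolding Hausdorff_space_def topspace_gromov[OF assms(2)]
proof (intro allI impI, elim conjE)
  fix C C' assume C: "C \<in> D" and C': "C' \<in> D" and ne: "C \<noteq> C'"
  note D = deformation_space_classD[OF assms(2)]
  interpret group G using assms(1) by (simp add: finitely_generated_group_def)
  obtain T where T: "T \<in> C" using D(2)[OF C] by blast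
  obtain T' where T': "T' \<in> C'" using D(2)[OF C'] by blast
  have horo: "\<exists>\<beta> up \<tau>. horo_tree G S \<beta> up \<tau>" if "B \<in> D" "S \<in> B" for B S
  proof -
    have "fixes_an_end G S" "\<not> is_line S" using assms(3) that by (auto simp: genuine_abelian_def)
    then show ?thesis by (rule horo_tree_exists[OF assms(1) D(3)[OF that]]) blast
  qed
  have elliptic_eq: "\<tau>' e = 0 \<longleftrightarrow> \<tau> e = 0"
    if B: "B \<in> D" "S \<in> B" "B' \<in> D" "S' \<in> B'"
      and h: "horo_tree G S \<beta> up \<tau>" "horo_tree G S' \<beta>' up' \<tau>'" and e: "e \<in> carrier G"
    for B S B' S' \<beta> up \<tau> \<beta>' up' \<tau>' e
    using D(4)[OF B generate_is_subgroup[of "{e}"]] horo_tree.elliptic_generate_iff[OF h(1) e]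
      horo_tree.elliptic_generate_iff[OF h(2) e] e by simp
  have self: "B \<in> gromov_nbhd G D S X A \<epsilon>"
    if "B \<in> D" "S \<in> B" "X \<subseteq> points S" "(0::real) < \<epsilon>" for B S X A \<epsilon>
  proof -
    have "gromov_close G S X A \<epsilon> S" by (rule gromov_closeI[of id]) (use that in auto)
    then show ?thesis using that by (auto simp: gromov_nbhd_def)
  qed
  show "\<exists>U V. openin (gromov_topology G D) U \<and> openin (gromov_topology G D) V \<and>
      C \<in> U \<and> C' \<in> V \<and> disjnt U V" (is ?separated)
  proof (rule ccontr)
    assume unsep: "\<not> ?thesis"
    obtain \<beta> up \<tau> where h: "horo_tree G T \<beta> up \<tau>" using horo[OF C T] by blast
    obtain \<beta>' up' \<tau>' where h': "horo_tree G T' \<beta>' up' \<tau>'" using horo[OF C' T'] by blast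
    have "unseparated_trees G T T' \<beta> up \<tau> \<beta>' up' \<tau>'"
    proof (intro unseparated_trees.intro unseparated_trees_axioms.intro h h')
      show "\<tau>' e = 0 \<longleftrightarrow> \<tau> e = 0" if "e \<in> carrier G" for e
        using elliptic_eq[OF C T C' T' h h' that] .
      fix X A \<epsilon> X' A' \<epsilon>'
      assume X: "finite X" "X \<subseteq> points T" "finite A" "A \<subseteq> carrier G" "(0::real) < \<epsilon>"
        and X': "finite X'" "X' \<subseteq> points T'" "finite A'" "A' \<subseteq> carrier G" "(0::real) < \<epsilon>'"
      \<comment> \<open>These sets are open and contain \<open>C\<close> and \<open>C'\<close>, so
        their disjointness would separate the two classes.\<close>
      have "\<not> disjnt (gromov_nbhd G D T X A \<epsilon>) (gromov_nbhd G D T' X' A' \<epsilon>')"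
      proof
        assume "disjnt (gromov_nbhd G D T X A \<epsilon>) (gromov_nbhd G D T' X' A' \<epsilon>')"
        then have ?separated
          using openin_gromov_nbhd[OF assms(2) X(1,3,4)] openin_gromov_nbhd[OF assms(2) X'(1,3,4)]
            self[OF C T X(2,5)] self[OF C' T' X'(2,5)]
          by (intro exI conjI)
        with unsep show False by (rule notE)
      qed
      then obtain B S S' where B: "B \<in> D" "S \<in> B" "S' \<in> B"
        and close: "gromov_close G T X A \<epsilon> S" "gromov_close G T' X' A' \<epsilon>' S'"
        unfolding disjnt_iff gromov_nbhd_def by blast
      have "(S', S) \<in> isometry_rel G" using D(1)[OF B(1,3)] B(2) by blast
      then have "gromov_close G T' X' A' \<epsilon>' S" by (rule gromov_close_isometry[OF _ X'(4) close(2)])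
      moreover obtain \<beta>'' up'' \<tau>'' where h'': "horo_tree G S \<beta>'' up'' \<tau>''"
        using horo[OF B(1,2)] by blast
      moreover have "\<forall>e\<in>carrier G. \<tau>'' e = 0 \<longleftrightarrow> \<tau> e = 0"
        using elliptic_eq[OF C T B(1,2) h h''] by blast
      ultimately show "\<exists>T'' \<beta>'' up'' \<tau>''. horo_tree G T'' \<beta>'' up'' \<tau>'' \<and>
          (\<forall>e\<in>carrier G. \<tau>'' e = 0 \<longleftrightarrow> \<tau> e = 0) \<and>
          gromov_close G T X A \<epsilon> T'' \<and> gromov_close G T' X' A' \<epsilon>' T''"
        using close(1) by (intro exI conjI)
    qed
    then obtain f where "equivariant_isometry G T T' f"
      using unseparated_trees.equivariant_isometry_exists by blast
    then have "(T, T') \<in> isometry_rel G"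
      using D(3)[OF C T] D(3)[OF C' T'] by (auto simp: isometry_rel_def)
    then have mem: "T' \<in> C" using D(1)[OF C T, of T'] by simp
    have "S \<in> C \<longleftrightarrow> S \<in> C'" for S
      using D(1)[OF C mem, of S] D(1)[OF C' T', of S] by simp
    then have "C = C'" by blast
    then show False using ne by contradiction
  qed
qed

end
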